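(* Let $\pi:(M,g)\to(B,h)$ be a semi-Riemannian submersion, $\mathcal P\subset B$ a non-degenerate submanifold and $\mathcal Q=\pi^{-1}(\mathcal P)$ its total lift. If $V$ is a vertical vector, $X$ is a horizontal vector tangent to $\mathcal Q$ and $Z$ is a vector orthogonal to $\mathcal Q$ (all at the same point of $\mathcal Q$), then $$\mathcal S^{\mathcal Q}(V,Z)=T_V(Z)+A_Z(V)^{\mathrm t},$$ $$\mathcal S^{\mathcal Q}(X,Z)=A_X(Z)+\mathcal S^{\mathcal P}(X,Z),$$ where $\mathrm t$ denotes the part tangent to $\mathcal P$ for vectors in $TB$ and the part tangent to $\mathcal Q$ for vectors in $TM$.
   Context: A semi-Riemannian submersion $\pi:(M,g)\to(B,h)$ is a smooth submersion between semi-Riemannian manifolds whose fibers are non-degenerate and such that $\mathrm d\pi_p$ restricts to an isometry from the horizontal space $(\mathrm{Ker}\,\mathrm d\pi_p)^\perp$ onto $T_{\pi(p)}B$. Let $\mathcal V$ and $\mathcal H$ be the orthogonal projections of $TM$ onto the vertical spaces $\mathrm{Ker}\,\mathrm d\pi_p$ and the horizontal spaces, and $\nabla$ the Levi-Civita connection of $g$. O'Neill's tensors: $T_E(F)=\mathcal H\nabla_{\mathcal VE}(\mathcal VF)+\mathcal V\nabla_{\mathcal VE}(\mathcal HF)$, $A_E(F)=\mathcal H\nabla_{\mathcal HE}(\mathcal VF)+\mathcal V\nabla_{\mathcal HE}(\mathcal HF)$. The total lift $\mathcal Q$ is a non-degenerate submanifold of $M$ whose tangent spaces contain the vertical spaces,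 so vectors orthogonal to $\mathcal Q$ are horizontal. For a non-degenerate submanifold $\mathcal N$, $\mathcal S^{\mathcal N}_q(v,w)=(\nabla_vW)^{\mathrm t}$ for $v\in T_q\mathcal N$, $w\in(T_q\mathcal N)^\perp$, where $W$ is any extension of $w$ to a vector field orthogonal to $\mathcal N$ and $\mathrm t$ is the component tangent to $\mathcal N$; for $\mathcal P$ the Levi-Civita connection of $B$ is used. Horizontal vectors of $M$ are identified with tangent vectors to $B$ through $\mathrm d\pi$: in $\mathcal S^{\mathcal P}(X,Z)$, $X,Z$ stand for $\mathrm d\pi(X),\mathrm d\pi(Z)$, and the result is lifted horizontally. *)

theory Defs
  imports "HOL-Analysis.Analysis" "HOL-Library.Function_Algebras"
begin

text \<open>Real-valued functionals form a real vector space under the pointwise operations; tangent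
  vectors below are such functionals, so each tangent space is a linear subspace of this type.\<close>

instantiation "fun" :: (type, real_vector) real_vector
begin

definition scaleR_fun :: "real \<Rightarrow> ('a \<Rightarrow> 'b) \<Rightarrow> 'a \<Rightarrow> 'b" where
  "scaleR_fun a f = (\<lambda>x. a *\<^sub>R f x)"

instance
  by standard (simp_all add: scaleR_fun_def fun_eq_iff algebra_simps)

end


section \<open>Smooth manifolds\<close>

primrec Ck_on ::
  "nat \<Rightarrow> 'a::real_normed_vector set \<Rightarrow> ('a \<Rightarrow> 'b::real_normed_vector) \<Rightarrow> bool" where
  "Ck_on 0 S f \<longleftrightarrow> continuous_on S f"
| "Ck_on (Suc k) S f \<longleftrightarrow> (\<forall>x\<in>S. f differentiable (at x)) \<and>
     (\<forall>v. Ck_on k S (\<lambda>x. frechet_derivative f (at x) v))"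

text \<open>Only meaningful, and only used, for open \<open>S\<close> in a finite-dimensional space.\<close>

definition smooth_on ::
  "'a::real_normed_vector set \<Rightarrow> ('a \<Rightarrow> 'b::real_normed_vector) \<Rightarrow> bool" where
  "smooth_on S f \<longleftrightarrow> (\<forall>k. Ck_on k S f)"

text \<open>A chart is a pair of its domain \<open>U\<close> and a coordinate map, whose values outside \<open>U\<close> are
  irrelevant.\<close>

type_synonym ('a, 'e) chart = "'a set \<times> ('a \<Rightarrow> 'e)"

record ('a, 'e) manifold =
  mtop :: "'a topology"
  charts :: "('a, 'e) chart set"

abbreviation points :: "('a, 'e::euclidean_space) manifold \<Rightarrow> 'a set" where
  "points M \<equiv> topspace (mtop M)"

definition is_chart :: "'a topology \<Rightarrow> ('a, 'e::euclidean_space) chart \<Rightarrow> bool" where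
  "is_chart X = (\<lambda>(U, \<phi>). openin X U \<and> open (\<phi> ` U) \<and>
     homeomorphic_map (subtopology X U) (top_of_set (\<phi> ` U)) \<phi>)"

definition smoothly_compatible ::
  "('a, 'e::euclidean_space) chart \<Rightarrow> ('a, 'e) chart \<Rightarrow> bool" where
  "smoothly_compatible = (\<lambda>(U, \<phi>) (V, \<psi>).
     smooth_on (\<phi> ` (U \<inter> V)) (\<psi> \<circ> inv_into U \<phi>) \<and>
     smooth_on (\<psi> ` (U \<inter> V)) (\<phi> \<circ> inv_into V \<psi>))"

text \<open>The last condition says that the atlas is maximal.\<close>

definition smooth_manifold :: "('a, 'e::euclidean_space) manifold \<Rightarrow> bool" where
  "smooth_manifold M \<longleftrightarrow>
     Hausdorff_space (mtop M) \<and> second_countable (mtop M) \<and>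
     (\<forall>c\<in>charts M. is_chart (mtop M) c) \<and>
     (\<Union>c\<in>charts M. fst c) = points M \<and>
     (\<forall>c\<in>charts M. \<forall>d\<in>charts M. smoothly_compatible c d) \<and>
     (\<forall>c. is_chart (mtop M) c \<and> (\<forall>d\<in>charts M. smoothly_compatible c d) \<longrightarrow> c \<in> charts M)"

text \<open>Smoothness of \<open>f\<close> on some open neighbourhood of \<open>p\<close>; the values of \<open>f\<close> away from \<open>p\<close>
  do not matter, so \<open>f\<close> stands for its germ at \<open>p\<close>.\<close>

definition smooth_at :: "('a, 'e::euclidean_space) manifold \<Rightarrow> 'a \<Rightarrow> ('a \<Rightarrow> real) \<Rightarrow> bool" where
  "smooth_at M p f \<longleftrightarrow> (\<exists>(U, \<phi>)\<in>charts M. \<exists>W. openin (mtop M) W \<and> p \<in> W \<and> W \<subseteq> U \<and>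
     smooth_on (\<phi> ` W) (f \<circ> inv_into U \<phi>))"

definition smooth_map ::
  "('a, 'e::euclidean_space) manifold \<Rightarrow> ('b, 'f::euclidean_space) manifold \<Rightarrow> ('a \<Rightarrow> 'b) \<Rightarrow> bool" where
  "smooth_map M B F \<longleftrightarrow> F \<in> points M \<rightarrow> points B \<and>
     (\<forall>p\<in>points M. \<exists>(U, \<phi>)\<in>charts M. \<exists>(V, \<psi>)\<in>charts B. \<exists>W.
        openin (mtop M) W \<and> p \<in> W \<and> W \<subseteq> U \<and> F ` W \<subseteq> V \<and>
        smooth_on (\<phi> ` W) (\<psi> \<circ> F \<circ> inv_into U \<phi>))"

text \<open>Curves are considered near the parameter \<open>0\<close> only.\<close>

definition smooth_curve :: "('a, 'e::euclidean_space) manifold \<Rightarrow> (real \<Rightarrow> 'a) \<Rightarrow> bool" where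
  "smooth_curve M \<gamma> \<longleftrightarrow> (\<exists>(U, \<phi>)\<in>charts M. \<exists>\<epsilon>>0. \<gamma> ` {-\<epsilon><..<\<epsilon>} \<subseteq> U \<and>
     smooth_on {-\<epsilon><..<\<epsilon>} (\<phi> \<circ> \<gamma>))"


section \<open>Tangent vectors and vector fields\<close>

text \<open>The tangent vector \<open>\<gamma>'(0)\<close> is the operator that differentiates smooth germs at \<open>\<gamma> 0\<close> along
  \<open>\<gamma>\<close>. It is set to \<open>0\<close> on functions that are not smooth near \<open>\<gamma> 0\<close>, so that equality of
  functionals is equality of tangent vectors at a point. A tangent vector does not determine its
  base point (the zero vectors coincide), which is why base points are passed explicitly below.\<close>

type_synonym 'a tvec = "('a \<Rightarrow> real) \<Rightarrow> real"
type_synonym 'a vfield = "'a \<Rightarrow> 'a tvec"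
type_synonym 'a metric = "'a \<Rightarrow> 'a tvec \<Rightarrow> 'a tvec \<Rightarrow> real"

definition velocity :: "('a, 'e::euclidean_space) manifold \<Rightarrow> (real \<Rightarrow> 'a) \<Rightarrow> 'a tvec" where
  "velocity M \<gamma> = (\<lambda>f. if smooth_at M (\<gamma> 0) f then deriv (f \<circ> \<gamma>) 0 else 0)"

definition tangent_space :: "('a, 'e::euclidean_space) manifold \<Rightarrow> 'a \<Rightarrow> 'a tvec set" where
  "tangent_space M p = {velocity M \<gamma> | \<gamma>. smooth_curve M \<gamma> \<and> \<gamma> 0 = p}"

definition differential ::
  "('b, 'f::euclidean_space) manifold \<Rightarrow> ('a \<Rightarrow> 'b) \<Rightarrow> 'a \<Rightarrow> 'a tvec \<Rightarrow> 'b tvec" where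
  "differential B F p v = (\<lambda>f. if smooth_at B (F p) f then v (f \<circ> F) else 0)"

text \<open>Vector fields that are defined and smooth on some neighbourhood of \<open>p\<close>: locally they take
  values in the tangent spaces and map smooth functions to smooth functions.\<close>

definition smooth_field_at ::
  "('a, 'e::euclidean_space) manifold \<Rightarrow> 'a \<Rightarrow> 'a vfield \<Rightarrow> bool" where
  "smooth_field_at M p W \<longleftrightarrow> (\<exists>U. openin (mtop M) U \<and> p \<in> U \<and>
     (\<forall>q\<in>U. W q \<in> tangent_space M q \<and>
        (\<forall>f. smooth_at M q f \<longrightarrow> smooth_at M q (\<lambda>x. W x f))))"

definition lie_bracket ::
  "('a, 'e::euclidean_space) manifold \<Rightarrow> 'a \<Rightarrow> 'a vfield \<Rightarrow> 'a vfield \<Rightarrow> 'a tvec" where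
  "lie_bracket M p V W =
     (\<lambda>f. if smooth_at M p f then V p (\<lambda>x. W x f) - W p (\<lambda>x. V x f) else 0)"


section \<open>Semi-Riemannian metrics and the Levi-Civita connection\<close>

definition nondegenerate_on :: "'a metric \<Rightarrow> 'a \<Rightarrow> 'a tvec set \<Rightarrow> bool" where
  "nondegenerate_on g p S \<longleftrightarrow> (\<forall>v\<in>S. (\<forall>w\<in>S. g p v w = 0) \<longrightarrow> v = 0)"

definition metric_index :: "('a, 'e::euclidean_space) manifold \<Rightarrow> 'a metric \<Rightarrow> 'a \<Rightarrow> nat" where
  "metric_index M g p = Max {dim W | W. subspace W \<and> W \<subseteq> tangent_space M p \<and>
     (\<forall>w\<in>W. w \<noteq> 0 \<longrightarrow> g p w w < 0)}"

definition semi_riemannian_manifold ::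
  "('a, 'e::euclidean_space) manifold \<Rightarrow> 'a metric \<Rightarrow> bool" where
  "semi_riemannian_manifold M g \<longleftrightarrow> smooth_manifold M \<and>
     (\<forall>p\<in>points M. \<forall>u\<in>tangent_space M p. \<forall>v\<in>tangent_space M p. \<forall>w\<in>tangent_space M p. \<forall>a b.
        g p (a *\<^sub>R u + b *\<^sub>R v) w = a * g p u w + b * g p v w) \<and>
     (\<forall>p\<in>points M. \<forall>v\<in>tangent_space M p. \<forall>w\<in>tangent_space M p. g p v w = g p w v) \<and>
     (\<forall>p\<in>points M. nondegenerate_on g p (tangent_space M p)) \<and>
     (\<forall>p\<in>points M. \<forall>V W. smooth_field_at M p V \<longrightarrow> smooth_field_at M p W \<longrightarrow>
        smooth_at M p (\<lambda>q. g q (V q) (W q))) \<and>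
     (\<exists>\<nu>. \<forall>p\<in>points M. metric_index M g p = \<nu>)"

text \<open>\<open>nabla p v W\<close> is the covariant derivative at \<open>p\<close> of the vector field \<open>W\<close>, smooth near \<open>p\<close>,
  in the direction of the tangent vector \<open>v\<close> at \<open>p\<close>. Stating the axioms for locally defined
  fields makes \<open>nabla\<close> depend only on germs of fields, so no cut-off functions are needed to
  differentiate local extensions.\<close>

type_synonym 'a connection = "'a \<Rightarrow> 'a tvec \<Rightarrow> 'a vfield \<Rightarrow> 'a tvec"

definition affine_connection ::
  "('a, 'e::euclidean_space) manifold \<Rightarrow> 'a connection \<Rightarrow> bool" where
  "affine_connection M nabla \<longleftrightarrow>
     (\<forall>p\<in>points M. \<forall>v\<in>tangent_space M p. \<forall>W. smooth_field_at M p W \<longrightarrow>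
        nabla p v W \<in> tangent_space M p) \<and>
     (\<forall>p\<in>points M. \<forall>u\<in>tangent_space M p. \<forall>v\<in>tangent_space M p. \<forall>W a b. smooth_field_at M p W \<longrightarrow>
        nabla p (a *\<^sub>R u + b *\<^sub>R v) W = a *\<^sub>R nabla p u W + b *\<^sub>R nabla p v W) \<and>
     (\<forall>p\<in>points M. \<forall>v\<in>tangent_space M p. \<forall>W W'.
        smooth_field_at M p W \<longrightarrow> smooth_field_at M p W' \<longrightarrow>
        nabla p v (\<lambda>q. W q + W' q) = nabla p v W + nabla p v W') \<and>
     (\<forall>p\<in>points M. \<forall>v\<in>tangent_space M p. \<forall>f W. smooth_at M p f \<longrightarrow> smooth_field_at M p W \<longrightarrow>
        nabla p v (\<lambda>q. f q *\<^sub>R W q) = v f *\<^sub>R W p + f p *\<^sub>R nabla p v W) \<and>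
     (\<forall>p\<in>points M. \<forall>V W. smooth_field_at M p V \<longrightarrow> smooth_field_at M p W \<longrightarrow>
        smooth_field_at M p (\<lambda>q. nabla q (V q) W))"

definition levi_civita ::
  "('a, 'e::euclidean_space) manifold \<Rightarrow> 'a metric \<Rightarrow> 'a connection \<Rightarrow> bool" where
  "levi_civita M g nabla \<longleftrightarrow> affine_connection M nabla \<and>
     (\<forall>p\<in>points M. \<forall>V W. smooth_field_at M p V \<longrightarrow> smooth_field_at M p W \<longrightarrow>
        nabla p (V p) W - nabla p (W p) V = lie_bracket M p V W) \<and>
     (\<forall>p\<in>points M. \<forall>v\<in>tangent_space M p. \<forall>W Z.
        smooth_field_at M p W \<longrightarrow> smooth_field_at M p Z \<longrightarrow>
        v (\<lambda>q. g q (W q) (Z q)) = g p (nabla p v W) (Z p) + g p (W p) (nabla p v Z))"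

definition orth_complement ::
  "('a, 'e::euclidean_space) manifold \<Rightarrow> 'a metric \<Rightarrow> 'a \<Rightarrow> 'a tvec set \<Rightarrow> 'a tvec set" where
  "orth_complement M g p S = {v \<in> tangent_space M p. \<forall>w\<in>S. g p v w = 0}"

text \<open>Orthogonal projection onto a non-degenerate subspace \<open>S\<close> of the tangent space at \<open>p\<close>.\<close>

definition orth_projection :: "'a metric \<Rightarrow> 'a \<Rightarrow> 'a tvec set \<Rightarrow> 'a tvec \<Rightarrow> 'a tvec" where
  "orth_projection g p S v = (THE w. w \<in> S \<and> (\<forall>u\<in>S. g p (v - w) u = 0))"


section \<open>Non-degenerate submanifolds and the operator S\<close>

text \<open>Embedded submanifolds of constant dimension \<open>k\<close> (possibly \<open>0\<close>), given by slice charts.\<close>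

definition submanifold :: "('a, 'e::euclidean_space) manifold \<Rightarrow> 'a set \<Rightarrow> bool" where
  "submanifold M N \<longleftrightarrow> N \<subseteq> points M \<and>
     (\<exists>k. \<forall>p\<in>N. \<exists>(U, \<phi>)\<in>charts M. \<exists>S. p \<in> U \<and> subspace S \<and> dim S = k \<and>
        \<phi> ` (U \<inter> N) = \<phi> ` U \<inter> S)"

text \<open>Tangent spaces of \<open>N\<close> as subspaces of the ambient tangent spaces.\<close>

definition sub_tangent_space ::
  "('a, 'e::euclidean_space) manifold \<Rightarrow> 'a set \<Rightarrow> 'a \<Rightarrow> 'a tvec set" where
  "sub_tangent_space M N p =
     {velocity M \<gamma> | \<gamma>. smooth_curve M \<gamma> \<and> \<gamma> 0 = p \<and> (\<forall>\<^sub>F t in nhds 0. \<gamma> t \<in> N)}"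

definition nondegenerate_submanifold ::
  "('a, 'e::euclidean_space) manifold \<Rightarrow> 'a metric \<Rightarrow> 'a set \<Rightarrow> bool" where
  "nondegenerate_submanifold M g N \<longleftrightarrow> submanifold M N \<and>
     (\<forall>p\<in>N. nondegenerate_on g p (sub_tangent_space M N p))"

definition normal_subspace ::
  "('a, 'e::euclidean_space) manifold \<Rightarrow> 'a metric \<Rightarrow> 'a set \<Rightarrow> 'a \<Rightarrow> 'a tvec set" where
  "normal_subspace M g N p = orth_complement M g p (sub_tangent_space M N p)"

definition tangential_part ::
  "('a, 'e::euclidean_space) manifold \<Rightarrow> 'a metric \<Rightarrow> 'a set \<Rightarrow> 'a \<Rightarrow> 'a tvec \<Rightarrow> 'a tvec" where
  "tangential_part M g N p v = orth_projection g p (sub_tangent_space M N p) v"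

text \<open>Extensions of \<open>w\<close>: vector fields of the ambient manifold, smooth near \<open>p\<close>, that are
  orthogonal to \<open>N\<close> at the points of \<open>N\<close> near \<open>p\<close>.\<close>

definition normal_extension ::
  "('a, 'e::euclidean_space) manifold \<Rightarrow> 'a metric \<Rightarrow> 'a set \<Rightarrow> 'a \<Rightarrow> 'a tvec \<Rightarrow> 'a vfield \<Rightarrow> bool" where
  "normal_extension M g N p w W \<longleftrightarrow> smooth_field_at M p W \<and> W p = w \<and>
     (\<exists>U. openin (mtop M) U \<and> p \<in> U \<and> (\<forall>q\<in>U \<inter> N. W q \<in> normal_subspace M g N q))"

definition shape_operator ::
  "('a, 'e::euclidean_space) manifold \<Rightarrow> 'a metric \<Rightarrow> 'a connection \<Rightarrow> 'a set \<Rightarrow> 'a \<Rightarrow>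
   'a tvec \<Rightarrow> 'a tvec \<Rightarrow> 'a tvec" where
  "shape_operator M g nabla N p v w =
     (THE u. \<exists>W. normal_extension M g N p w W \<and> u = tangential_part M g N p (nabla p v W))"


section \<open>Semi-Riemannian submersions and O'Neill's tensors\<close>

definition vertical_space ::
  "('a, 'e::euclidean_space) manifold \<Rightarrow> ('b, 'f::euclidean_space) manifold \<Rightarrow> ('a \<Rightarrow> 'b) \<Rightarrow>
   'a \<Rightarrow> 'a tvec set" where
  "vertical_space M B \<pi> p = {v \<in> tangent_space M p. differential B \<pi> p v = 0}"

definition horizontal_space ::
  "('a, 'e::euclidean_space) manifold \<Rightarrow> 'a metric \<Rightarrow> ('b, 'f::euclidean_space) manifold \<Rightarrow>
   ('a \<Rightarrow> 'b) \<Rightarrow> 'a \<Rightarrow> 'a tvec set" where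
  "horizontal_space M g B \<pi> p = orth_complement M g p (vertical_space M B \<pi> p)"

text \<open>The tangent space at \<open>p\<close> of the fibre through \<open>p\<close> is the vertical space, so non-degeneracy
  of the fibres is non-degeneracy of all vertical spaces. Surjectivity of \<open>\<pi>\<close> is not required.\<close>

definition semi_riemannian_submersion ::
  "('a, 'e::euclidean_space) manifold \<Rightarrow> 'a metric \<Rightarrow> ('b, 'f::euclidean_space) manifold \<Rightarrow>
   'b metric \<Rightarrow> ('a \<Rightarrow> 'b) \<Rightarrow> bool" where
  "semi_riemannian_submersion M g B h \<pi> \<longleftrightarrow>
     semi_riemannian_manifold M g \<and> semi_riemannian_manifold B h \<and> smooth_map M B \<pi> \<and>
     (\<forall>p\<in>points M.
        differential B \<pi> p ` tangent_space M p = tangent_space B (\<pi> p) \<and>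
        nondegenerate_on g p (vertical_space M B \<pi> p) \<and>
        bij_betw (differential B \<pi> p) (horizontal_space M g B \<pi> p) (tangent_space B (\<pi> p)) \<and>
        (\<forall>x\<in>horizontal_space M g B \<pi> p. \<forall>y\<in>horizontal_space M g B \<pi> p.
           h (\<pi> p) (differential B \<pi> p x) (differential B \<pi> p y) = g p x y))"

definition vertical_part ::
  "('a, 'e::euclidean_space) manifold \<Rightarrow> 'a metric \<Rightarrow> ('b, 'f::euclidean_space) manifold \<Rightarrow>
   ('a \<Rightarrow> 'b) \<Rightarrow> 'a \<Rightarrow> 'a tvec \<Rightarrow> 'a tvec" where
  "vertical_part M g B \<pi> p v = orth_projection g p (vertical_space M B \<pi> p) v"

definition horizontal_part ::
  "('a, 'e::euclidean_space) manifold \<Rightarrow> 'a metric \<Rightarrow> ('b, 'f::euclidean_space) manifold \<Rightarrow>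
   ('a \<Rightarrow> 'b) \<Rightarrow> 'a \<Rightarrow> 'a tvec \<Rightarrow> 'a tvec" where
  "horizontal_part M g B \<pi> p v = orth_projection g p (horizontal_space M g B \<pi> p) v"

definition horizontal_lift ::
  "('a, 'e::euclidean_space) manifold \<Rightarrow> 'a metric \<Rightarrow> ('b, 'f::euclidean_space) manifold \<Rightarrow>
   ('a \<Rightarrow> 'b) \<Rightarrow> 'a \<Rightarrow> 'b tvec \<Rightarrow> 'a tvec" where
  "horizontal_lift M g B \<pi> p u =
     (THE x. x \<in> horizontal_space M g B \<pi> p \<and> differential B \<pi> p x = u)"

text \<open>O'Neill's tensors evaluated at tangent vectors \<open>e\<close>, \<open>f\<close> at \<open>p\<close>; as the expressions are
  tensorial, \<open>f\<close> may be extended to any vector field \<open>F\<close>.\<close>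

definition oneill_T ::
  "('a, 'e::euclidean_space) manifold \<Rightarrow> 'a metric \<Rightarrow> 'a connection \<Rightarrow>
   ('b, 'f::euclidean_space) manifold \<Rightarrow> ('a \<Rightarrow> 'b) \<Rightarrow> 'a \<Rightarrow> 'a tvec \<Rightarrow> 'a tvec \<Rightarrow> 'a tvec" where
  "oneill_T M g nabla B \<pi> p e f =
     (let ver = vertical_part M g B \<pi>; hor = horizontal_part M g B \<pi> in
      THE u. \<exists>F. smooth_field_at M p F \<and> F p = f \<and>
        u = hor p (nabla p (ver p e) (\<lambda>q. ver q (F q))) + ver p (nabla p (ver p e) (\<lambda>q. hor q (F q))))"

definition oneill_A ::
  "('a, 'e::euclidean_space) manifold \<Rightarrow> 'a metric \<Rightarrow> 'a connection \<Rightarrow>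
   ('b, 'f::euclidean_space) manifold \<Rightarrow> ('a \<Rightarrow> 'b) \<Rightarrow> 'a \<Rightarrow> 'a tvec \<Rightarrow> 'a tvec \<Rightarrow> 'a tvec" where
  "oneill_A M g nabla B \<pi> p e f =
     (let ver = vertical_part M g B \<pi>; hor = horizontal_part M g B \<pi> in
      THE u. \<exists>F. smooth_field_at M p F \<and> F p = f \<and>
        u = hor p (nabla p (hor p e) (\<lambda>q. ver q (F q))) + ver p (nabla p (hor p e) (\<lambda>q. hor q (F q))))"

definition total_lift ::
  "('a, 'e::euclidean_space) manifold \<Rightarrow> ('a \<Rightarrow> 'b) \<Rightarrow> 'b set \<Rightarrow> 'a set" where
  "total_lift M \<pi> P = {x \<in> points M. \<pi> x \<in> P}"

end

theory Submission
  imports Defs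
begin

text \<open>Extend \<open>Z\<close> by the basic field \<open>W\<close>, the horizontal lift of an extension \<open>w\<close> of
  \<open>d\<pi>(Z)\<close> to a field normal to \<open>P\<close>; it is normal to \<open>Q\<close>. Since \<open>W\<close> is horizontal near the
  point, \<open>T\<^sub>V Z\<close> and \<open>A\<^sub>X Z\<close> are the vertical parts of \<open>\<nabla>\<^sub>V W\<close> and \<open>\<nabla>\<^sub>X W\<close>. The remaining
  horizontal parts are read off from \<open>d\<pi>\<close>: if \<open>F\<close> is a vertical extension of \<open>V\<close>, then \<open>[F, W]\<close>
  is \<open>\<pi>\<close>-related to \<open>[0, w] = 0\<close>, so \<open>\<nabla>\<^sub>V W\<close> and \<open>\<nabla>\<^sub>Z F\<close> have the same horizontal part, and
  \<open>d\<pi>(\<nabla>\<^sub>X W)\<close> is the derivative of \<open>w\<close> along \<open>d\<pi>(X)\<close>. Finally the tangent spaces of \<open>Q\<close> are the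
  preimages of those of \<open>P\<close>, because curves lift through submersions; this identifies the two
  tangential parts.\<close>

section \<open>Smooth maps between Euclidean spaces\<close>

text \<open>Both \<open>shape_operator\<close> and the O'Neill tensors are definite descriptions
  over all extensions of a vector, so nothing can be computed before independence of the extension
  is known. Metric compatibility gives it in every case: if g(W, Y) = 0 along the direction of
  differentiation, then g(nabla_v W, Y) = - g(W, nabla_v Y), and the right side sees only the value
  of \<open>W\<close> at the point. The other obstacle is to produce smooth fields: horizontal
  lifts, tangential components, normal extensions. Each rests on a Gram system with smooth
  coefficients that is nondegenerate at one point. The metrics are indefinite, so Gram-Schmidt could
  meet null vectors; elimination over the ring of smooth germs replaces it, and the same elimination
  shows that a local inverse of a smooth map is smooth. The total lift enters through its tangent
  spaces: its tangential projection is assembled from those of the fibres and of \<open>P\<close>,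
  and its tangent fields from vertical fields and lifts of fields tangent to \<open>P\<close>, so no
  slice charts of \<open>Q\<close> are constructed.\<close>

lemma frechet_derivative_eqI:
  "(f has_derivative f') (at x) \<Longrightarrow> frechet_derivative f (at x) = f'"
  using frechet_derivative_at by metis

text \<open>On an open set, agreement on \<open>S\<close> is agreement of germs, so the derivatives
  agree on \<open>S\<close> as well and the induction passes to them.\<close>

lemma Ck_on_cong:
  assumes "open S" "\<And>x. x \<in> S \<Longrightarrow> f x = g x" "Ck_on k S f"
  shows "Ck_on k S g"
  using assms(2,3)
proof (induction k arbitrary: f g)
  case 0
  then show ?case by (simp cong: continuous_on_cong)
next
  case (Suc k)
  have der: "(g has_derivative frechet_derivative f (at x)) (at x)" if "x \<in> S" for x
    using Suc.prems that assms(1)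
    by (intro has_derivative_transform_within_open[where f = f and g = g and s = S])
      (auto simp: frechet_derivative_works[symmetric])
  have "Ck_on k S (\<lambda>x. frechet_derivative g (at x) v)" for v
    by (rule Suc.IH[of "\<lambda>x. frechet_derivative f (at x) v"])
      (use Suc.prems frechet_derivative_eqI[OF der] in auto)
  with der show ?case by (auto simp: differentiable_def)
qed

text \<open>Lets a derivative be supplied as an explicit family, arbitrary off \<open>S\<close>;
  \<open>Ck_on_cong\<close> then exchanges it for \<open>frechet_derivative\<close>.\<close>

lemma Ck_on_SucI:
  assumes "open S" "\<And>x. x \<in> S \<Longrightarrow> (f has_derivative f' x) (at x)"
    "\<And>v. Ck_on k S (\<lambda>x. f' x v)"
  shows "Ck_on (Suc k) S f"
proof -
  have "Ck_on k S (\<lambda>x. frechet_derivative f (at x) v)" for v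
    by (rule Ck_on_cong[OF assms(1) _ assms(3)[of v]]) (simp add: frechet_derivative_eqI[OF assms(2)])
  with assms(2) show ?thesis by (auto simp: differentiable_def)
qed

lemma Ck_on_SucE:
  assumes "Ck_on (Suc k) S f"
  obtains f' where "\<And>x. x \<in> S \<Longrightarrow> (f has_derivative f' x) (at x)"
    "\<And>v. Ck_on k S (\<lambda>x. f' x v)"
  using assms that[of "\<lambda>x. frechet_derivative f (at x)"]
  by (simp add: frechet_derivative_works[symmetric])

lemma Ck_on_continuous: "Ck_on k S f \<Longrightarrow> continuous_on S f"
proof (cases k)
  case (Suc n)
  assume "Ck_on k S f"
  then have "\<forall>x\<in>S. f differentiable (at x)" by (simp add: Suc)
  then show ?thesis
    by (intro continuous_at_imp_continuous_on ballI) (auto intro: differentiable_imp_continuous_within)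
qed auto

lemma Ck_on_Suc_imp: "Ck_on (Suc k) S f \<Longrightarrow> Ck_on k S f"
proof (induction k arbitrary: f)
  case 0
  then show ?case using Ck_on_continuous[OF 0] by simp
qed auto

lemma Ck_on_subset: "Ck_on k S f \<Longrightarrow> T \<subseteq> S \<Longrightarrow> Ck_on k T f"
  by (induction k arbitrary: f) (auto intro: continuous_on_subset)

text \<open>The gluing step of \<open>smooth_on_local_inverse\<close>, where regularity is obtained
  on a neighbourhood that depends on the point.\<close>

lemma Ck_on_UN:
  assumes "\<And>T. T \<in> \<T> \<Longrightarrow> open T" "\<And>T. T \<in> \<T> \<Longrightarrow> Ck_on k T f"
  shows "Ck_on k (\<Union>\<T>) f"
  using assms(2)
proof (induction k arbitrary: f)
  case 0
  then show ?case using assms(1) by (auto intro: continuous_on_open_Union)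
qed auto

lemma Ck_on_const: "Ck_on k S (\<lambda>x. c)"
  by (induction k arbitrary: c) (auto simp: frechet_derivative_const)

lemma Ck_on_linear:
  assumes "open S" "bounded_linear h" "Ck_on k S f"
  shows "Ck_on k S (\<lambda>x. h (f x))"
  using assms(3)
proof (induction k arbitrary: f)
  case 0
  then show ?case by (simp add: bounded_linear.continuous_on[OF assms(2)])
next
  case (Suc k)
  from Suc.prems obtain f' where "\<And>x. x \<in> S \<Longrightarrow> (f has_derivative f' x) (at x)"
    "\<And>v. Ck_on k S (\<lambda>x. f' x v)" by (rule Ck_on_SucE) blast
  then show ?case
    by (intro Ck_on_SucI[where f' = "\<lambda>x v. h (f' x v)"])
      (auto intro: assms Suc.IH bounded_linear.has_derivative)
qed

lemma Ck_on_id: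
  assumes "open S"
  shows "Ck_on k S (\<lambda>x. x)"
proof (cases k)
  case (Suc n)
  then show ?thesis using assms Ck_on_const
    by (auto intro!: Ck_on_SucI[where f' = "\<lambda>x v. v"] simp del: Ck_on.simps)
qed auto

lemma Ck_on_add:
  assumes "open S" "Ck_on k S f" "Ck_on k S g"
  shows "Ck_on k S (\<lambda>x. f x + g x)"
  using assms(2,3)
proof (induction k arbitrary: f g)
  case 0
  then show ?case by (auto intro: continuous_intros)
next
  case (Suc k)
  from Suc.prems(1) obtain f' where "\<And>x. x \<in> S \<Longrightarrow> (f has_derivative f' x) (at x)"
    "\<And>v. Ck_on k S (\<lambda>x. f' x v)" by (rule Ck_on_SucE) blast
  moreover from Suc.prems(2) obtain g' where "\<And>x. x \<in> S \<Longrightarrow> (g has_derivative g' x) (at x)"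
    "\<And>v. Ck_on k S (\<lambda>x. g' x v)" by (rule Ck_on_SucE) blast
  ultimately show ?case
    by (intro Ck_on_SucI[where f' = "\<lambda>x v. f' x v + g' x v"])
      (auto intro: assms Suc.IH has_derivative_add)
qed

lemma Ck_on_sum:
  assumes "open S" "\<And>i. i \<in> I \<Longrightarrow> Ck_on k S (f i)"
  shows "Ck_on k S (\<lambda>x. \<Sum>i\<in>I. f i x)"
  using assms(2)
  by (induction I rule: infinite_finite_induct) (auto intro: Ck_on_const Ck_on_add assms(1))

lemma Ck_on_scaleR:
  fixes f :: "_ \<Rightarrow> real"
  assumes "open S" "Ck_on k S f" "Ck_on k S g"
  shows "Ck_on k S (\<lambda>x. f x *\<^sub>R g x)"
  using assms(2,3)
proof (induction k arbitrary: f g)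
  case 0
  then show ?case by (auto intro: continuous_intros)
next
  case (Suc k)
  note fg = Suc.prems[THEN Ck_on_Suc_imp]
  from Suc.prems(1) obtain f' where "\<And>x. x \<in> S \<Longrightarrow> (f has_derivative f' x) (at x)"
    "\<And>v. Ck_on k S (\<lambda>x. f' x v)" by (rule Ck_on_SucE) blast
  moreover from Suc.prems(2) obtain g' where "\<And>x. x \<in> S \<Longrightarrow> (g has_derivative g' x) (at x)"
    "\<And>v. Ck_on k S (\<lambda>x. g' x v)" by (rule Ck_on_SucE) blast
  ultimately show ?case using fg
    by (intro Ck_on_SucI[where f' = "\<lambda>x v. f x *\<^sub>R g' x v + f' x v *\<^sub>R g x"] Ck_on_add)
      (auto intro: assms Suc.IH has_derivative_scaleR)
qed

text \<open>The chain rule gives \<open>g' (f x) (f' x v)\<close>, whose direction varies with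
  \<open>x\<close>, while the induction hypothesis speaks of a fixed direction. Expanding
  \<open>f' x v\<close> in \<open>Basis\<close> leaves only the fixed directions \<open>b\<close>,
  with coefficients of the required class.\<close>

lemma Ck_on_compose:
  fixes f :: "'a::real_normed_vector \<Rightarrow> 'b::euclidean_space"
  assumes "open S" "open T" "f ` S \<subseteq> T" "Ck_on k S f" "Ck_on k T g"
  shows "Ck_on k S (\<lambda>x. g (f x))"
  using assms(4,5)
proof (induction k arbitrary: g)
  case 0
  then show ?case using assms(3) by (auto intro: continuous_on_compose2)
next
  case (Suc k)
  from Suc.prems(1) obtain f' where f': "\<And>x. x \<in> S \<Longrightarrow> (f has_derivative f' x) (at x)"
    "\<And>v. Ck_on k S (\<lambda>x. f' x v)" by (rule Ck_on_SucE) blast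
  from Suc.prems(2) obtain g' where g': "\<And>x. x \<in> T \<Longrightarrow> (g has_derivative g' x) (at x)"
    "\<And>v. Ck_on k T (\<lambda>x. g' x v)" by (rule Ck_on_SucE) blast
  have der: "((\<lambda>x. g (f x)) has_derivative (\<lambda>v. g' (f x) (f' x v))) (at x)" if "x \<in> S" for x
    using has_derivative_compose[OF f'(1)[OF that] g'(1)[of "f x"]] assms(3) that by auto
  have "g' (f x) (f' x v) = (\<Sum>b\<in>Basis. (f' x v \<bullet> b) *\<^sub>R g' (f x) b)" if "x \<in> S" for x v
  proof -
    have "linear (g' (f x))"
      using g'(1)[of "f x"] assms(3) that by (auto dest: has_derivative_linear)
    then have "g' (f x) (\<Sum>b\<in>Basis. (f' x v \<bullet> b) *\<^sub>R b) = (\<Sum>b\<in>Basis. (f' x v \<bullet> b) *\<^sub>R g' (f x) b)"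
      by (simp add: linear_sum linear_cmul)
    then show ?thesis by (simp add: euclidean_representation)
  qed
  moreover have "Ck_on k S (\<lambda>x. \<Sum>b\<in>Basis. (f' x v \<bullet> b) *\<^sub>R g' (f x) b)" for v
    using f'(2) g'(2) Suc.prems(1)
    by (intro Ck_on_sum Ck_on_scaleR assms Ck_on_linear[where h = "\<lambda>x. x \<bullet> _"] Suc.IH
        bounded_linear_inner_left) (auto intro: Ck_on_Suc_imp simp del: Ck_on.simps)
  ultimately have "Ck_on k S (\<lambda>x. g' (f x) (f' x v))" for v
    by (auto intro: Ck_on_cong[OF assms(1), where f = "\<lambda>x. \<Sum>b\<in>Basis. (f' x v \<bullet> b) *\<^sub>R g' (f x) b"])
  then show ?case by (intro Ck_on_SucI[OF assms(1) der])
qed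

text \<open>The derivative of 1/f is a product of f' and two factors 1/f, and the induction
  hypothesis already provides 1/f at the order needed for that product.\<close>

lemma Ck_on_inverse:
  fixes f :: "_ \<Rightarrow> real"
  assumes "open S" "Ck_on k S f" "\<And>x. x \<in> S \<Longrightarrow> f x \<noteq> 0"
  shows "Ck_on k S (\<lambda>x. inverse (f x))"
  using assms(2)
proof (induction k)
  case 0
  then show ?case using assms(3) by (auto intro: continuous_intros)
next
  case (Suc k)
  from Suc.prems(1) obtain f' where f': "\<And>x. x \<in> S \<Longrightarrow> (f has_derivative f' x) (at x)"
    "\<And>v. Ck_on k S (\<lambda>x. f' x v)" by (rule Ck_on_SucE) blast
  have inv: "Ck_on k S (\<lambda>x. inverse (f x))"
    using Suc Ck_on_Suc_imp by blast
  have "Ck_on k S (\<lambda>x. - (inverse (f x) *\<^sub>R (f' x v *\<^sub>R inverse (f x))))" for v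
    by (intro Ck_on_linear[where h = uminus] Ck_on_scaleR assms inv f' bounded_linear_minus
        bounded_linear_ident)
  then show ?case using f'(1) assms(3)
    by (intro Ck_on_SucI[OF assms(1), where f' = "\<lambda>x v. - (inverse (f x) *\<^sub>R (f' x v *\<^sub>R inverse (f x)))"])
      (auto intro!: has_derivative_eq_rhs[OF Deriv.has_derivative_inverse] simp: mult.assoc)
qed

section \<open>Calculus of smooth functions\<close>

lemma smooth_on_cong:
  "open S \<Longrightarrow> (\<And>x. x \<in> S \<Longrightarrow> f x = g x) \<Longrightarrow> smooth_on S f \<Longrightarrow> smooth_on S g"
  unfolding smooth_on_def using Ck_on_cong by metis

lemma smooth_on_subset: "smooth_on S f \<Longrightarrow> T \<subseteq> S \<Longrightarrow> smooth_on T f"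
  unfolding smooth_on_def using Ck_on_subset by metis

lemma smooth_on_continuous: "smooth_on S f \<Longrightarrow> continuous_on S f"
  unfolding smooth_on_def using Ck_on_continuous by blast

lemma smooth_on_const: "smooth_on S (\<lambda>x. c)"
  by (simp add: smooth_on_def Ck_on_const)

lemma smooth_on_id: "open S \<Longrightarrow> smooth_on S (\<lambda>x. x)"
  by (simp add: smooth_on_def Ck_on_id)

lemma smooth_on_linear:
  "open S \<Longrightarrow> bounded_linear h \<Longrightarrow> smooth_on S f \<Longrightarrow> smooth_on S (\<lambda>x. h (f x))"
  by (simp add: smooth_on_def Ck_on_linear)

lemma smooth_on_add:
  "open S \<Longrightarrow> smooth_on S f \<Longrightarrow> smooth_on S g \<Longrightarrow> smooth_on S (\<lambda>x. f x + g x)"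
  by (simp add: smooth_on_def Ck_on_add)

lemma smooth_on_scaleR:
  fixes f :: "_ \<Rightarrow> real"
  shows "open S \<Longrightarrow> smooth_on S f \<Longrightarrow> smooth_on S g \<Longrightarrow> smooth_on S (\<lambda>x. f x *\<^sub>R g x)"
  by (simp add: smooth_on_def Ck_on_scaleR)

lemma smooth_on_inverse:
  fixes f :: "_ \<Rightarrow> real"
  shows "open S \<Longrightarrow> smooth_on S f \<Longrightarrow> (\<And>x. x \<in> S \<Longrightarrow> f x \<noteq> 0) \<Longrightarrow> smooth_on S (\<lambda>x. inverse (f x))"
  by (simp add: smooth_on_def Ck_on_inverse)

lemma smooth_on_compose:
  fixes f :: "'a::real_normed_vector \<Rightarrow> 'b::euclidean_space"
  shows "open S \<Longrightarrow> open T \<Longrightarrow> f ` S \<subseteq> T \<Longrightarrow> smooth_on S f \<Longrightarrow> smooth_on T g \<Longrightarrow>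
    smooth_on S (\<lambda>x. g (f x))"
  by (simp add: smooth_on_def Ck_on_compose)

lemma smooth_on_differentiable: "smooth_on S f \<Longrightarrow> x \<in> S \<Longrightarrow> f differentiable (at x)"
  unfolding smooth_on_def using Ck_on.simps(2) by blast

lemma smooth_on_has_derivative:
  "smooth_on S f \<Longrightarrow> x \<in> S \<Longrightarrow> (f has_derivative frechet_derivative f (at x)) (at x)"
  using smooth_on_differentiable frechet_derivative_works by blast

lemma smooth_on_derivative:
  "smooth_on S f \<Longrightarrow> smooth_on S (\<lambda>x. frechet_derivative f (at x) v)"
  unfolding smooth_on_def using Ck_on.simps(2) by blast

text \<open>Gaussian elimination over a ring \<open>R\<close> of functions that is local at \<open>p\<close>: the pivots are
  chosen nonzero at \<open>p\<close> and stay so near \<open>p\<close>.\<close>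

lemma linear_system_solvable:
  fixes R :: "('x \<Rightarrow> real) set" and a :: "'j \<Rightarrow> 'i \<Rightarrow> 'x \<Rightarrow> real"
  assumes add: "\<And>f g. f \<in> R \<Longrightarrow> g \<in> R \<Longrightarrow> (\<lambda>x. f x + g x) \<in> R"
    and mult: "\<And>f g. f \<in> R \<Longrightarrow> g \<in> R \<Longrightarrow> (\<lambda>x. f x * g x) \<in> R"
    and const: "\<And>c. (\<lambda>x. c) \<in> R"
    and inverse: "\<And>f. f \<in> R \<Longrightarrow> f p \<noteq> 0 \<Longrightarrow> (\<lambda>x. inverse (f x)) \<in> R"
    and local: "\<And>f. f \<in> R \<Longrightarrow> f p \<noteq> 0 \<Longrightarrow> eventually (\<lambda>x. f x \<noteq> 0) F"
    and "finite I" "finite J" "card I = card J"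
    and "\<And>j i. j \<in> J \<Longrightarrow> i \<in> I \<Longrightarrow> a j i \<in> R" "\<And>j. j \<in> J \<Longrightarrow> b j \<in> R"
    and "\<And>u. (\<And>j. j \<in> J \<Longrightarrow> (\<Sum>i\<in>I. a j i p * u i) = 0) \<Longrightarrow> (\<And>i. i \<in> I \<Longrightarrow> u i = 0)"
  shows "\<exists>c. (\<forall>i\<in>I. c i \<in> R) \<and> eventually (\<lambda>x. \<forall>j\<in>J. (\<Sum>i\<in>I. a j i x * c i x) = b j x) F"
  using assms(6-)
proof (induction I arbitrary: J a b rule: finite_induct)
  case empty
  then show ?case by auto
next
  case (insert k I)
  have "\<exists>j\<in>J. a j k p \<noteq> 0"
  proof (rule ccontr)
    assume "\<not> ?thesis"
    \<comment> \<open>The unit vector at \<open>k\<close> would then be a nonzero solution of the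
      homogeneous system at \<open>p\<close>.\<close>
    then have "(\<Sum>i\<in>insert k I. a j i p * (if i = k then 1 else 0)) = 0" if "j \<in> J" for j
      using that insert.hyps by (auto intro!: sum.neutral)
    from insert.prems(5)[OF this, of k] show False by simp
  qed
  then obtain l where l: "l \<in> J" "a l k p \<noteq> 0" by blast
  \<comment> \<open>\<open>r j\<close> is the multiple of the pivot row \<open>l\<close> that clears
    column \<open>k\<close> from row \<open>j\<close>. Differences are written with a factor -1
    because \<open>R\<close> is assumed closed under sums, products and constants.\<close>
  define r where "r j x = a j k x * inverse (a l k x)" for j x
  define a' where "a' j i x = a j i x + (- 1) * (r j x * a l i x)" for j i x
  define b' where "b' j x = b j x + (- 1) * (r j x * b l x)" for j x
  have rR: "r j \<in> R" if "j \<in> J" for j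
    unfolding r_def using that l insert.prems(3) by (intro mult inverse) auto
  have a'R: "a' j i \<in> R" if "j \<in> J - {l}" "i \<in> I" for i j
    unfolding a'_def using that l insert.prems(3) by (intro add mult const rR) auto
  have b'R: "b' j \<in> R" if "j \<in> J - {l}" for j
    unfolding b'_def using that l insert.prems(4) by (intro add mult const rR) auto
  have inj: "u i = 0"
    if u: "\<And>j. j \<in> J - {l} \<Longrightarrow> (\<Sum>i\<in>I. a' j i p * u i) = 0" and i: "i \<in> I" for u i
  proof -
    \<comment> \<open>Back-substitution: the entry at \<open>k\<close> is chosen to satisfy the
      pivot row, so a solution of the reduced homogeneous system becomes one of the full system at
      \<open>p\<close>.\<close>
    define u' where "u' = u(k := - inverse (a l k p) * (\<Sum>i\<in>I. a l i p * u i))"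
    have u'I: "(\<Sum>i\<in>I. f i * u' i) = (\<Sum>i\<in>I. f i * u i)" for f
      using insert.hyps by (intro sum.cong) (auto simp: u'_def)
    have "(\<Sum>i\<in>insert k I. a j i p * u' i) = 0" if "j \<in> J" for j
    proof -
      have "(\<Sum>i\<in>insert k I. a j i p * u' i) = (\<Sum>i\<in>I. a' j i p * u i)"
        using insert.hyps u'I
        by (simp add: u'_def a'_def r_def sum.distrib sum_subtractf algebra_simps sum_distrib_left
            sum_negf)
      also have "\<dots> = 0"
        using u that l by (cases "j = l") (auto simp: a'_def r_def)
      finally show ?thesis .
    qed
    from insert.prems(5)[OF this, of i] i insert.hyps show "u i = 0"
      by (auto simp: u'_def split: if_splits)
  qed
  have "card I = card (J - {l})"
    using insert.prems(1,2) insert.hyps l by (simp add: card_Diff_singleton)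
  then obtain c where c: "\<And>i. i \<in> I \<Longrightarrow> c i \<in> R"
    "eventually (\<lambda>x. \<forall>j\<in>J - {l}. (\<Sum>i\<in>I. a' j i x * c i x) = b' j x) F"
    using insert.IH[of "J - {l}" a' b'] a'R b'R inj insert.prems(1) by blast
  \<comment> \<open>The same back-substitution with functions. It divides by the pivot, which is
    nonzero only near \<open>p\<close>; hence the solution is asserted eventually.\<close>
  define d where "d = c(k := (\<lambda>x. inverse (a l k x) * (b l x + (- 1) * (\<Sum>i\<in>I. a l i x * c i x))))"
  have sumR: "(\<lambda>x. \<Sum>i\<in>A. a l i x * c i x) \<in> R" if "A \<subseteq> I" for A
    using finite_subset[OF that insert.hyps(1)] that
    by (induction A rule: finite_induct) (use const add mult insert.prems(3) l c(1) in auto)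
  have "d k \<in> R"
    unfolding d_def fun_upd_same
    using l insert.prems(3,4) by (intro mult inverse add const sumR) auto
  then have "d i \<in> R" if "i \<in> insert k I" for i
    using that c(1) by (auto simp: d_def)
  moreover have "eventually (\<lambda>x. a l k x \<noteq> 0) F"
    using l insert.prems(3) local by blast
  with c(2) have "eventually (\<lambda>x. \<forall>j\<in>J. (\<Sum>i\<in>insert k I. a j i x * d i x) = b j x) F"
  proof eventually_elim
    case (elim x)
    have dI: "(\<Sum>i\<in>I. f i * d i x) = (\<Sum>i\<in>I. f i * c i x)" for f
      using insert.hyps by (intro sum.cong) (auto simp: d_def)
    have "(\<Sum>i\<in>insert k I. a j i x * d i x) = b j x" if "j \<in> J" for j
    proof -
      have "(\<Sum>i\<in>insert k I. a j i x * d i x) = (\<Sum>i\<in>I. a' j i x * c i x) + r j x * b l x"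
        using insert.hyps dI
        by (simp add: d_def a'_def r_def sum.distrib sum_subtractf algebra_simps sum_distrib_left
            sum_negf)
      also have "(\<Sum>i\<in>I. a' j i x * c i x) = b' j x"
        using elim that by (cases "j = l") (auto simp: a'_def b'_def r_def)
      finally show ?thesis by (simp add: b'_def)
    qed
    then show ?case by blast
  qed
  ultimately show ?case by blast
qed

section \<open>Germs, tangent vectors and fields on manifolds\<close>

lemma eventually_nhdsin_open: "openin X W \<Longrightarrow> p \<in> W \<Longrightarrow> (\<And>x. x \<in> W \<Longrightarrow> P x) \<Longrightarrow> eventually P (nhdsin X p)"
  by (auto simp: eventually_nhdsin)

text \<open>An open witness is a neighbourhood of each of its points. Outside the space the filter
  is trivial, so that case is vacuous.\<close>

lemma eventually_nhdsin_eventually: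
  assumes "eventually P (nhdsin X p)"
  shows "eventually (\<lambda>x. x \<in> topspace X \<and> P x \<and> eventually P (nhdsin X x)) (nhdsin X p)"
proof (cases "p \<in> topspace X")
  case True
  with assms obtain W where "openin X W" "p \<in> W" "\<And>x. x \<in> W \<Longrightarrow> P x"
    by (auto simp: eventually_nhdsin)
  then show ?thesis
    by (intro eventually_nhdsin_open[of X W]) (auto simp: openin_subset[THEN subsetD]
        intro: eventually_nhdsin_open)
qed auto

lemma eventually_nhdsin_self: "eventually P (nhdsin X p) \<Longrightarrow> p \<in> topspace X \<Longrightarrow> P p"
  by (auto simp: eventually_nhdsin)

locale smooth_mfd =
  fixes M :: "('a, 'e::euclidean_space) manifold"
  assumes smooth: "smooth_manifold M"
begin

section \<open>Charts and open sets\<close>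

lemma chart:
  assumes "(U, \<phi>) \<in> charts M"
  shows openin_chart: "openin (mtop M) U" and open_chart: "open (\<phi> ` U)"
    and homeo_chart: "homeomorphic_map (subtopology (mtop M) U) (top_of_set (\<phi> ` U)) \<phi>"
  using smooth assms unfolding smooth_manifold_def is_chart_def by auto

lemma chart_subset: "(U, \<phi>) \<in> charts M \<Longrightarrow> x \<in> U \<Longrightarrow> x \<in> points M"
  using openin_chart openin_subset by fastforce

lemma inj_chart: "(U, \<phi>) \<in> charts M \<Longrightarrow> inj_on \<phi> U"
  using homeomorphic_imp_injective_map[OF homeo_chart] chart_subset
  by (metis (no_types, lifting) Int_absorb1 subsetI topspace_subtopology)

lemma inv_chart [simp]: "(U, \<phi>) \<in> charts M \<Longrightarrow> x \<in> U \<Longrightarrow> inv_into U \<phi> (\<phi> x) = x"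
  by (simp add: inj_chart)

lemma chart_open_image:
  assumes "(U, \<phi>) \<in> charts M" "openin (mtop M) W" "W \<subseteq> U"
  shows "open (\<phi> ` W)"
proof -
  have "openin (subtopology (mtop M) U) W"
    using assms openin_chart by (simp add: openin_open_subtopology)
  then have "openin (top_of_set (\<phi> ` U)) (\<phi> ` W)"
    using homeomorphic_imp_open_map[OF homeo_chart[OF assms(1)]] by (simp add: open_map_def)
  then show ?thesis using open_chart[OF assms(1)] openin_open_eq by blast
qed

lemma chart_open_preimage:
  assumes "(U, \<phi>) \<in> charts M" "open T"
  shows "openin (mtop M) {x \<in> U. \<phi> x \<in> T}"
proof -
  have "continuous_map (subtopology (mtop M) U) (top_of_set (\<phi> ` U)) \<phi>"
    using homeo_chart[OF assms(1)] homeomorphic_imp_continuous_map by blast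
  then have "openin (subtopology (mtop M) U) {x \<in> topspace (subtopology (mtop M) U). \<phi> x \<in> \<phi> ` U \<inter> T}"
    using assms(2) by (intro openin_continuous_map_preimage) (auto intro: openin_open_Int)
  moreover have "{x \<in> topspace (subtopology (mtop M) U). \<phi> x \<in> \<phi> ` U \<inter> T} = {x \<in> U. \<phi> x \<in> T}"
    using chart_subset[OF assms(1)] by auto
  ultimately show ?thesis using openin_chart[OF assms(1)] by (simp add: openin_open_subtopology)
qed

lemma chart_image_preimage: "T \<subseteq> \<phi> ` U \<Longrightarrow> \<phi> ` {x \<in> U. \<phi> x \<in> T} = T"
  by auto

lemma chart_at:
  assumes "p \<in> points M" obtains U \<phi> where "(U, \<phi>) \<in> charts M" "p \<in> U"
proof -
  have "p \<in> (\<Union>c\<in>charts M. fst c)"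
    using assms smooth by (simp add: smooth_manifold_def)
  then show ?thesis using that by auto
qed

lemma transition_smooth:
  assumes "(U, \<phi>) \<in> charts M" "(V, \<psi>) \<in> charts M"
  shows "smooth_on (\<phi> ` (U \<inter> V)) (\<psi> \<circ> inv_into U \<phi>)"
proof -
  have "\<forall>c\<in>charts M. \<forall>d\<in>charts M. smoothly_compatible c d"
    using smooth unfolding smooth_manifold_def by (elim conjE)
  with assms have "smoothly_compatible (U, \<phi>) (V, \<psi>)" by blast
  then show ?thesis unfolding smoothly_compatible_def prod.case by blast
qed

lemma eventually_chart: "(U, \<phi>) \<in> charts M \<Longrightarrow> p \<in> U \<Longrightarrow> eventually (\<lambda>x. x \<in> U) (nhdsin (mtop M) p)"
  by (rule eventually_nhdsin_open[OF openin_chart])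

section \<open>Smooth germs in coordinates\<close>

text \<open>Transition maps are smooth, so the chart promised by \<open>smooth_at\<close> may be
  replaced by any chart around \<open>p\<close>.\<close>

lemma smooth_at_chart:
  assumes c: "(U, \<phi>) \<in> charts M" "p \<in> U"
  shows "smooth_at M p f \<longleftrightarrow>
    (\<exists>T. open T \<and> \<phi> p \<in> T \<and> T \<subseteq> \<phi> ` U \<and> smooth_on T (f \<circ> inv_into U \<phi>))"
proof
  assume "smooth_at M p f"
  then obtain V \<psi> W where W: "(V, \<psi>) \<in> charts M" "openin (mtop M) W" "p \<in> W" "W \<subseteq> V"
     "smooth_on (\<psi> ` W) (f \<circ> inv_into V \<psi>)"
    unfolding smooth_at_def by auto
  define T where "T = \<phi> ` (U \<inter> W)"
  have T: "open T"
    unfolding T_def using W(2) by (intro chart_open_image[OF c(1)] openin_Int openin_chart[OF c(1)]) auto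
  have "smooth_on T (\<lambda>z. (f \<circ> inv_into V \<psi>) ((\<psi> \<circ> inv_into U \<phi>) z))"
  proof (rule smooth_on_compose[OF T _ _ _ W(5)])
    show "open (\<psi> ` W)" using chart_open_image W by blast
    show "(\<psi> \<circ> inv_into U \<phi>) ` T \<subseteq> \<psi> ` W" using c by (auto simp: T_def)
    show "smooth_on T (\<psi> \<circ> inv_into U \<phi>)"
      by (rule smooth_on_subset[OF transition_smooth[OF c(1) W(1)]]) (use W in \<open>auto simp: T_def\<close>)
  qed
  then have "smooth_on T (f \<circ> inv_into U \<phi>)"
    by (rule smooth_on_cong[OF T, rotated]) (use c W in \<open>auto simp: T_def\<close>)
  with T c W show "\<exists>T. open T \<and> \<phi> p \<in> T \<and> T \<subseteq> \<phi> ` U \<and> smooth_on T (f \<circ> inv_into U \<phi>)"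
    by (intro exI[of _ T]) (auto simp: T_def)
next
  assume "\<exists>T. open T \<and> \<phi> p \<in> T \<and> T \<subseteq> \<phi> ` U \<and> smooth_on T (f \<circ> inv_into U \<phi>)"
  then obtain T where T: "open T" "\<phi> p \<in> T" "T \<subseteq> \<phi> ` U" "smooth_on T (f \<circ> inv_into U \<phi>)" by blast
  then have "openin (mtop M) {x \<in> U. \<phi> x \<in> T} \<and> p \<in> {x \<in> U. \<phi> x \<in> T} \<and> {x \<in> U. \<phi> x \<in> T} \<subseteq> U \<and>
     smooth_on (\<phi> ` {x \<in> U. \<phi> x \<in> T}) (f \<circ> inv_into U \<phi>)"
    using c chart_open_preimage[OF c(1)] by (simp add: chart_image_preimage)
  then show "smooth_at M p f"
    unfolding smooth_at_def by (intro bexI[OF _ c(1)]) blast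
qed

lemma smooth_atE:
  assumes "smooth_at M p f" "(U, \<phi>) \<in> charts M" "p \<in> U"
  obtains T where "open T" "\<phi> p \<in> T" "T \<subseteq> \<phi> ` U" "smooth_on T (f \<circ> inv_into U \<phi>)"
  using assms(1) unfolding smooth_at_chart[OF assms(2,3)] by blast

lemma smooth_atI:
  assumes "(U, \<phi>) \<in> charts M" "p \<in> U" "open T" "\<phi> p \<in> T" "smooth_on T F"
    and "\<And>x. x \<in> U \<Longrightarrow> \<phi> x \<in> T \<Longrightarrow> f x = F (\<phi> x)"
  shows "smooth_at M p f"
proof -
  have o: "open (T \<inter> \<phi> ` U)" using open_chart assms by blast
  have "smooth_on (T \<inter> \<phi> ` U) (f \<circ> inv_into U \<phi>)"
    by (rule smooth_on_cong[OF o _ smooth_on_subset[OF assms(5)]]) (use assms in auto)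
  with o show ?thesis using assms by (auto simp: smooth_at_chart)
qed

lemma smooth_at_points: "smooth_at M p f \<Longrightarrow> p \<in> points M"
  unfolding smooth_at_def using chart_subset by blast

lemma eventually_smooth_at:
  assumes "smooth_at M p f" shows "eventually (\<lambda>x. smooth_at M x f) (nhdsin (mtop M) p)"
proof -
  obtain U \<phi> where c: "(U, \<phi>) \<in> charts M" "p \<in> U" using chart_at smooth_at_points assms by blast
  obtain T where T: "open T" "\<phi> p \<in> T" "T \<subseteq> \<phi> ` U" "smooth_on T (f \<circ> inv_into U \<phi>)"
    using smooth_atE[OF assms c] by blast
  then show ?thesis using c
    by (intro eventually_nhdsin_open[OF chart_open_preimage[OF c(1) T(1)]]) (auto simp: smooth_at_chart)
qed

lemma smooth_at_cong:
  assumes "eventually (\<lambda>x. f x = g x) (nhdsin (mtop M) p)" "smooth_at M p f"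
  shows "smooth_at M p g"
proof -
  have p: "p \<in> points M" using assms smooth_at_points by blast
  obtain U \<phi> where c: "(U, \<phi>) \<in> charts M" "p \<in> U" using chart_at p by blast
  obtain T where T: "open T" "\<phi> p \<in> T" "T \<subseteq> \<phi> ` U" "smooth_on T (f \<circ> inv_into U \<phi>)"
    using smooth_atE[OF assms(2) c] by blast
  obtain W where W: "openin (mtop M) W" "p \<in> W" "\<And>x. x \<in> W \<Longrightarrow> f x = g x"
    using assms(1) p by (auto simp: eventually_nhdsin)
  show ?thesis
    by (rule smooth_atI[OF c, of "T \<inter> \<phi> ` (U \<inter> W)" "f \<circ> inv_into U \<phi>"])
      (use T W c in \<open>auto intro!: smooth_on_subset[OF T(4)] chart_open_image[OF c(1)] openin_Int
        openin_chart[OF c(1)] dest: inj_onD[OF inj_chart]\<close>)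
qed

lemma smooth_at_const: "p \<in> points M \<Longrightarrow> smooth_at M p (\<lambda>x. c)"
proof -
  assume "p \<in> points M"
  then obtain U \<phi> where "(U, \<phi>) \<in> charts M" "p \<in> U" using chart_at by blast
  then show ?thesis by (rule smooth_atI[of _ _ p UNIV "\<lambda>x. c"]) (simp_all add: smooth_on_const)
qed

lemma smooth_at_binop:
  assumes f: "smooth_at M p f" and g: "smooth_at M p g"
    and op: "\<And>T F G. open (T :: 'e set) \<Longrightarrow> smooth_on T F \<Longrightarrow> smooth_on T G \<Longrightarrow> smooth_on T (\<lambda>x. h (F x) (G x))"
  shows "smooth_at M p (\<lambda>x. h (f x) (g x))"
proof -
  obtain U \<phi> where c: "(U, \<phi>) \<in> charts M" "p \<in> U" using chart_at smooth_at_points f by blast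
  obtain T where T: "open T" "\<phi> p \<in> T" "T \<subseteq> \<phi> ` U" "smooth_on T (f \<circ> inv_into U \<phi>)"
    using smooth_atE[OF f c] by blast
  obtain T' where T': "open T'" "\<phi> p \<in> T'" "T' \<subseteq> \<phi> ` U" "smooth_on T' (g \<circ> inv_into U \<phi>)"
    using smooth_atE[OF g c] by blast
  show ?thesis
  proof (rule smooth_atI[OF c, of "T \<inter> T'" "\<lambda>z. h ((f \<circ> inv_into U \<phi>) z) ((g \<circ> inv_into U \<phi>) z)"])
    show "smooth_on (T \<inter> T') (\<lambda>z. h ((f \<circ> inv_into U \<phi>) z) ((g \<circ> inv_into U \<phi>) z))"
      using T T' by (intro op smooth_on_subset[OF T(4)] smooth_on_subset[OF T'(4)]) auto
  qed (use T T' c in auto)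
qed

lemma smooth_at_add: "smooth_at M p f \<Longrightarrow> smooth_at M p g \<Longrightarrow> smooth_at M p (\<lambda>x. f x + g x)"
  by (rule smooth_at_binop) (auto intro: smooth_on_add)

lemma smooth_at_mult: "smooth_at M p f \<Longrightarrow> smooth_at M p g \<Longrightarrow> smooth_at M p (\<lambda>x. f x * g x)"
  using smooth_at_binop[of p f g "(*)"] smooth_on_scaleR by (force simp: real_scaleR_def)

lemma smooth_at_sum:
  "p \<in> points M \<Longrightarrow> (\<And>i. i \<in> I \<Longrightarrow> smooth_at M p (f i)) \<Longrightarrow> smooth_at M p (\<lambda>x. \<Sum>i\<in>I. f i x)"
  by (induction I rule: infinite_finite_induct) (auto intro: smooth_at_const smooth_at_add)

text \<open>These are the hypotheses \<open>local\<close> and \<open>inverse\<close> of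
  \<open>linear_system_solvable\<close> for the ring of germs smooth at \<open>p\<close>.\<close>

lemma smooth_at_nonzero:
  assumes "smooth_at M p f" "f p \<noteq> 0"
  shows "eventually (\<lambda>x. f x \<noteq> 0) (nhdsin (mtop M) p)"
    and "smooth_at M p (\<lambda>x. inverse (f x))"
proof -
  obtain U \<phi> where c: "(U, \<phi>) \<in> charts M" "p \<in> U" using chart_at smooth_at_points assms by blast
  obtain T where T: "open T" "\<phi> p \<in> T" "T \<subseteq> \<phi> ` U" "smooth_on T (f \<circ> inv_into U \<phi>)"
    using smooth_atE[OF assms(1) c] by blast
  define T' where "T' = T \<inter> (f \<circ> inv_into U \<phi>) -` (- {0})"
  have T': "open T'" "T' \<subseteq> T" "\<phi> p \<in> T'"
    using continuous_open_preimage[OF smooth_on_continuous[OF T(4)] T(1), of "- {0}"] T c assms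
    by (auto simp: T'_def)
  show "eventually (\<lambda>x. f x \<noteq> 0) (nhdsin (mtop M) p)"
    by (rule eventually_nhdsin_open[OF chart_open_preimage[OF c(1) T'(1)]])
      (use T' c in \<open>auto simp: T'_def\<close>)
  show "smooth_at M p (\<lambda>x. inverse (f x))"
  proof (rule smooth_atI[OF c T'(1,3), of "\<lambda>z. inverse ((f \<circ> inv_into U \<phi>) z)"])
    show "smooth_on T' (\<lambda>z. inverse ((f \<circ> inv_into U \<phi>) z))"
      by (rule smooth_on_inverse[OF T'(1) smooth_on_subset[OF T(4) T'(2)]]) (auto simp: T'_def)
  qed (use c in auto)
qed

lemma smooth_at_coord: "(U, \<phi>) \<in> charts M \<Longrightarrow> p \<in> U \<Longrightarrow> smooth_at M p (\<lambda>x. \<phi> x \<bullet> b)"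
  by (rule smooth_atI[of U \<phi> p UNIV "\<lambda>z. z \<bullet> b"])
    (use smooth_on_linear[OF open_UNIV bounded_linear_inner_left smooth_on_id] in auto)

section \<open>Coordinate fields, velocities and tangent spaces\<close>

text \<open>The field whose coefficients in the chart are the constants of \<open>c\<close>; the
  value 0 on non-smooth functions matches the convention of \<open>velocity\<close>.\<close>

definition coord_field :: "'a set \<Rightarrow> ('a \<Rightarrow> 'e) \<Rightarrow> 'e \<Rightarrow> 'a vfield" where
  "coord_field U \<phi> c p =
     (\<lambda>f. if smooth_at M p f then frechet_derivative (f \<circ> inv_into U \<phi>) (at (\<phi> p)) c else 0)"

lemma has_derivative_coord:
  assumes "smooth_at M p f" "(U, \<phi>) \<in> charts M" "p \<in> U"
  shows "((f \<circ> inv_into U \<phi>) has_derivative (\<lambda>c. coord_field U \<phi> c p f)) (at (\<phi> p))"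
  using smooth_atE[OF assms] assms(1) by (auto simp: coord_field_def intro: smooth_on_has_derivative)

lemma coord_field_eqI:
  assumes "smooth_at M p f" "(U, \<phi>) \<in> charts M" "p \<in> U"
    "((f \<circ> inv_into U \<phi>) has_derivative f') (at (\<phi> p))"
  shows "coord_field U \<phi> c p f = f' c"
  using has_derivative_unique[OF has_derivative_coord[OF assms(1-3)] assms(4)] by metis

lemma linear_coord_field:
  assumes "(U, \<phi>) \<in> charts M" "p \<in> U"
  shows "linear (\<lambda>c. coord_field U \<phi> c p)"
proof -
  have "linear (\<lambda>c. coord_field U \<phi> c p f)" for f
  proof (cases "smooth_at M p f")
    case True
    then show ?thesis using has_derivative_coord[OF True assms] has_derivative_linear by blast
  next
    case False
    then show ?thesis by (simp add: coord_field_def linear_zero)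
  qed
  then show ?thesis
    by (auto simp: linear_iff fun_eq_iff scaleR_fun_def)
qed

lemma velocity_chart:
  assumes "(U, \<phi>) \<in> charts M" "\<gamma> 0 \<in> U" "((\<phi> \<circ> \<gamma>) has_vector_derivative c) (at 0)"
    "eventually (\<lambda>t. \<gamma> t \<in> U) (nhds 0)"
  shows "velocity M \<gamma> = coord_field U \<phi> c (\<gamma> 0)"
proof
  fix f
  show "velocity M \<gamma> f = coord_field U \<phi> c (\<gamma> 0) f"
  proof (cases "smooth_at M (\<gamma> 0) f")
    case True
    have "(((f \<circ> inv_into U \<phi>) \<circ> (\<phi> \<circ> \<gamma>)) has_vector_derivative coord_field U \<phi> c (\<gamma> 0) f) (at 0)"
      by (rule vector_derivative_diff_chain_within[OF assms(3)], unfold comp_apply[of \<phi> \<gamma> 0])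
        (rule has_derivative_at_withinI[OF has_derivative_coord[OF True assms(1,2)]])
    moreover have "eventually (\<lambda>t. ((f \<circ> inv_into U \<phi>) \<circ> (\<phi> \<circ> \<gamma>)) t = (f \<circ> \<gamma>) t) (nhds 0)"
      using assms(4) by eventually_elim (use assms(1) in auto)
    ultimately have "((f \<circ> \<gamma>) has_vector_derivative coord_field U \<phi> c (\<gamma> 0) f) (at 0)"
      using assms(1,2) by (subst (asm) has_vector_derivative_cong_ev[where g = "f \<circ> \<gamma>"]) auto
    then show ?thesis
      using True by (simp add: velocity_def DERIV_imp_deriv has_real_derivative_iff_has_vector_derivative)
  qed (simp add: velocity_def coord_field_def)
qed

lemma smooth_curve_chart:
  assumes "smooth_curve M \<gamma>" "(U, \<phi>) \<in> charts M" "\<gamma> 0 \<in> U"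
  obtains \<epsilon> where "\<epsilon> > 0" "\<gamma> ` {-\<epsilon><..<\<epsilon>} \<subseteq> U" "smooth_on {-\<epsilon><..<\<epsilon>} (\<phi> \<circ> \<gamma>)"
proof -
  obtain V \<psi> \<delta> where V: "(V, \<psi>) \<in> charts M" "\<delta> > 0" "\<gamma> ` {-\<delta><..<\<delta>} \<subseteq> V"
    "smooth_on {-\<delta><..<\<delta>} (\<psi> \<circ> \<gamma>)"
    using assms(1) unfolding smooth_curve_def by auto
  \<comment> \<open>The parameters at which the curve lies in both chart domains; continuity in the
    chart \<open>\<psi>\<close> makes this set open.\<close>
  define T where "T = {-\<delta><..<\<delta>} \<inter> (\<psi> \<circ> \<gamma>) -` (\<psi> ` (V \<inter> U))"
  have oVU: "open (\<psi> ` (V \<inter> U))"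
    using V assms by (intro chart_open_image openin_Int openin_chart) auto
  have "open T"
    unfolding T_def
    by (rule continuous_open_preimage[OF smooth_on_continuous[OF V(4)] _ oVU]) auto
  moreover have "\<gamma> 0 \<in> V \<inter> U" using V(2,3) assms by auto
  then have "0 \<in> T" using V(2) by (auto simp: T_def)
  ultimately obtain \<epsilon> where e: "\<epsilon> > 0" "ball 0 \<epsilon> \<subseteq> T" using open_contains_ball by blast
  have eT: "{-\<epsilon><..<\<epsilon>} \<subseteq> T" using e(2) by (force simp: ball_def dist_real_def)
  have U: "\<gamma> t \<in> V \<inter> U" if "t \<in> T" for t
  proof -
    from that obtain z where z: "\<psi> (\<gamma> t) = \<psi> z" "z \<in> V \<inter> U" by (auto simp: T_def)
    moreover have "\<gamma> t \<in> V" using that V(3) by (auto simp: T_def)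
    ultimately show ?thesis using inj_onD[OF inj_chart[OF V(1)] z(1)] by auto
  qed
  have "smooth_on {-\<epsilon><..<\<epsilon>} (\<lambda>t. (\<phi> \<circ> inv_into V \<psi>) ((\<psi> \<circ> \<gamma>) t))"
  proof (rule smooth_on_compose[OF _ oVU _ _ transition_smooth[OF V(1) assms(2)]])
    show "smooth_on {-\<epsilon><..<\<epsilon>} (\<psi> \<circ> \<gamma>)"
      using eT by (intro smooth_on_subset[OF V(4)]) (auto simp: T_def)
  qed (use eT in \<open>auto simp: T_def\<close>)
  then have "smooth_on {-\<epsilon><..<\<epsilon>} (\<phi> \<circ> \<gamma>)"
    by (rule smooth_on_cong[rotated -1]) (use eT U V in auto)
  with e(1) that[of \<epsilon>] eT U show ?thesis by blast
qed

lemma eventually_open_interval: "\<epsilon> > 0 \<Longrightarrow> (\<And>t. t \<in> {-\<epsilon><..<\<epsilon>} \<Longrightarrow> P t) \<Longrightarrow> eventually P (nhds (0::real))"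
  by (rule eventually_nhds_in_open[of "{-\<epsilon><..<\<epsilon>}", THEN eventually_mono]) auto

lemma velocity_curve:
  assumes "smooth_curve M \<gamma>" "(U, \<phi>) \<in> charts M" "\<gamma> 0 \<in> U"
  obtains c where "((\<phi> \<circ> \<gamma>) has_vector_derivative c) (at 0)"
    "eventually (\<lambda>t. \<gamma> t \<in> U) (nhds 0)" "velocity M \<gamma> = coord_field U \<phi> c (\<gamma> 0)"
proof -
  obtain \<epsilon> where e: "\<epsilon> > 0" "\<gamma> ` {-\<epsilon><..<\<epsilon>} \<subseteq> U" "smooth_on {-\<epsilon><..<\<epsilon>} (\<phi> \<circ> \<gamma>)"
    using smooth_curve_chart[OF assms] by blast
  have "(\<phi> \<circ> \<gamma>) differentiable (at 0)"
    using e smooth_on_differentiable by (metis greaterThanLessThan_iff neg_less_0_iff_less)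
  then obtain c where c: "((\<phi> \<circ> \<gamma>) has_vector_derivative c) (at 0)"
    using vector_derivative_works by blast
  have ev: "eventually (\<lambda>t. \<gamma> t \<in> U) (nhds 0)"
    using e by (intro eventually_open_interval[of \<epsilon>]) auto
  show ?thesis
    by (rule that[OF c ev velocity_chart[OF assms(2,3) c ev]])
qed

text \<open>Coordinate lines realise every coordinate direction as a velocity. The last claim
  records their coordinates, from which a line directed along a slice is seen to stay in it.\<close>

lemma smooth_curve_line:
  fixes c :: 'e
  assumes "(U, \<phi>) \<in> charts M" "p \<in> U"
  defines "\<gamma> \<equiv> \<lambda>t. inv_into U \<phi> (\<phi> p + t *\<^sub>R c)"
  shows "smooth_curve M \<gamma>" "\<gamma> 0 = p" "velocity M \<gamma> = coord_field U \<phi> c p"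
    "eventually (\<lambda>t. \<gamma> t \<in> U \<and> \<phi> (\<gamma> t) = \<phi> p + t *\<^sub>R c) (nhds 0)"
proof -
  define f where "f t = \<phi> p + t *\<^sub>R c" for t :: real
  have "open (f -` (\<phi> ` U))"
    unfolding f_def by (intro open_vimage open_chart[OF assms(1)] continuous_intros)
  moreover have "0 \<in> f -` (\<phi> ` U)" using assms by (auto simp: f_def)
  ultimately obtain \<epsilon> where e: "\<epsilon> > 0" "ball 0 \<epsilon> \<subseteq> f -` (\<phi> ` U)" using open_contains_ball by blast
  then have eT: "{-\<epsilon><..<\<epsilon>} \<subseteq> f -` (\<phi> ` U)" by (force simp: ball_def dist_real_def)
  have g: "\<gamma> t \<in> U" "\<phi> (\<gamma> t) = f t" if "t \<in> {-\<epsilon><..<\<epsilon>}" for t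
    using eT that unfolding \<gamma>_def f_def by (auto simp: inv_into_into f_inv_into_f)
  show g0: "\<gamma> 0 = p" using assms by (simp add: \<gamma>_def)
  have "smooth_on {-\<epsilon><..<\<epsilon>} f"
    unfolding f_def
    by (intro smooth_on_add smooth_on_const smooth_on_scaleR smooth_on_id open_greaterThanLessThan)
  then have "smooth_on {-\<epsilon><..<\<epsilon>} (\<phi> \<circ> \<gamma>)"
    by (rule smooth_on_cong[rotated -1]) (use g in auto)
  then show "smooth_curve M \<gamma>"
    unfolding smooth_curve_def using e g by (intro bexI[OF _ assms(1)]) auto
  show ev: "eventually (\<lambda>t. \<gamma> t \<in> U \<and> \<phi> (\<gamma> t) = \<phi> p + t *\<^sub>R c) (nhds 0)"
    using e g by (intro eventually_open_interval[of \<epsilon>]) (auto simp: f_def)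
  have "(f has_vector_derivative c) (at 0)"
    unfolding f_def by (auto intro!: derivative_eq_intros)
  moreover have "eventually (\<lambda>t. f t = (\<phi> \<circ> \<gamma>) t) (nhds 0)"
    using ev by eventually_elim (simp add: f_def)
  ultimately have "((\<phi> \<circ> \<gamma>) has_vector_derivative c) (at 0)"
    using assms g0 by (subst (asm) has_vector_derivative_cong_ev[where g = "\<phi> \<circ> \<gamma>"]) (auto simp: f_def)
  then show "velocity M \<gamma> = coord_field U \<phi> c p"
    using velocity_chart[OF assms(1), of \<gamma> c] eventually_mono[OF ev] g0 assms(2) by simp
qed

lemma tangent_space_chart:
  assumes "(U, \<phi>) \<in> charts M" "p \<in> U"
  shows "tangent_space M p = range (\<lambda>c. coord_field U \<phi> c p)"
proof
  show "tangent_space M p \<subseteq> range (\<lambda>c. coord_field U \<phi> c p)"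
    unfolding tangent_space_def using assms by (auto elim!: velocity_curve)
  show "range (\<lambda>c. coord_field U \<phi> c p) \<subseteq> tangent_space M p"
  proof clarify
    fix c
    show "coord_field U \<phi> c p \<in> tangent_space M p"
      unfolding tangent_space_def using smooth_curve_line(1-3)[OF assms, of c]
      by (intro CollectI exI[of _ "\<lambda>t. inv_into U \<phi> (\<phi> p + t *\<^sub>R c)"]) simp
  qed
qed

lemma coord_field_tangent:
  "(U, \<phi>) \<in> charts M \<Longrightarrow> p \<in> U \<Longrightarrow> coord_field U \<phi> c p \<in> tangent_space M p"
  by (simp add: tangent_space_chart)

lemma subspace_tangent:
  assumes "p \<in> points M" shows "subspace (tangent_space M p)"
proof -
  obtain U \<phi> where c: "(U, \<phi>) \<in> charts M" "p \<in> U" using chart_at assms by blast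
  show ?thesis
    using linear_subspace_image[OF linear_coord_field[OF c] subspace_UNIV]
    by (simp add: tangent_space_chart[OF c])
qed

lemma tangent_cases:
  assumes "v \<in> tangent_space M p" "p \<in> points M"
  obtains U \<phi> c where "(U, \<phi>) \<in> charts M" "p \<in> U" "v = coord_field U \<phi> c p"
proof -
  obtain U \<phi> where c: "(U, \<phi>) \<in> charts M" "p \<in> U" using chart_at assms(2) by blast
  with assms(1) show ?thesis by (auto simp: tangent_space_chart[OF c] intro: that[OF c])
qed

lemma tangent_nonsmooth: "v \<in> tangent_space M p \<Longrightarrow> \<not> smooth_at M p f \<Longrightarrow> v f = 0"
  by (auto simp: tangent_space_def velocity_def)

lemma tangent_cong:
  assumes "v \<in> tangent_space M p" "p \<in> points M" "eventually (\<lambda>x. f x = g x) (nhdsin (mtop M) p)"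
  shows "v f = v g"
proof (cases "smooth_at M p f")
  case True
  have g: "smooth_at M p g" using smooth_at_cong[OF assms(3) True] .
  obtain U \<phi> c where c: "(U, \<phi>) \<in> charts M" "p \<in> U" "v = coord_field U \<phi> c p"
    using assms tangent_cases by blast
  obtain W where W: "openin (mtop M) W" "p \<in> W" "\<And>x. x \<in> W \<Longrightarrow> f x = g x"
    using assms(2,3) by (auto simp: eventually_nhdsin)
  have "((g \<circ> inv_into U \<phi>) has_derivative (\<lambda>c. coord_field U \<phi> c p f)) (at (\<phi> p))"
    by (rule has_derivative_transform_within_open[OF has_derivative_coord[OF True c(1,2)],
          of "\<phi> ` (U \<inter> W)"])
      (use c W in \<open>auto intro!: chart_open_image[OF c(1)] openin_Int openin_chart[OF c(1)]\<close>)
  from coord_field_eqI[OF g c(1,2) this] c show ?thesis by simp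
next
  case False
  \<comment> \<open>Smoothness at \<open>p\<close> is itself a property of the germ, so both sides
    carry the default value 0.\<close>
  moreover have "\<not> smooth_at M p g"
    using False smooth_at_cong[of g f p] assms(3) by (auto simp: eq_commute)
  ultimately show ?thesis using tangent_nonsmooth assms by metis
qed

lemma tangent_const:
  assumes "v \<in> tangent_space M p" "p \<in> points M"
  shows "v (\<lambda>x. k) = 0"
proof -
  obtain U \<phi> c where c: "(U, \<phi>) \<in> charts M" "p \<in> U" "v = coord_field U \<phi> c p"
    using assms tangent_cases by blast
  have "(((\<lambda>x. k) \<circ> inv_into U \<phi>) has_derivative (\<lambda>c. 0)) (at (\<phi> p))"
    by (simp add: o_def)
  from coord_field_eqI[OF smooth_at_const[OF assms(2)] c(1,2) this] c show ?thesis by simp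
qed

lemma coord_field_coord:
  assumes "(U, \<phi>) \<in> charts M" "p \<in> U"
  shows "coord_field U \<phi> c p (\<lambda>x. \<phi> x \<bullet> b) = c \<bullet> b"
proof -
  have "(((\<lambda>x. \<phi> x \<bullet> b) \<circ> inv_into U \<phi>) has_derivative (\<lambda>c. c \<bullet> b)) (at (\<phi> p))"
    by (rule has_derivative_transform_within_open[where s = "\<phi> ` U" and f = "\<lambda>z. z \<bullet> b"])
      (use assms in \<open>auto intro!: open_chart derivative_eq_intros\<close>)
  from coord_field_eqI[OF smooth_at_coord[OF assms] assms this] show ?thesis .
qed

text \<open>The coefficients are the values of \<open>v\<close> on the coordinate functions, hence
  vary smoothly whenever \<open>v\<close> does.\<close>

lemma coord_expansion:
  assumes "(U, \<phi>) \<in> charts M" "p \<in> U" "v \<in> tangent_space M p"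
  shows "v = (\<Sum>b\<in>Basis. v (\<lambda>x. \<phi> x \<bullet> b) *\<^sub>R coord_field U \<phi> b p)"
proof -
  obtain c where c: "v = coord_field U \<phi> c p" using assms tangent_space_chart by auto
  have "v = coord_field U \<phi> (\<Sum>b\<in>Basis. (c \<bullet> b) *\<^sub>R b) p" by (simp add: euclidean_representation c)
  also have "\<dots> = (\<Sum>b\<in>Basis. (c \<bullet> b) *\<^sub>R coord_field U \<phi> b p)"
    by (simp add: linear_sum[OF linear_coord_field[OF assms(1,2)]]
        linear_cmul[OF linear_coord_field[OF assms(1,2)]])
  also have "\<dots> = (\<Sum>b\<in>Basis. v (\<lambda>x. \<phi> x \<bullet> b) *\<^sub>R coord_field U \<phi> b p)"
    unfolding c by (simp add: coord_field_coord[OF assms(1,2)])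
  finally show ?thesis .
qed

lemma smooth_at_coord_field:
  assumes f: "smooth_at M p f" and c: "(U, \<phi>) \<in> charts M" "p \<in> U"
  shows "smooth_at M p (\<lambda>x. coord_field U \<phi> c x f)"
proof -
  obtain T where T: "open T" "\<phi> p \<in> T" "T \<subseteq> \<phi> ` U" "smooth_on T (f \<circ> inv_into U \<phi>)"
    using smooth_atE[OF f c] by blast
  show ?thesis
    by (rule smooth_atI[OF c T(1,2) smooth_on_derivative[OF T(4), of c]])
      (use T c in \<open>auto simp: coord_field_def smooth_at_chart\<close>)
qed

section \<open>Locally defined smooth vector fields\<close>

lemma smooth_field_at_eventually:
  assumes "p \<in> points M"
  shows "smooth_field_at M p W \<longleftrightarrow> eventually (\<lambda>q. W q \<in> tangent_space M q \<and>
        (\<forall>f. smooth_at M q f \<longrightarrow> smooth_at M q (\<lambda>x. W x f))) (nhdsin (mtop M) p)"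
  using assms by (simp add: smooth_field_at_def eventually_nhdsin)

lemma field_points: "smooth_field_at M p W \<Longrightarrow> p \<in> points M"
  unfolding smooth_field_at_def using openin_subset by blast

lemma fieldE:
  assumes "smooth_field_at M p W"
  obtains U where "openin (mtop M) U" "p \<in> U" "\<And>x. x \<in> U \<Longrightarrow> W x \<in> tangent_space M x"
    "\<And>x f. x \<in> U \<Longrightarrow> smooth_at M x f \<Longrightarrow> smooth_at M x (\<lambda>y. W y f)"
  using assms unfolding smooth_field_at_def by metis

lemma field_apply: "smooth_field_at M p W \<Longrightarrow> smooth_at M p f \<Longrightarrow> smooth_at M p (\<lambda>x. W x f)"
  by (erule fieldE) simp

lemma field_tangent: "smooth_field_at M p W \<Longrightarrow> W p \<in> tangent_space M p"
  by (erule fieldE) simp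

lemma eventually_field:
  assumes "smooth_field_at M p W"
  shows "eventually (\<lambda>x. smooth_field_at M x W) (nhdsin (mtop M) p)"
proof -
  obtain U where "openin (mtop M) U" "p \<in> U" "\<And>x. x \<in> U \<Longrightarrow> W x \<in> tangent_space M x"
    "\<And>x f. x \<in> U \<Longrightarrow> smooth_at M x f \<Longrightarrow> smooth_at M x (\<lambda>y. W y f)"
    using fieldE[OF assms] by metis
  then show ?thesis
    by (intro eventually_nhdsin_open[of _ U]) (auto simp: smooth_field_at_def)
qed

lemma eventually_field_tangent:
  assumes "smooth_field_at M p W"
  shows "eventually (\<lambda>x. W x \<in> tangent_space M x) (nhdsin (mtop M) p)"
  using eventually_field[OF assms] by eventually_elim (rule field_tangent)

lemma eventually_points: "eventually (\<lambda>x. x \<in> points M) (nhdsin (mtop M) p)"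
  by (cases "p \<in> points M") (auto intro: eventually_nhdsin_open)

lemma field_cong:
  assumes "eventually (\<lambda>x. W x = W' x) (nhdsin (mtop M) p)" "smooth_field_at M p W"
  shows "smooth_field_at M p W'"
proof -
  have p: "p \<in> points M" using assms field_points by blast
  show ?thesis
    unfolding smooth_field_at_eventually[OF p]
    using eventually_nhdsin_eventually[OF assms(1)] eventually_field[OF assms(2)]
  proof eventually_elim
    case (elim x)
    have "smooth_at M x (\<lambda>y. W' y f)" if "smooth_at M x f" for f
      by (rule smooth_at_cong[OF _ field_apply[of x W f]]) (use elim that in \<open>auto elim: eventually_mono\<close>)
    then show ?case using elim field_tangent by metis
  qed
qed

lemma fieldI:
  assumes "p \<in> points M" "eventually (\<lambda>x. P x) (nhdsin (mtop M) p)"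
    "\<And>x. x \<in> points M \<Longrightarrow> P x \<Longrightarrow> W x \<in> tangent_space M x"
    "\<And>x f. x \<in> points M \<Longrightarrow> P x \<Longrightarrow> smooth_at M x f \<Longrightarrow> smooth_at M x (\<lambda>x. W x f)"
  shows "smooth_field_at M p W"
  unfolding smooth_field_at_eventually[OF assms(1)]
  using assms(2) eventually_points by eventually_elim (use assms in auto)

lemma field_coord:
  assumes "(U, \<phi>) \<in> charts M" "p \<in> U"
  shows "smooth_field_at M p (coord_field U \<phi> c)"
  by (rule fieldI[OF _ eventually_chart[OF assms]])
    (use assms in \<open>auto intro: coord_field_tangent smooth_at_coord_field chart_subset\<close>)

lemma field_add:
  assumes "smooth_field_at M p V" "smooth_field_at M p W"
  shows "smooth_field_at M p (\<lambda>x. V x + W x)"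
  by (rule fieldI[OF field_points[OF assms(1)] eventually_conj[OF eventually_field[OF assms(1)] eventually_field[OF assms(2)]]])
    (auto simp: field_apply field_tangent smooth_at_add subspace_add[OF subspace_tangent])

lemma field_scale:
  assumes "smooth_at M p f" "smooth_field_at M p W"
  shows "smooth_field_at M p (\<lambda>x. f x *\<^sub>R W x)"
  by (rule fieldI[OF smooth_at_points[OF assms(1)] eventually_conj[OF eventually_smooth_at[OF assms(1)] eventually_field[OF assms(2)]]])
    (simp_all add: subspace_scale[OF subspace_tangent] field_tangent,
      simp add: scaleR_fun_def field_apply smooth_at_mult)

lemma field_zero: "p \<in> points M \<Longrightarrow> smooth_field_at M p (\<lambda>x. 0)"
  by (rule fieldI[of _ "\<lambda>x. True"]) (auto intro: subspace_0 subspace_tangent smooth_at_const)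

lemma field_sum:
  assumes "p \<in> points M" "\<And>i. i \<in> I \<Longrightarrow> smooth_field_at M p (W i)"
  shows "smooth_field_at M p (\<lambda>x. \<Sum>i\<in>I. W i x)"
  using assms(2)
  by (induction I rule: infinite_finite_induct) (auto intro: field_zero field_add assms(1))

lemma field_minus:
  assumes "smooth_field_at M p V" "smooth_field_at M p W"
  shows "smooth_field_at M p (\<lambda>x. V x - W x)"
proof -
  have "smooth_field_at M p (\<lambda>x. V x + (- 1) *\<^sub>R W x)"
    using assms by (intro field_add field_scale smooth_at_const field_points) auto
  then show ?thesis by simp
qed

lemma field_extension:
  assumes "v \<in> tangent_space M p" "p \<in> points M"
  obtains W where "smooth_field_at M p W" "W p = v"
  using assms tangent_cases field_coord by metis

end

section \<open>Smooth maps and lifting of curves\<close>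

text \<open>Bootstrapping the differentiable inverse of the inverse function theorem. If
  \<open>g\<close> is of class C^k, then \<open>g' y v\<close> is the solution \<open>u\<close> of a
  linear system with right side \<open>v\<close> whose matrix, the derivative of
  \<open>\<Psi>\<close> at \<open>g y\<close>, is C^k in \<open>y\<close>. Elimination yields a C^k
  solution, injectivity identifies it with \<open>g' y v\<close>, and \<open>g\<close> is of class
  C^(k+1).\<close>

lemma smooth_on_local_inverse:
  fixes \<Psi> :: "'a::euclidean_space \<Rightarrow> 'a" and g :: "'a \<Rightarrow> 'a"
  assumes V: "open V" and U: "open U" "smooth_on U \<Psi>" "g ` V \<subseteq> U"
    and g: "\<And>y. y \<in> V \<Longrightarrow> (g has_derivative g' y) (at y)"
    and inv: "\<And>y v. y \<in> V \<Longrightarrow> frechet_derivative \<Psi> (at (g y)) (g' y v) = v"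
    and inj: "\<And>y. y \<in> V \<Longrightarrow> inj (frechet_derivative \<Psi> (at (g y)))"
  shows "smooth_on V g"
proof -
  have "Ck_on k V g" for k
  proof (induction k)
    case 0
    have "continuous_on V g"
      using g by (intro continuous_at_imp_continuous_on ballI has_derivative_continuous)
    then show ?case by simp
  next
    case (Suc k)
    \<comment> \<open>Matrix entries of the derivative of \<open>\<Psi>\<close> along
      \<open>g\<close>; they inherit from the induction hypothesis the regularity of
      \<open>g\<close>.\<close>
    define A where "A j i y = frechet_derivative \<Psi> (at (g y)) i \<bullet> j" for i j y
    have A: "Ck_on k V (A j i)" for i j
    proof -
      have "Ck_on k V (\<lambda>y. frechet_derivative \<Psi> (at (g y)) i)"
        using smooth_on_derivative[OF U(2), of i]
        by (intro Ck_on_compose[OF V U(1,3) Suc]) (simp add: smooth_on_def)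
      then show ?thesis
        unfolding A_def by (intro Ck_on_linear[where h = "\<lambda>z. z \<bullet> j"] V bounded_linear_inner_left)
    qed
    have lin: "linear (frechet_derivative \<Psi> (at (g y)))" if "y \<in> V" for y
      using that U smooth_on_has_derivative has_derivative_linear by blast
    have expand: "frechet_derivative \<Psi> (at (g y)) (\<Sum>i\<in>Basis. u i *\<^sub>R i) \<bullet> j = (\<Sum>i\<in>Basis. A j i y * u i)"
      if "y \<in> V" for y j and u :: "'a \<Rightarrow> real"
      by (simp add: A_def linear_sum[OF lin[OF that]] linear_cmul[OF lin[OF that]] inner_sum_left
          mult.commute)
    have "\<exists>N. open N \<and> y0 \<in> N \<and> Ck_on k N (\<lambda>y. g' y v)" if y0: "y0 \<in> V" for y0 v
    proof -
      \<comment> \<open>The ring of C^k germs at \<open>y0\<close>, over which the system is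
        eliminated.\<close>
      define R :: "('a \<Rightarrow> real) set" where "R = {f. \<exists>N. open N \<and> y0 \<in> N \<and> Ck_on k N f}"
      have R: "\<exists>N. open N \<and> y0 \<in> N \<and> Ck_on k N f \<and> Ck_on k N h" if "f \<in> R" "h \<in> R" for f h
      proof -
        from that obtain N N' where "open N" "y0 \<in> N" "Ck_on k N f" "open N'" "y0 \<in> N'" "Ck_on k N' h"
          by (auto simp: R_def)
        then show ?thesis by (intro exI[of _ "N \<inter> N'"]) (auto intro: Ck_on_subset)
      qed
      have nz: "\<exists>N. open N \<and> y0 \<in> N \<and> Ck_on k N f \<and> (\<forall>y\<in>N. f y \<noteq> 0)" if "f \<in> R" "f y0 \<noteq> 0" for f
      proof -
        from that obtain N where N: "open N" "y0 \<in> N" "Ck_on k N f" by (auto simp: R_def)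
        have "open (N \<inter> f -` (- {0}))"
          by (rule continuous_open_preimage[OF Ck_on_continuous[OF N(3)] N(1)]) auto
        with N that show ?thesis
          by (intro exI[of _ "N \<inter> f -` (- {0})"]) (auto intro: Ck_on_subset)
      qed
      have "\<exists>c. (\<forall>i\<in>Basis. c i \<in> R) \<and>
          eventually (\<lambda>y. \<forall>j\<in>Basis. (\<Sum>i\<in>Basis. A j i y * c i y) = v \<bullet> j) (nhds y0)"
      proof (rule linear_system_solvable[where p = y0])
        fix f h assume fh: "f \<in> R" "h \<in> R"
        show "(\<lambda>x. f x + h x) \<in> R" using R[OF fh] by (auto simp: R_def intro: Ck_on_add)
        show "(\<lambda>x. f x * h x) \<in> R"
          using R[OF fh] Ck_on_scaleR[of _ k f h] by (auto simp: R_def)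
      next
        fix f assume f: "f \<in> R" "f y0 \<noteq> 0"
        from nz[OF f] obtain N where "open N" "y0 \<in> N" "Ck_on k N f" "\<And>y. y \<in> N \<Longrightarrow> f y \<noteq> 0" by blast
        then show "(\<lambda>x. inverse (f x)) \<in> R" unfolding R_def using Ck_on_inverse by blast
        show "eventually (\<lambda>x. f x \<noteq> 0) (nhds y0)"
          using nz[OF f] by (auto simp: eventually_nhds)
      next
        fix u :: "'a \<Rightarrow> real" and i :: 'a
        assume u: "\<And>j. j \<in> Basis \<Longrightarrow> (\<Sum>i\<in>Basis. A j i y0 * u i) = 0" and i: "i \<in> Basis"
        have "frechet_derivative \<Psi> (at (g y0)) (\<Sum>i\<in>Basis. u i *\<^sub>R i) = 0"
          by (rule euclidean_eqI) (simp add: expand[OF y0] u)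
        then have "(\<Sum>i\<in>Basis. u i *\<^sub>R i) = 0"
          using inj[OF y0] linear_0[OF lin[OF y0]] by (metis injD)
        then show "u i = 0" using i by (metis inner_sum_left_Basis inner_zero_left)
      qed (auto simp: R_def intro!: Ck_on_const A y0 V)
      then obtain c where c: "\<And>i. i \<in> Basis \<Longrightarrow> c i \<in> R"
        "eventually (\<lambda>y. \<forall>j\<in>Basis. (\<Sum>i\<in>Basis. A j i y * c i y) = v \<bullet> j) (nhds y0)" by blast
      from c(1) have "\<forall>i\<in>Basis. \<exists>N. open N \<and> y0 \<in> N \<and> Ck_on k N (c i)" by (simp add: R_def)
      then obtain N where N: "\<And>i. i \<in> Basis \<Longrightarrow> open (N i) \<and> y0 \<in> N i \<and> Ck_on k (N i) (c i)"
        unfolding bchoice_iff by blast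
      from c(2) obtain N' where N': "open N'" "y0 \<in> N'"
        "\<And>y j. y \<in> N' \<Longrightarrow> j \<in> Basis \<Longrightarrow> (\<Sum>i\<in>Basis. A j i y * c i y) = v \<bullet> j"
        by (auto simp: eventually_nhds)
      \<comment> \<open>There are finitely many unknowns, so all coefficient functions and the
        equations hold on a common neighbourhood.\<close>
      define K where "K = V \<inter> N' \<inter> (\<Inter>i\<in>Basis. N i)"
      have K: "open K" "y0 \<in> K"
        unfolding K_def using N N' V y0 by (auto intro!: open_Int open_INT)
      have "Ck_on k K (\<lambda>y. \<Sum>i\<in>Basis. c i y *\<^sub>R i)"
        using N K by (intro Ck_on_sum Ck_on_scaleR Ck_on_const) (auto intro: Ck_on_subset simp: K_def)
      moreover have "(\<Sum>i\<in>Basis. c i y *\<^sub>R i) = g' y v" if "y \<in> K" for y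
      proof -
        have y: "y \<in> V" "y \<in> N'" using that by (auto simp: K_def)
        have "frechet_derivative \<Psi> (at (g y)) (\<Sum>i\<in>Basis. c i y *\<^sub>R i) = v"
          by (rule euclidean_eqI) (simp add: expand[OF y(1)] N'(3)[OF y(2)])
        then have "frechet_derivative \<Psi> (at (g y)) (\<Sum>i\<in>Basis. c i y *\<^sub>R i) =
            frechet_derivative \<Psi> (at (g y)) (g' y v)" by (simp only: inv[OF y(1)])
        then show ?thesis by (rule injD[OF inj[OF y(1)]])
      qed
      ultimately have "Ck_on k K (\<lambda>y. g' y v)" by (rule Ck_on_cong[OF K(1), rotated])
      with K show ?thesis by blast
    qed
    \<comment> \<open>The neighbourhoods depend on the point and on \<open>v\<close>; for each fixed
      \<open>v\<close> they cover \<open>V\<close>, and regularity is glued over the cover.\<close>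
    then obtain N where "\<And>y v. y \<in> V \<Longrightarrow> open (N y v) \<and> y \<in> N y v \<and> Ck_on k (N y v) (\<lambda>y. g' y v)"
      by metis
    then have "Ck_on k (\<Union>((\<lambda>y. N y v) ` V)) (\<lambda>y. g' y v)" "V \<subseteq> \<Union>((\<lambda>y. N y v) ` V)" for v
      by (auto intro!: Ck_on_UN)
    then have "Ck_on k V (\<lambda>y. g' y v)" for v by (rule Ck_on_subset)
    with g V show ?case by (intro Ck_on_SucI)
  qed
  then show ?thesis by (simp add: smooth_on_def)
qed

text \<open>Lifting a curve \<open>c\<close> through a submersion \<open>F\<close> with prescribed initial velocity \<open>v\<close>: with a
  right inverse \<open>R\<close> of the derivative of \<open>F\<close> at \<open>a\<close>, invert
  \<open>(t, y) \<mapsto> (t, F (a + t v + R y) - c t)\<close>, whose derivative at the origin is the identity.\<close>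

lemma smooth_curve_lift:
  fixes F :: "'e::euclidean_space \<Rightarrow> 'f::euclidean_space" and c :: "real \<Rightarrow> 'f"
  assumes T: "open T" "a \<in> T" "smooth_on T F" and surj: "surj (frechet_derivative F (at a))"
    and c: "\<epsilon> > 0" "smooth_on {-\<epsilon><..<\<epsilon>} c" "c 0 = F a"
    "(c has_vector_derivative frechet_derivative F (at a) v) (at 0)"
  obtains \<delta> \<gamma> where "\<delta> > 0" "smooth_on {-\<delta><..<\<delta>} \<gamma>" "\<gamma> 0 = a" "(\<gamma> has_vector_derivative v) (at 0)"
    "\<And>t. t \<in> {-\<delta><..<\<delta>} \<Longrightarrow> \<gamma> t \<in> T \<and> F (\<gamma> t) = c t"
proof -
  define D where "D = frechet_derivative F (at a)"
  have F: "(F has_derivative D) (at a)"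
    unfolding D_def using smooth_on_has_derivative T by blast
  then have "linear D" by (rule has_derivative_linear)
  then obtain R where R: "linear R" "\<And>u. D (R u) = u"
    using linear_surjective_right_inverse surj by (metis D_def comp_apply id_apply)
  define L where "L x = fst x *\<^sub>R v + R (snd x)" for x :: "real \<times> 'f"
  have L: "bounded_linear L"
    unfolding L_def
    by (intro bounded_linear_intros R(1)[THEN linear_conv_bounded_linear[THEN iffD1], THEN bounded_linear_compose])
  define \<Psi> where "\<Psi> x = (fst x, F (a + L x) - c (fst x))" for x :: "real \<times> 'f"
  define U where "U = ({-\<epsilon><..<\<epsilon>} \<times> UNIV) \<inter> (\<lambda>x. a + L x) -` T"
  have oU: "open U"
    unfolding U_def using T
    by (intro open_Int open_vimage open_Times continuous_intros linear_continuous_on L) auto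
  have L0: "L 0 = 0" using bounded_linear.linear[OF L] by (rule linear_0)
  have U0: "0 \<in> U" using T c(1) L0 by (auto simp: U_def zero_prod_def)
  have smooth_id: "smooth_on U (\<lambda>x. x)" using oU by (rule smooth_on_id)
  have "smooth_on U (\<lambda>x. (fst x, 0) + ((0, F (a + L x)) + (0, - c (fst x))))"
  proof (intro smooth_on_add oU)
    show "smooth_on U (\<lambda>x. (fst x, 0::'f))"
      by (rule smooth_on_linear[OF oU bounded_linear_Pair[OF bounded_linear_fst bounded_linear_zero] smooth_id])
    have "smooth_on U (\<lambda>x. F (a + L x))"
      by (rule smooth_on_compose[OF oU T(1) _ _ T(3)])
        (auto simp: U_def intro!: smooth_on_add smooth_on_const smooth_on_linear[OF oU L smooth_id, unfolded U_def] oU[unfolded U_def])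
    then show "smooth_on U (\<lambda>x. (0::real, F (a + L x)))"
      by (rule smooth_on_linear[OF oU bounded_linear_Pair[OF bounded_linear_zero bounded_linear_ident]])
    have "smooth_on U (\<lambda>x. c (fst x))"
      by (rule smooth_on_compose[OF oU open_greaterThanLessThan _ _ c(2)])
        (auto simp: U_def intro!: smooth_on_linear[OF oU bounded_linear_fst smooth_id, unfolded U_def])
    then show "smooth_on U (\<lambda>x. (0::real, - c (fst x)))"
      by (rule smooth_on_linear[OF oU bounded_linear_Pair[OF bounded_linear_zero
            bounded_linear_minus[OF bounded_linear_ident]]])
  qed
  then have smooth\<Psi>: "smooth_on U \<Psi>" by (simp add: \<Psi>_def[abs_def])
  \<comment> \<open>The inverse function theorem expects a continuous operator-valued derivative; in
    finite dimension its continuity follows from that of its values on basis vectors.\<close>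
  define f' where "f' x = Blinfun (frechet_derivative \<Psi> (at x))" for x
  have f': "blinfun_apply (f' x) = frechet_derivative \<Psi> (at x)" if "x \<in> U" for x
    unfolding f'_def using smooth_on_has_derivative[OF smooth\<Psi> that] has_derivative_bounded_linear
    by (intro bounded_linear_Blinfun_apply) blast
  have der: "(\<Psi> has_derivative blinfun_apply (f' x)) (at x)" if "x \<in> U" for x
    using smooth_on_has_derivative[OF smooth\<Psi> that] f'[OF that] by simp
  have "continuous_on U (\<lambda>x. blinfun_apply (f' x) i)" for i
    using smooth_on_continuous[OF smooth_on_derivative[OF smooth\<Psi>]] f'
    by (simp cong: continuous_on_cong)
  then have cont: "continuous_on U f'" by (intro continuous_on_blinfun_componentwise)
  have "(\<Psi> has_derivative (\<lambda>x. (fst x, D (L x) - fst x *\<^sub>R D v))) (at 0)"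
  proof -
    have "((\<lambda>x. F (a + L x)) has_derivative (\<lambda>x. D (L x))) (at 0)"
      by (rule has_derivative_compose[where f = "\<lambda>x. a + L x" and f' = L])
        (use F L0 in \<open>auto intro!: derivative_eq_intros bounded_linear_imp_has_derivative[OF L]\<close>)
    moreover have "((\<lambda>x. c (fst x)) has_derivative (\<lambda>x. fst x *\<^sub>R D v)) (at (0 :: real \<times> 'f))"
      by (rule has_derivative_compose[where f = fst and f' = fst])
        (use c(4) in \<open>auto simp: has_vector_derivative_def D_def intro!: derivative_eq_intros\<close>)
    ultimately show ?thesis
      unfolding \<Psi>_def by (auto intro!: has_derivative_Pair has_derivative_diff derivative_eq_intros)
  qed
  \<comment> \<open>Since \<open>D (R u) = u\<close>, the terms in \<open>D v\<close> cancel and the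
    second component is \<open>snd x\<close>.\<close>
  moreover have "(\<lambda>x. (fst x, D (L x) - fst x *\<^sub>R D v)) = id"
    using \<open>linear D\<close> R(2) by (auto simp: L_def linear_add linear_cmul fun_eq_iff)
  ultimately have D0: "frechet_derivative \<Psi> (at 0) = id"
    using frechet_derivative_eqI by metis
  have "id_blinfun o\<^sub>L f' 0 = id_blinfun"
    by (rule blinfun_eqI) (simp add: f' U0 D0)
  from inverse_function_theorem[OF oU der cont U0 this] obtain U' V g g' where
    UV: "open U'" "U' \<subseteq> U" "0 \<in> U'" "open V" "\<Psi> 0 \<in> V" "homeomorphism U' V \<Psi> g"
    and g': "\<And>y. y \<in> V \<Longrightarrow> (g has_derivative g' y) (at y)"
    "\<And>y. y \<in> V \<Longrightarrow> g' y = inv (blinfun_apply (f' (g y)))"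
    "\<And>y. y \<in> V \<Longrightarrow> bij (blinfun_apply (f' (g y)))" by metis
  have gU: "g y \<in> U'" "\<Psi> (g y) = y" if "y \<in> V" for y
    using UV(6) that by (auto simp: homeomorphism_def)
  have g0: "g 0 = 0" "0 \<in> V"
    using UV c(3) L0 by (auto simp: homeomorphism_def \<Psi>_def zero_prod_def)
  have smooth_g: "smooth_on V g"
  proof (rule smooth_on_local_inverse[OF UV(4) oU smooth\<Psi> _ g'(1)])
    show "g ` V \<subseteq> U" using gU UV(2) by blast
    show "frechet_derivative \<Psi> (at (g y)) (g' y v) = v" if "y \<in> V" for y v
      using g'(2,3)[OF that] f'[of "g y"] gU(1)[OF that] UV(2) by (metis bij_inv_eq_iff subsetD)
    show "inj (frechet_derivative \<Psi> (at (g y)))" if "y \<in> V" for y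
      using g'(3)[OF that] f'[of "g y"] gU(1)[OF that] UV(2) by (metis bij_is_inj subsetD)
  qed
  have "open ((\<lambda>t::real. (t, 0::'f)) -` V)"
    by (intro open_vimage UV(4) continuous_intros)
  moreover have "0 \<in> (\<lambda>t::real. (t, 0::'f)) -` V" using g0 by (simp add: zero_prod_def)
  ultimately obtain \<delta> where \<delta>: "\<delta> > 0" "ball 0 \<delta> \<subseteq> (\<lambda>t::real. (t, 0::'f)) -` V"
    using open_contains_ball by blast
  have \<delta>V: "(t, 0) \<in> V" if "t \<in> {-\<delta><..<\<delta>}" for t
    using \<delta>(2) that by (force simp: ball_def dist_real_def)
  \<comment> \<open>As \<open>\<Psi>\<close> keeps the first component, that of
    \<open>g (t, 0)\<close> is \<open>t\<close>; the vanishing second component then reads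
    \<open>F (\<gamma> t) = c t\<close>.\<close>
  define \<gamma> where "\<gamma> t = a + L (g (t, 0))" for t
  have bl: "bounded_linear (\<lambda>t. (t, 0::'f))"
    by (rule bounded_linear_Pair[OF bounded_linear_ident bounded_linear_zero])
  have "smooth_on {-\<delta><..<\<delta>} (\<lambda>t. g (t, 0))"
    by (rule smooth_on_compose[OF _ UV(4) _ _ smooth_g])
      (use \<delta>V smooth_on_linear[OF open_greaterThanLessThan bl smooth_on_id[OF open_greaterThanLessThan]] in auto)
  then have "smooth_on {-\<delta><..<\<delta>} \<gamma>"
    unfolding \<gamma>_def by (intro smooth_on_add smooth_on_const smooth_on_linear[OF _ L]) auto
  moreover have "\<gamma> 0 = a"
    using g0 L0 by (simp add: \<gamma>_def zero_prod_def[symmetric])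
  moreover have "(\<gamma> has_vector_derivative v) (at 0)"
  proof -
    have "g' 0 = id"
      using g'(2)[OF g0(2)] f'[OF U0] D0 g0 by simp
    then have "(g has_derivative id) (at (0, 0))"
      using g'(1)[OF g0(2)] by (simp add: zero_prod_def)
    then have "((\<lambda>t. g (t, 0)) has_derivative (\<lambda>t. id (t, 0))) (at 0)"
      by (rule has_derivative_compose[OF bounded_linear_imp_has_derivative[OF bl]])
    then have "(\<gamma> has_derivative (\<lambda>t. L (t, 0))) (at 0)"
      unfolding \<gamma>_def by (auto intro!: derivative_eq_intros bounded_linear.has_derivative[OF L])
    then show ?thesis
      using R(1) by (simp add: has_vector_derivative_def L_def linear_0)
  qed
  moreover have "\<gamma> t \<in> T \<and> F (\<gamma> t) = c t" if "t \<in> {-\<delta><..<\<delta>}" for t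
    using gU[OF \<delta>V[OF that]] UV(2) by (auto simp: \<gamma>_def \<Psi>_def U_def)
  ultimately show ?thesis using that \<delta>(1) by blast
qed

lemma (in smooth_mfd) coord_field_inject:
  assumes "(U, \<phi>) \<in> charts M" "p \<in> U" "coord_field U \<phi> c p = coord_field U \<phi> d p"
  shows "c = d"
  by (rule euclidean_eqI) (metis coord_field_coord assms)

lemma (in smooth_mfd) smooth_curveI:
  assumes "(U, \<phi>) \<in> charts M" "\<epsilon> > 0" "\<gamma> ` {-\<epsilon><..<\<epsilon>} \<subseteq> U" "smooth_on {-\<epsilon><..<\<epsilon>} (\<phi> \<circ> \<gamma>)"
  shows "smooth_curve M \<gamma>"
  unfolding smooth_curve_def using assms by (intro bexI[OF _ assms(1)]) auto

section \<open>Smooth maps and their differentials in charts\<close>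

locale smooth_mfd_map = M: smooth_mfd M + B: smooth_mfd B
  for M :: "('a, 'e::euclidean_space) manifold" and B :: "('b, 'f::euclidean_space) manifold" +
  fixes \<pi> :: "'a \<Rightarrow> 'b"
  assumes smooth_map: "smooth_map M B \<pi>"
begin

lemma map_points: "p \<in> points M \<Longrightarrow> \<pi> p \<in> points B"
  using smooth_map unfolding smooth_map_def by blast

text \<open>\<open>smooth_map\<close> grants smoothness in some pair of charts; transition maps on
  both sides carry it to a given pair. \<open>T\<close> is shrunk until the image stays in
  \<open>V\<close>, where \<open>\<psi>\<close> is meaningful.\<close>

lemma map_chart:
  assumes c: "(U, \<phi>) \<in> charts M" "p \<in> U" and d: "(V, \<psi>) \<in> charts B" "\<pi> p \<in> V"
  obtains T where "open T" "\<phi> p \<in> T" "T \<subseteq> \<phi> ` U" "\<And>x. x \<in> U \<Longrightarrow> \<phi> x \<in> T \<Longrightarrow> \<pi> x \<in> V"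
    "smooth_on T (\<psi> \<circ> \<pi> \<circ> inv_into U \<phi>)"
proof -
  have "p \<in> points M" using M.chart_subset c by blast
  with smooth_map have "\<exists>(U, \<phi>)\<in>charts M. \<exists>(V, \<psi>)\<in>charts B. \<exists>W.
        openin (mtop M) W \<and> p \<in> W \<and> W \<subseteq> U \<and> \<pi> ` W \<subseteq> V \<and>
        smooth_on (\<phi> ` W) (\<psi> \<circ> \<pi> \<circ> inv_into U \<phi>)"
    unfolding smooth_map_def by simp
  then obtain U1 \<phi>1 V1 \<psi>1 W where 1: "(U1, \<phi>1) \<in> charts M" "(V1, \<psi>1) \<in> charts B"
    "openin (mtop M) W" "p \<in> W" "W \<subseteq> U1" "\<pi> ` W \<subseteq> V1"
    "smooth_on (\<phi>1 ` W) (\<psi>1 \<circ> \<pi> \<circ> inv_into U1 \<phi>1)" by auto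
  define A where "A = \<phi> ` (U \<inter> W)"
  define G where "G = (\<lambda>z. (\<psi>1 \<circ> \<pi> \<circ> inv_into U1 \<phi>1) ((\<phi>1 \<circ> inv_into U \<phi>) z))"
  have oA: "open A"
    unfolding A_def using 1 by (intro M.chart_open_image[OF c(1)] openin_Int M.openin_chart[OF c(1)]) auto
  have tA: "smooth_on A (\<phi>1 \<circ> inv_into U \<phi>)"
    by (rule smooth_on_subset[OF M.transition_smooth[OF c(1) 1(1)]]) (use 1 in \<open>auto simp: A_def\<close>)
  have sG: "smooth_on A G"
    unfolding G_def
    by (rule smooth_on_compose[OF oA _ _ tA 1(7)])
      (use 1 c M.chart_open_image[OF 1(1,3,5)] in \<open>auto simp: A_def\<close>)
  have oVV: "open (\<psi>1 ` (V1 \<inter> V))"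
    using 1 d by (intro B.chart_open_image[OF 1(2)] openin_Int B.openin_chart) auto
  define T where "T = A \<inter> G -` (\<psi>1 ` (V1 \<inter> V))"
  have oT: "open T"
    unfolding T_def using continuous_open_preimage[OF smooth_on_continuous[OF sG] oA oVV] .
  have Gval: "G (\<phi> x) = \<psi>1 (\<pi> x)" if "x \<in> U" "x \<in> W" for x
    using that 1(1,5) c(1) by (auto simp: G_def)
  have xW: "x \<in> W" if "x \<in> U" "\<phi> x \<in> A" for x
    using that inj_onD[OF M.inj_chart[OF c(1)]] by (auto simp: A_def)
  have V: "\<pi> x \<in> V" if "x \<in> U" "\<phi> x \<in> T" for x
  proof -
    have "x \<in> W" using xW that by (simp add: T_def)
    with that obtain y where y: "\<psi>1 (\<pi> x) = \<psi>1 y" "y \<in> V1 \<inter> V" by (auto simp: T_def Gval)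
    moreover have "\<pi> x \<in> V1" using \<open>x \<in> W\<close> 1(6) by blast
    ultimately show ?thesis using inj_onD[OF B.inj_chart[OF 1(2)] y(1)] by auto
  qed
  have "smooth_on T (\<lambda>z. (\<psi> \<circ> inv_into V1 \<psi>1) (G z))"
    by (rule smooth_on_compose[OF oT oVV _ smooth_on_subset[OF sG] B.transition_smooth[OF 1(2) d(1)]])
      (auto simp: T_def)
  then have "smooth_on T (\<psi> \<circ> \<pi> \<circ> inv_into U \<phi>)"
  proof (rule smooth_on_cong[OF oT, rotated])
    fix z assume z: "z \<in> T"
    then obtain x where x: "z = \<phi> x" "x \<in> U" "x \<in> W" by (auto simp: T_def A_def)
    then show "(\<psi> \<circ> inv_into V1 \<psi>1) (G z) = (\<psi> \<circ> \<pi> \<circ> inv_into U \<phi>) z"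
      using 1(2,6) c(1) Gval[OF x(2,3)] by (auto simp: image_subset_iff)
  qed
  moreover have "\<phi> p \<in> T"
    using c d 1(4,6) Gval[of p] by (auto simp: T_def A_def image_subset_iff)
  moreover have "T \<subseteq> \<phi> ` U" by (auto simp: T_def A_def)
  ultimately show ?thesis using that oT V by blast
qed

text \<open>Continuity of \<open>\<pi>\<close> in the language of germs, read off its continuous
  coordinate representation.\<close>

lemma map_eventually:
  assumes "eventually P (nhdsin (mtop B) (\<pi> p))" "p \<in> points M"
  shows "eventually (\<lambda>x. P (\<pi> x)) (nhdsin (mtop M) p)"
proof -
  obtain U \<phi> where c: "(U, \<phi>) \<in> charts M" "p \<in> U" using M.chart_at assms(2) by blast
  obtain V \<psi> where d: "(V, \<psi>) \<in> charts B" "\<pi> p \<in> V" using B.chart_at map_points assms(2) by blast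
  obtain T where T: "open T" "\<phi> p \<in> T" "T \<subseteq> \<phi> ` U" "\<And>x. x \<in> U \<Longrightarrow> \<phi> x \<in> T \<Longrightarrow> \<pi> x \<in> V"
    "smooth_on T (\<psi> \<circ> \<pi> \<circ> inv_into U \<phi>)" using map_chart[OF c d] by blast
  obtain W where W: "openin (mtop B) W" "\<pi> p \<in> W" "\<And>x. x \<in> W \<Longrightarrow> P x"
    using assms map_points by (auto simp: eventually_nhdsin)
  define T' where "T' = T \<inter> (\<psi> \<circ> \<pi> \<circ> inv_into U \<phi>) -` (\<psi> ` (V \<inter> W))"
  have "open (\<psi> ` (V \<inter> W))"
    using W d by (intro B.chart_open_image[OF d(1)] openin_Int B.openin_chart[OF d(1)]) auto
  then have oT': "open T'"
    unfolding T'_def using continuous_open_preimage[OF smooth_on_continuous[OF T(5)] T(1)] by blast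
  show ?thesis
  proof (rule eventually_nhdsin_open[OF M.chart_open_preimage[OF c(1) oT']])
    show "p \<in> {x \<in> U. \<phi> x \<in> T'}" using c d T W by (auto simp: T'_def)
    fix x assume "x \<in> {x \<in> U. \<phi> x \<in> T'}"
    then have x: "x \<in> U" "\<phi> x \<in> T" "\<psi> (\<pi> x) \<in> \<psi> ` (V \<inter> W)" using c(1) by (auto simp: T'_def)
    from x(3) obtain y where y: "\<psi> (\<pi> x) = \<psi> y" "y \<in> V \<inter> W" by blast
    then have "\<pi> x = y" using inj_onD[OF B.inj_chart[OF d(1)] y(1)] T(4)[OF x(1,2)] by auto
    then show "P (\<pi> x)" using W(3) y by auto
  qed
qed

lemma map_smooth_at:
  assumes "smooth_at B (\<pi> p) f" "p \<in> points M"
  shows "smooth_at M p (f \<circ> \<pi>)"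
proof -
  obtain U \<phi> where c: "(U, \<phi>) \<in> charts M" "p \<in> U" using M.chart_at assms(2) by blast
  obtain V \<psi> where d: "(V, \<psi>) \<in> charts B" "\<pi> p \<in> V" using B.chart_at map_points assms(2) by blast
  obtain T where T: "open T" "\<phi> p \<in> T" "T \<subseteq> \<phi> ` U" "\<And>x. x \<in> U \<Longrightarrow> \<phi> x \<in> T \<Longrightarrow> \<pi> x \<in> V"
    "smooth_on T (\<psi> \<circ> \<pi> \<circ> inv_into U \<phi>)" using map_chart[OF c d] by blast
  obtain S where S: "open S" "\<psi> (\<pi> p) \<in> S" "S \<subseteq> \<psi> ` V" "smooth_on S (f \<circ> inv_into V \<psi>)"
    using B.smooth_atE[OF assms(1) d] by blast
  define T' where "T' = T \<inter> (\<psi> \<circ> \<pi> \<circ> inv_into U \<phi>) -` S"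
  have oT': "open T'"
    unfolding T'_def using continuous_open_preimage[OF smooth_on_continuous[OF T(5)] T(1) S(1)] .
  have sm: "smooth_on T' (\<lambda>z. (f \<circ> inv_into V \<psi>) ((\<psi> \<circ> \<pi> \<circ> inv_into U \<phi>) z))"
    by (rule smooth_on_compose[OF oT' S(1) _ smooth_on_subset[OF T(5)] S(4)]) (auto simp: T'_def)
  show ?thesis
    by (rule M.smooth_atI[OF c oT' _ sm]) (use T S c d in \<open>auto simp: T'_def\<close>)
qed

lemma differential_apply:
  "smooth_at B (\<pi> p) f \<Longrightarrow> differential B \<pi> p v f = v (f \<circ> \<pi>)"
  by (simp add: differential_def)

lemma differential_linear: "linear (differential B \<pi> p)"
  by (auto simp: linear_iff differential_def fun_eq_iff scaleR_fun_def)

lemma map_curve: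
  assumes "smooth_curve M \<gamma>"
  shows "smooth_curve B (\<pi> \<circ> \<gamma>)" "velocity B (\<pi> \<circ> \<gamma>) = differential B \<pi> (\<gamma> 0) (velocity M \<gamma>)"
proof -
  obtain U0 \<phi>0 \<epsilon>0 where 0: "(U0, \<phi>0) \<in> charts M" "\<epsilon>0 > 0" "\<gamma> ` {-\<epsilon>0<..<\<epsilon>0} \<subseteq> U0"
    using assms unfolding smooth_curve_def by auto
  have "\<gamma> 0 \<in> U0" using 0 by auto
  with 0 have p: "\<gamma> 0 \<in> points M" using M.chart_subset by blast
  obtain U \<phi> where c: "(U, \<phi>) \<in> charts M" "\<gamma> 0 \<in> U" using M.chart_at p by blast
  obtain V \<psi> where d: "(V, \<psi>) \<in> charts B" "\<pi> (\<gamma> 0) \<in> V" using B.chart_at map_points p by blast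
  obtain T where T: "open T" "\<phi> (\<gamma> 0) \<in> T" "T \<subseteq> \<phi> ` U" "\<And>x. x \<in> U \<Longrightarrow> \<phi> x \<in> T \<Longrightarrow> \<pi> x \<in> V"
    "smooth_on T (\<psi> \<circ> \<pi> \<circ> inv_into U \<phi>)" using map_chart[OF c d] by blast
  obtain \<epsilon> where e: "\<epsilon> > 0" "\<gamma> ` {-\<epsilon><..<\<epsilon>} \<subseteq> U" "smooth_on {-\<epsilon><..<\<epsilon>} (\<phi> \<circ> \<gamma>)"
    using M.smooth_curve_chart[OF assms c] by blast
  have "open ({-\<epsilon><..<\<epsilon>} \<inter> (\<phi> \<circ> \<gamma>) -` T)"
    by (rule continuous_open_preimage[OF smooth_on_continuous[OF e(3)] _ T(1)]) auto
  moreover have "0 \<in> {-\<epsilon><..<\<epsilon>} \<inter> (\<phi> \<circ> \<gamma>) -` T" using e T by auto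
  ultimately obtain \<delta> where \<delta>: "\<delta> > 0" "ball 0 \<delta> \<subseteq> {-\<epsilon><..<\<epsilon>} \<inter> (\<phi> \<circ> \<gamma>) -` T"
    using open_contains_ball by blast
  then have \<delta>T: "{-\<delta><..<\<delta>} \<subseteq> {-\<epsilon><..<\<epsilon>} \<inter> (\<phi> \<circ> \<gamma>) -` T"
    by (force simp: ball_def dist_real_def)
  have "smooth_on {-\<delta><..<\<delta>} (\<lambda>t. (\<psi> \<circ> \<pi> \<circ> inv_into U \<phi>) ((\<phi> \<circ> \<gamma>) t))"
    by (rule smooth_on_compose[OF _ T(1) _ smooth_on_subset[OF e(3)] T(5)]) (use \<delta>T in auto)
  then have sm: "smooth_on {-\<delta><..<\<delta>} (\<psi> \<circ> (\<pi> \<circ> \<gamma>))"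
  proof (rule smooth_on_cong[rotated -1])
    fix t assume "t \<in> {-\<delta><..<\<delta>}"
    then have "\<gamma> t \<in> U" using \<delta>T e(2) by blast
    then show "(\<psi> \<circ> \<pi> \<circ> inv_into U \<phi>) ((\<phi> \<circ> \<gamma>) t) = (\<psi> \<circ> (\<pi> \<circ> \<gamma>)) t" using c(1) by simp
  qed auto
  show "smooth_curve B (\<pi> \<circ> \<gamma>)"
    by (rule B.smooth_curveI[OF d(1) \<delta>(1) _ sm]) (use \<delta>T T(4) e(2) in \<open>force\<close>)
  show "velocity B (\<pi> \<circ> \<gamma>) = differential B \<pi> (\<gamma> 0) (velocity M \<gamma>)"
    using map_smooth_at[OF _ p] by (auto simp: velocity_def differential_def fun_eq_iff o_assoc)
qed

lemma differential_tangent: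
  assumes "v \<in> tangent_space M p"
  shows "differential B \<pi> p v \<in> tangent_space B (\<pi> p)"
proof -
  obtain \<gamma> where "smooth_curve M \<gamma>" "v = velocity M \<gamma>" "\<gamma> 0 = p"
    using assms unfolding tangent_space_def by blast
  then show ?thesis
    unfolding tangent_space_def using map_curve[of \<gamma>]
    by (intro CollectI exI[of _ "\<pi> \<circ> \<gamma>"]) auto
qed

text \<open>The chain rule identifies the differential with the Jacobian, which turns a surjective
  differential into the Euclidean hypothesis of \<open>smooth_curve_lift\<close>.\<close>

lemma differential_coord_field:
  assumes c: "(U, \<phi>) \<in> charts M" "p \<in> U" and d: "(V, \<psi>) \<in> charts B" "\<pi> p \<in> V"
  defines "D \<equiv> frechet_derivative (\<psi> \<circ> \<pi> \<circ> inv_into U \<phi>) (at (\<phi> p))"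
  shows "differential B \<pi> p (M.coord_field U \<phi> u p) = B.coord_field V \<psi> (D u) (\<pi> p)"
proof
  fix f
  show "differential B \<pi> p (M.coord_field U \<phi> u p) f = B.coord_field V \<psi> (D u) (\<pi> p) f"
  proof (cases "smooth_at B (\<pi> p) f")
    case True
    have p: "p \<in> points M" using M.chart_subset c by blast
    obtain T where T: "open T" "\<phi> p \<in> T" "T \<subseteq> \<phi> ` U" "\<And>x. x \<in> U \<Longrightarrow> \<phi> x \<in> T \<Longrightarrow> \<pi> x \<in> V"
      "smooth_on T (\<psi> \<circ> \<pi> \<circ> inv_into U \<phi>)" using map_chart[OF c d] by blast
    have val: "(\<psi> \<circ> \<pi> \<circ> inv_into U \<phi>) (\<phi> p) = \<psi> (\<pi> p)" using c by simp
    have "((\<lambda>z. (f \<circ> inv_into V \<psi>) ((\<psi> \<circ> \<pi> \<circ> inv_into U \<phi>) z)) has_derivative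
        (\<lambda>u. B.coord_field V \<psi> (D u) (\<pi> p) f)) (at (\<phi> p))"
      by (rule has_derivative_compose[OF smooth_on_has_derivative[OF T(5,2)], folded D_def])
        (unfold val, rule B.has_derivative_coord[OF True d])
    then have "((f \<circ> \<pi> \<circ> inv_into U \<phi>) has_derivative (\<lambda>u. B.coord_field V \<psi> (D u) (\<pi> p) f)) (at (\<phi> p))"
      by (rule has_derivative_transform_within_open[OF _ T(1,2)]) (use T c d in auto)
    from M.coord_field_eqI[OF map_smooth_at[OF True p] c this]
    show ?thesis by (simp add: differential_apply[OF True])
  qed (simp add: differential_def B.coord_field_def)
qed

section \<open>Lifted curves and tangent spaces of preimages\<close>

lemma curve_lift:
  assumes p: "p \<in> points M" and v: "v \<in> tangent_space M p"
    and onto: "tangent_space B (\<pi> p) \<subseteq> differential B \<pi> p ` tangent_space M p"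
    and k: "smooth_curve B k" "k 0 = \<pi> p" "velocity B k = differential B \<pi> p v"
  obtains \<gamma> where "smooth_curve M \<gamma>" "\<gamma> 0 = p" "velocity M \<gamma> = v"
    "eventually (\<lambda>t. \<gamma> t \<in> points M \<and> \<pi> (\<gamma> t) = k t) (nhds 0)"
proof -
  obtain U \<phi> where c: "(U, \<phi>) \<in> charts M" "p \<in> U" using M.chart_at p by blast
  obtain V \<psi> where d: "(V, \<psi>) \<in> charts B" "\<pi> p \<in> V" using B.chart_at map_points p by blast
  obtain T where T: "open T" "\<phi> p \<in> T" "T \<subseteq> \<phi> ` U" "\<And>x. x \<in> U \<Longrightarrow> \<phi> x \<in> T \<Longrightarrow> \<pi> x \<in> V"
    "smooth_on T (\<psi> \<circ> \<pi> \<circ> inv_into U \<phi>)" using map_chart[OF c d] by blast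
  let ?F = "\<psi> \<circ> \<pi> \<circ> inv_into U \<phi>"
  let ?D = "frechet_derivative ?F (at (\<phi> p))"
  note dcf = differential_coord_field[OF c d]
  obtain v0 where v0: "v = M.coord_field U \<phi> v0 p" using v M.tangent_space_chart[OF c] by auto
  \<comment> \<open>A tangent vector determines its coordinate vector, so surjectivity of the
    differential passes to the Jacobian.\<close>
  have surj: "surj ?D"
    unfolding surj_def
  proof
    fix w
    have "B.coord_field V \<psi> w (\<pi> p) \<in> differential B \<pi> p ` tangent_space M p"
      using onto B.coord_field_tangent[OF d] by blast
    then obtain u where "B.coord_field V \<psi> w (\<pi> p) = differential B \<pi> p (M.coord_field U \<phi> u p)"
      using M.tangent_space_chart[OF c] by auto
    then have "w = ?D u" using B.coord_field_inject[OF d] dcf by simp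
    then show "\<exists>x. w = ?D x" by blast
  qed
  have k0: "k 0 \<in> V" using k d by simp
  obtain \<epsilon> where e: "\<epsilon> > 0" "k ` {-\<epsilon><..<\<epsilon>} \<subseteq> V" "smooth_on {-\<epsilon><..<\<epsilon>} (\<psi> \<circ> k)"
    using B.smooth_curve_chart[OF k(1) d(1) k0] by blast
  obtain w where w: "((\<psi> \<circ> k) has_vector_derivative w) (at 0)" "velocity B k = B.coord_field V \<psi> w (k 0)"
    using B.velocity_curve[OF k(1) d(1) k0] by metis
  have "w = ?D v0"
    using w(2) k(2,3) dcf B.coord_field_inject[OF d] v0 by simp
  with w(1) have w': "((\<psi> \<circ> k) has_vector_derivative ?D v0) (at 0)" by simp
  have k0': "(\<psi> \<circ> k) 0 = ?F (\<phi> p)" using k(2) c by simp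
  obtain \<delta> \<gamma> where g: "\<delta> > 0" "smooth_on {-\<delta><..<\<delta>} \<gamma>" "\<gamma> 0 = \<phi> p" "(\<gamma> has_vector_derivative v0) (at 0)"
    "\<And>t. t \<in> {-\<delta><..<\<delta>} \<Longrightarrow> \<gamma> t \<in> T \<and> ?F (\<gamma> t) = (\<psi> \<circ> k) t"
    using smooth_curve_lift[OF T(1,2,5) surj e(1,3) k0' w'] by blast
  define \<gamma>' where "\<gamma>' = inv_into U \<phi> \<circ> \<gamma>"
  have g': "\<gamma>' t \<in> U" "\<phi> (\<gamma>' t) = \<gamma> t" if "t \<in> {-\<delta><..<\<delta>}" for t
    using g(5)[OF that] T(3) by (auto simp: \<gamma>'_def inv_into_into f_inv_into_f subsetD)
  have g'0: "\<gamma>' 0 = p" using g(3) c by (simp add: \<gamma>'_def)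
  have "smooth_on {-\<delta><..<\<delta>} (\<phi> \<circ> \<gamma>')"
    by (rule smooth_on_cong[OF _ _ g(2)]) (use g' in auto)
  then have sc: "smooth_curve M \<gamma>'" using g' by (intro M.smooth_curveI[OF c(1) g(1)]) auto
  have ev: "eventually (\<lambda>t. \<gamma>' t \<in> U) (nhds 0)"
    by (rule M.eventually_open_interval[OF g(1) g'(1)])
  have "eventually (\<lambda>t. \<gamma> t = (\<phi> \<circ> \<gamma>') t) (nhds 0)"
    by (rule M.eventually_open_interval[OF g(1)]) (simp add: g'(2))
  then have "((\<phi> \<circ> \<gamma>') has_vector_derivative v0) (at 0)"
    using g(4) g'0 g(3) by (subst (asm) has_vector_derivative_cong_ev[where g = "\<phi> \<circ> \<gamma>'"]) auto
  then have vel: "velocity M \<gamma>' = v"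
    using M.velocity_chart[OF c(1) _ _ ev] g'0 c v0 by simp
  have ev2: "eventually (\<lambda>t. t \<in> {-\<epsilon><..<\<epsilon>}) (nhds 0)"
    by (rule M.eventually_open_interval[OF e(1)])
  have ev3: "eventually (\<lambda>t. t \<in> {-\<delta><..<\<delta>}) (nhds 0)"
    by (rule M.eventually_open_interval[OF g(1)])
  have "eventually (\<lambda>t. \<gamma>' t \<in> points M \<and> \<pi> (\<gamma>' t) = k t) (nhds 0)"
    using ev2 ev3
  proof eventually_elim
    case (elim t)
    have "\<phi> (\<gamma>' t) \<in> T" using g(5)[OF elim(2)] g'[OF elim(2)] by simp
    then have "\<pi> (\<gamma>' t) \<in> V" using T(4) g'[OF elim(2)] by blast
    moreover have "\<psi> (\<pi> (\<gamma>' t)) = \<psi> (k t)" using g(5)[OF elim(2)] by (simp add: \<gamma>'_def)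
    moreover have "k t \<in> V" using e(2) elim(1) by blast
    ultimately have "\<pi> (\<gamma>' t) = k t" using inj_onD[OF B.inj_chart[OF d(1)]] by blast
    then show ?case using M.chart_subset[OF c(1)] g'[OF elim(2)] by blast
  qed
  with that sc g'0 vel show ?thesis by blast
qed

text \<open>For the inclusion from right to left, the curve in \<open>P\<close> must be lifted with
  initial velocity exactly \<open>v\<close>, not merely with one that has the same image; this is
  why \<open>curve_lift\<close> prescribes the velocity.\<close>

lemma sub_tangent_total_lift:
  assumes p: "p \<in> total_lift M \<pi> P"
    and onto: "tangent_space B (\<pi> p) \<subseteq> differential B \<pi> p ` tangent_space M p"
  shows "sub_tangent_space M (total_lift M \<pi> P) p =
    {v \<in> tangent_space M p. differential B \<pi> p v \<in> sub_tangent_space B P (\<pi> p)}"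
proof (intro set_eqI iffI)
  fix v assume "v \<in> sub_tangent_space M (total_lift M \<pi> P) p"
  then obtain \<gamma> where g: "smooth_curve M \<gamma>" "v = velocity M \<gamma>" "\<gamma> 0 = p"
    "eventually (\<lambda>t. \<gamma> t \<in> total_lift M \<pi> P) (nhds 0)" by (auto simp: sub_tangent_space_def)
  have "eventually (\<lambda>t. (\<pi> \<circ> \<gamma>) t \<in> P) (nhds 0)"
    using g(4) by eventually_elim (simp add: total_lift_def)
  moreover have "velocity B (\<pi> \<circ> \<gamma>) = differential B \<pi> p v" using map_curve[OF g(1)] g by simp
  ultimately have "differential B \<pi> p v \<in> sub_tangent_space B P (\<pi> p)"
    unfolding sub_tangent_space_def using map_curve(1)[OF g(1)] g(3)
    by (intro CollectI exI[of _ "\<pi> \<circ> \<gamma>"]) auto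
  then show "v \<in> {v \<in> tangent_space M p. differential B \<pi> p v \<in> sub_tangent_space B P (\<pi> p)}"
    using g by (auto simp: tangent_space_def)
next
  fix v assume "v \<in> {v \<in> tangent_space M p. differential B \<pi> p v \<in> sub_tangent_space B P (\<pi> p)}"
  then obtain k where v: "v \<in> tangent_space M p" and k: "smooth_curve B k" "k 0 = \<pi> p"
    "velocity B k = differential B \<pi> p v" "eventually (\<lambda>t. k t \<in> P) (nhds 0)"
    by (auto simp: sub_tangent_space_def)
  have "p \<in> points M" using p by (simp add: total_lift_def)
  from curve_lift[OF this v onto k(1-3)] obtain \<gamma> where g: "smooth_curve M \<gamma>" "\<gamma> 0 = p"
    "velocity M \<gamma> = v" "eventually (\<lambda>t. \<gamma> t \<in> points M \<and> \<pi> (\<gamma> t) = k t) (nhds 0)" by blast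
  have "eventually (\<lambda>t. \<gamma> t \<in> total_lift M \<pi> P) (nhds 0)"
    using g(4) k(4) by eventually_elim (simp add: total_lift_def)
  then show "v \<in> sub_tangent_space M (total_lift M \<pi> P) p"
    using g by (auto simp: sub_tangent_space_def)
qed

end

section \<open>Metrics, connections and non-degenerate submanifolds\<close>

text \<open>The defining property sees the vector only through its products with \<open>S\<close>.
  Projections can thus be compared without knowing that they exist or are unique.\<close>

lemma orth_projection_cong:
  assumes "\<And>u w. u \<in> S \<Longrightarrow> w \<in> S \<Longrightarrow> g p (v - w) u = g p (v' - w) u"
  shows "orth_projection g p S v = orth_projection g p S v'"
  unfolding orth_projection_def by (rule arg_cong[of _ _ The]) (use assms in auto)

section \<open>Submanifolds in slice charts\<close>

context smooth_mfd
begin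

lemma slice:
  assumes "submanifold M N" "p \<in> N"
  obtains U \<phi> S where "(U, \<phi>) \<in> charts M" "p \<in> U" "subspace S" "\<phi> ` (U \<inter> N) = \<phi> ` U \<inter> S"
  using assms unfolding submanifold_def by fast

text \<open>A curve in \<open>N\<close> has coordinates in \<open>S\<close>, so the derivative of
  its coordinates is orthogonal to the orthogonal complement of \<open>S\<close>, hence lies in
  \<open>S\<close>. Conversely, coordinate lines with direction in \<open>S\<close> that start on
  the slice remain in it.\<close>

lemma sub_tangent_slice:
  assumes c: "(U, \<phi>) \<in> charts M" and S: "subspace S" "\<phi> ` (U \<inter> N) = \<phi> ` U \<inter> S" and x: "x \<in> U" "x \<in> N"
  shows "sub_tangent_space M N x = (\<lambda>c. coord_field U \<phi> c x) ` S"
proof (intro set_eqI iffI)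
  fix v assume "v \<in> sub_tangent_space M N x"
  then obtain \<gamma> where g: "smooth_curve M \<gamma>" "v = velocity M \<gamma>" "\<gamma> 0 = x"
    "eventually (\<lambda>t. \<gamma> t \<in> N) (nhds 0)" by (auto simp: sub_tangent_space_def)
  obtain w where w: "((\<phi> \<circ> \<gamma>) has_vector_derivative w) (at 0)"
    "eventually (\<lambda>t. \<gamma> t \<in> U) (nhds 0)" "velocity M \<gamma> = coord_field U \<phi> w (\<gamma> 0)"
    using velocity_curve[OF g(1) c] g(3) x by metis
  have "orthogonal s w" if s: "s \<in> orthogonal_comp S" for s
  proof -
    have "((\<lambda>t. s \<bullet> (\<phi> \<circ> \<gamma>) t) has_vector_derivative s \<bullet> w) (at 0)"
      using bounded_linear.has_vector_derivative[OF bounded_linear_inner_right w(1)] .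
    moreover have ev: "eventually (\<lambda>t. s \<bullet> (\<phi> \<circ> \<gamma>) t = 0) (nhds 0)"
      using g(4) w(2)
    proof eventually_elim
      case (elim t)
      then have "\<phi> (\<gamma> t) \<in> S" using S(2) by blast
      then show ?case using s by (auto simp: orthogonal_comp_def orthogonal_def inner_commute)
    qed
    ultimately have "((\<lambda>t. 0) has_vector_derivative s \<bullet> w) (at (0::real))"
      by (subst (asm) has_vector_derivative_cong_ev[where g = "\<lambda>t. 0"])
        (auto dest: eventually_nhds_x_imp_x)
    then show ?thesis
      using vector_derivative_unique_at[OF _ has_vector_derivative_const] by (auto simp: orthogonal_def)
  qed
  then have "w \<in> orthogonal_comp (orthogonal_comp S)" by (simp add: orthogonal_comp_def)
  then have "w \<in> S" using orthogonal_comp_self[OF S(1)] by simp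
  with g w show "v \<in> (\<lambda>c. coord_field U \<phi> c x) ` S" by auto
next
  fix v assume "v \<in> (\<lambda>c. coord_field U \<phi> c x) ` S"
  then obtain w where w: "w \<in> S" "v = coord_field U \<phi> w x" by blast
  let ?\<gamma> = "\<lambda>t. inv_into U \<phi> (\<phi> x + t *\<^sub>R w)"
  have "\<phi> x \<in> S" using S(2) x by blast
  have "eventually (\<lambda>t. ?\<gamma> t \<in> N) (nhds 0)"
    using smooth_curve_line(4)[OF c x(1), of w]
  proof eventually_elim
    case (elim t)
    then have "\<phi> (?\<gamma> t) \<in> S" "?\<gamma> t \<in> U"
      using \<open>\<phi> x \<in> S\<close> w(1) S(1) by (auto intro: subspace_add subspace_scale)
    then have "\<phi> (?\<gamma> t) \<in> \<phi> ` (U \<inter> N)" using S(2) by blast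
    then obtain y where y: "\<phi> (?\<gamma> t) = \<phi> y" "y \<in> U \<inter> N" by blast
    then have "?\<gamma> t = y" using inj_onD[OF inj_chart[OF c] y(1)] \<open>?\<gamma> t \<in> U\<close> by blast
    with y show ?case by simp
  qed
  then show "v \<in> sub_tangent_space M N x"
    unfolding sub_tangent_space_def w(2) using smooth_curve_line(1-3)[OF c x(1), of w]
    by (intro CollectI exI[of _ ?\<gamma>]) simp
qed

lemma sub_tangent_tangent: "v \<in> sub_tangent_space M N p \<Longrightarrow> v \<in> tangent_space M p"
  by (auto simp: sub_tangent_space_def tangent_space_def)

lemma subspace_sub_tangent:
  assumes "submanifold M N" "p \<in> N"
  shows "subspace (sub_tangent_space M N p)"
proof -
  obtain U \<phi> S where s: "(U, \<phi>) \<in> charts M" "p \<in> U" "subspace S" "\<phi> ` (U \<inter> N) = \<phi> ` U \<inter> S"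
    using slice[OF assms] by blast
  show ?thesis
    unfolding sub_tangent_slice[OF s(1,3,4,2) assms(2)]
    by (rule linear_subspace_image[OF linear_coord_field[OF s(1,2)] s(3)])
qed

text \<open>In a slice chart, the coordinate field with constant coefficients in \<open>S\<close> is
  tangent to \<open>N\<close> at every point of \<open>N\<close>.\<close>

lemma tangent_extension:
  assumes "submanifold M N" "p \<in> N" "v \<in> sub_tangent_space M N p"
  obtains Y where "smooth_field_at M p Y" "Y p = v"
    "eventually (\<lambda>x. x \<in> N \<longrightarrow> Y x \<in> sub_tangent_space M N x) (nhdsin (mtop M) p)"
proof -
  obtain U \<phi> S where s: "(U, \<phi>) \<in> charts M" "p \<in> U" "subspace S" "\<phi> ` (U \<inter> N) = \<phi> ` U \<inter> S"
    using slice[OF assms(1,2)] by blast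
  obtain c where c: "c \<in> S" "v = coord_field U \<phi> c p"
    using sub_tangent_slice[OF s(1,3,4,2) assms(2)] assms(3) by blast
  have "eventually (\<lambda>x. x \<in> N \<longrightarrow> coord_field U \<phi> c x \<in> sub_tangent_space M N x) (nhdsin (mtop M) p)"
    using eventually_chart[OF s(1,2)]
    by eventually_elim (use sub_tangent_slice[OF s(1,3,4)] c(1) in auto)
  with that[OF field_coord[OF s(1,2)] c(2)[symmetric]] show ?thesis .
qed

lemma curve_eventually:
  assumes "smooth_curve M \<gamma>" "eventually P (nhdsin (mtop M) (\<gamma> 0))"
  shows "eventually (\<lambda>t. P (\<gamma> t)) (nhds 0)"
proof -
  obtain U \<phi> \<epsilon> where c: "(U, \<phi>) \<in> charts M" and e: "\<epsilon> > 0" "\<gamma> ` {-\<epsilon><..<\<epsilon>} \<subseteq> U"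
    "smooth_on {-\<epsilon><..<\<epsilon>} (\<phi> \<circ> \<gamma>)"
    using assms(1) unfolding smooth_curve_def by auto
  have U: "\<gamma> 0 \<in> U" using e by auto
  obtain W where W: "openin (mtop M) W" "\<gamma> 0 \<in> W" "\<And>x. x \<in> W \<Longrightarrow> P x"
    using assms(2) chart_subset[OF c U] by (auto simp: eventually_nhdsin)
  have "open (\<phi> ` (U \<inter> W))"
    using W by (intro chart_open_image[OF c] openin_Int openin_chart[OF c]) auto
  then have "open ({-\<epsilon><..<\<epsilon>} \<inter> (\<phi> \<circ> \<gamma>) -` (\<phi> ` (U \<inter> W)))"
    by (intro continuous_open_preimage[OF smooth_on_continuous[OF e(3)]]) auto
  moreover have "0 \<in> {-\<epsilon><..<\<epsilon>} \<inter> (\<phi> \<circ> \<gamma>) -` (\<phi> ` (U \<inter> W))" using e(1) U W(2) by auto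
  ultimately have "eventually (\<lambda>t. t \<in> {-\<epsilon><..<\<epsilon>} \<inter> (\<phi> \<circ> \<gamma>) -` (\<phi> ` (U \<inter> W))) (nhds 0)"
    by (rule eventually_nhds_in_open)
  then show ?thesis
  proof eventually_elim
    case (elim t)
    then obtain y where "\<phi> (\<gamma> t) = \<phi> y" "y \<in> U \<inter> W" by auto
    moreover have "\<gamma> t \<in> U" using elim e(2) by blast
    ultimately have y: "\<phi> (\<gamma> t) = \<phi> y" "y \<in> U \<inter> W" "\<gamma> t \<in> U" by auto
    then have "\<gamma> t = y" using inj_onD[OF inj_chart[OF c] y(1)] by blast
    with y W(3) show ?case by blast
  qed
qed

text \<open>\<open>v\<close> differentiates along a curve inside \<open>N\<close>, where
  \<open>f\<close> vanishes; a non-smooth \<open>f\<close> gets 0 by convention. It allows relations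
  that hold only on \<open>N\<close> to be differentiated.\<close>

lemma sub_tangent_annihilates:
  assumes v: "v \<in> sub_tangent_space M N p"
    and f: "eventually (\<lambda>x. x \<in> N \<longrightarrow> f x = 0) (nhdsin (mtop M) p)"
  shows "v f = 0"
proof -
  obtain \<gamma> where g: "smooth_curve M \<gamma>" "v = velocity M \<gamma>" "\<gamma> 0 = p"
    "eventually (\<lambda>t. \<gamma> t \<in> N) (nhds 0)" using v by (auto simp: sub_tangent_space_def)
  have "eventually (\<lambda>t. \<gamma> t \<in> N \<longrightarrow> f (\<gamma> t) = 0) (nhds 0)"
    using curve_eventually[OF g(1)] f g(3) by blast
  with g(4) have "eventually (\<lambda>t. (f \<circ> \<gamma>) t = 0) (nhds 0)" by eventually_elim simp
  then have "deriv (f \<circ> \<gamma>) 0 = deriv (\<lambda>t. 0) 0" by (rule deriv_cong_ev) simp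
  then show ?thesis by (simp add: g(2) velocity_def)
qed

end

section \<open>Linear algebra of the metric\<close>

locale semi_riem = smooth_mfd M
  for M :: "('a, 'e::euclidean_space) manifold" +
  fixes g :: "'a metric" and nabla :: "'a connection"
  assumes metric: "semi_riemannian_manifold M g" and levi_civita: "levi_civita M g nabla"
begin

lemma metric_lin:
  assumes "p \<in> points M" "u \<in> tangent_space M p" "v \<in> tangent_space M p" "w \<in> tangent_space M p"
  shows "g p (a *\<^sub>R u + b *\<^sub>R v) w = a * g p u w + b * g p v w"
  using metric assms unfolding semi_riemannian_manifold_def by blast

lemma metric_sym: "p \<in> points M \<Longrightarrow> v \<in> tangent_space M p \<Longrightarrow> w \<in> tangent_space M p \<Longrightarrow> g p v w = g p w v"
  using metric unfolding semi_riemannian_manifold_def by blast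

lemma metric_nondegenerate:
  "p \<in> points M \<Longrightarrow> v \<in> tangent_space M p \<Longrightarrow> (\<And>w. w \<in> tangent_space M p \<Longrightarrow> g p v w = 0) \<Longrightarrow> v = 0"
  using metric unfolding semi_riemannian_manifold_def nondegenerate_on_def by blast

lemma metric_smooth:
  assumes "smooth_field_at M p V" "smooth_field_at M p W"
  shows "smooth_at M p (\<lambda>x. g x (V x) (W x))"
  using metric assms field_points[OF assms(1)] unfolding semi_riemannian_manifold_def by blast

context
  fixes p assumes p: "p \<in> points M"
begin

lemma tangent_0: "0 \<in> tangent_space M p"
  and tangent_vadd: "u \<in> tangent_space M p \<Longrightarrow> v \<in> tangent_space M p \<Longrightarrow> u + v \<in> tangent_space M p"
  and tangent_vdiff: "u \<in> tangent_space M p \<Longrightarrow> v \<in> tangent_space M p \<Longrightarrow> u - v \<in> tangent_space M p"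
  and tangent_vscale: "u \<in> tangent_space M p \<Longrightarrow> a *\<^sub>R u \<in> tangent_space M p"
  using subspace_tangent[OF p] by (auto intro: subspace_0 subspace_add subspace_diff subspace_scale)

lemma tangent_vsum: "(\<And>i. i \<in> I \<Longrightarrow> f i \<in> tangent_space M p) \<Longrightarrow> sum f I \<in> tangent_space M p"
  using subspace_sum[OF subspace_tangent[OF p]] by blast

lemma metric_add_left:
  "u \<in> tangent_space M p \<Longrightarrow> v \<in> tangent_space M p \<Longrightarrow> w \<in> tangent_space M p \<Longrightarrow>
    g p (u + v) w = g p u w + g p v w"
  using metric_lin[OF p, of u v w 1 1] by simp

lemma metric_diff_left:
  "u \<in> tangent_space M p \<Longrightarrow> v \<in> tangent_space M p \<Longrightarrow> w \<in> tangent_space M p \<Longrightarrow>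
    g p (u - v) w = g p u w - g p v w"
  using metric_lin[OF p, of u v w 1 "-1"] by simp

lemma metric_scale_left:
  "u \<in> tangent_space M p \<Longrightarrow> w \<in> tangent_space M p \<Longrightarrow> g p (a *\<^sub>R u) w = a * g p u w"
  using metric_lin[OF p, of u u w a 0] by simp

lemma metric_zero_left: "w \<in> tangent_space M p \<Longrightarrow> g p 0 w = 0"
  using metric_scale_left[OF tangent_0, of w 0] by simp

lemma metric_sum_left:
  assumes "\<And>i. i \<in> I \<Longrightarrow> f i \<in> tangent_space M p" "w \<in> tangent_space M p"
  shows "g p (\<Sum>i\<in>I. c i *\<^sub>R f i) w = (\<Sum>i\<in>I. c i * g p (f i) w)"
  using assms(1)
  by (induction I rule: infinite_finite_induct)
    (simp_all add: metric_zero_left metric_add_left metric_scale_left assms(2) tangent_vscale tangent_vsum)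

lemma metric_diff_right:
  "u \<in> tangent_space M p \<Longrightarrow> v \<in> tangent_space M p \<Longrightarrow> w \<in> tangent_space M p \<Longrightarrow>
    g p w (u - v) = g p w u - g p w v"
  by (simp add: metric_sym[OF p, of w] metric_diff_left tangent_vdiff)

lemma metric_sum_right:
  assumes "\<And>i. i \<in> I \<Longrightarrow> f i \<in> tangent_space M p" "w \<in> tangent_space M p"
  shows "g p w (\<Sum>i\<in>I. c i *\<^sub>R f i) = (\<Sum>i\<in>I. c i * g p w (f i))"
  using assms by (simp add: metric_sym[OF p, of w] metric_sum_left tangent_vsum tangent_vscale)

lemma metric_eqI:
  assumes "u \<in> tangent_space M p" "v \<in> tangent_space M p"
    "\<And>w. w \<in> tangent_space M p \<Longrightarrow> g p u w = g p v w"
  shows "u = v"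
  using metric_nondegenerate[OF p, of "u - v"] assms by (simp add: metric_diff_left tangent_vdiff)

end

lemma metric_eq_coordI:
  assumes c: "(U, \<phi>) \<in> charts M" "p \<in> U" and uv: "u \<in> tangent_space M p" "v \<in> tangent_space M p"
    and eq: "\<And>b. b \<in> Basis \<Longrightarrow> g p u (coord_field U \<phi> b p) = g p v (coord_field U \<phi> b p)"
  shows "u = v"
proof -
  have p: "p \<in> points M" using chart_subset[OF c] .
  show ?thesis
  proof (rule metric_eqI[OF p uv])
    fix w assume w: "w \<in> tangent_space M p"
    show "g p u w = g p v w"
      by (subst (1 2) coord_expansion[OF c w])
        (simp add: metric_sum_right[OF p] coord_field_tangent[OF c] uv eq)
  qed
qed

section \<open>Smooth fields from Gram systems\<close>

text \<open>The unknown coefficients solve the linear system of the Gram matrix of the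
  \<open>Y i\<close> over the ring of smooth germs. Nondegeneracy is asked at \<open>p\<close> only;
  the elimination extends the solution to a neighbourhood.\<close>

lemma frame_field:
  assumes p: "p \<in> points M" and "finite I"
    and Y: "\<And>i. i \<in> I \<Longrightarrow> smooth_field_at M p (Y i)"
    and \<beta>: "\<And>i. i \<in> I \<Longrightarrow> smooth_at M p (\<beta> i)"
    and nondeg: "\<And>u. (\<And>j. j \<in> I \<Longrightarrow> (\<Sum>i\<in>I. u i * g p (Y i p) (Y j p)) = 0) \<Longrightarrow> (\<And>i. i \<in> I \<Longrightarrow> u i = 0)"
  obtains c where "smooth_field_at M p (\<lambda>x. \<Sum>i\<in>I. c i x *\<^sub>R Y i x)"
    "eventually (\<lambda>x. \<forall>j\<in>I. g x (\<Sum>i\<in>I. c i x *\<^sub>R Y i x) (Y j x) = \<beta> j x) (nhdsin (mtop M) p)"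
proof -
  have "\<exists>c. (\<forall>i\<in>I. c i \<in> {f. smooth_at M p f}) \<and> eventually (\<lambda>x. \<forall>j\<in>I.
      (\<Sum>i\<in>I. g x (Y i x) (Y j x) * c i x) = \<beta> j x) (nhdsin (mtop M) p)"
  proof (rule linear_system_solvable[where p = p])
    fix u :: "_ \<Rightarrow> real" and i
    assume "\<And>j. j \<in> I \<Longrightarrow> (\<Sum>i\<in>I. g p (Y i p) (Y j p) * u i) = 0" "i \<in> I"
    then show "u i = 0" using nondeg[of u i] by (simp add: mult.commute)
  qed (use assms in \<open>auto intro: smooth_at_add smooth_at_mult smooth_at_const smooth_at_nonzero metric_smooth\<close>)
  then obtain c where c: "\<And>i. i \<in> I \<Longrightarrow> smooth_at M p (c i)"
    "eventually (\<lambda>x. \<forall>j\<in>I. (\<Sum>i\<in>I. g x (Y i x) (Y j x) * c i x) = \<beta> j x) (nhdsin (mtop M) p)"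
    by auto
  have "eventually (\<lambda>x. \<forall>i\<in>I. Y i x \<in> tangent_space M x) (nhdsin (mtop M) p)"
    using Y eventually_field_tangent by (intro eventually_ball_finite \<open>finite I\<close>) auto
  with c(2) eventually_points
  have "eventually (\<lambda>x. \<forall>j\<in>I. g x (\<Sum>i\<in>I. c i x *\<^sub>R Y i x) (Y j x) = \<beta> j x) (nhdsin (mtop M) p)"
    by eventually_elim (simp add: metric_sum_left mult.commute)
  moreover have "smooth_field_at M p (\<lambda>x. \<Sum>i\<in>I. c i x *\<^sub>R Y i x)"
    using p Y c(1) by (intro field_sum field_scale) auto
  ultimately show ?thesis using that by blast
qed

text \<open>Raising an index: \<open>\<beta>\<close> lists the components of a covector field. The
  Gram matrix of a full coordinate frame is nondegenerate because the metric is.\<close>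

lemma riesz_field:
  assumes c: "(U, \<phi>) \<in> charts M" "p \<in> U" and \<beta>: "\<And>b. b \<in> Basis \<Longrightarrow> smooth_at M p (\<beta> b)"
  obtains L where "smooth_field_at M p L"
    "eventually (\<lambda>x. \<forall>b\<in>Basis. g x (L x) (coord_field U \<phi> b x) = \<beta> b x) (nhdsin (mtop M) p)"
proof -
  have p: "p \<in> points M" using chart_subset[OF c] .
  note cf = coord_field_tangent[OF c]
  have "u i = 0" if u: "\<And>j. j \<in> Basis \<Longrightarrow>
      (\<Sum>i\<in>Basis. u i * g p (coord_field U \<phi> i p) (coord_field U \<phi> j p)) = 0" and i: "i \<in> Basis" for u i
  proof -
    have "(\<Sum>i\<in>Basis. u i *\<^sub>R coord_field U \<phi> i p) = 0"
      by (rule metric_eq_coordI[OF c])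
        (simp_all add: tangent_vsum p tangent_vscale cf tangent_0 metric_sum_left u metric_zero_left)
    then have "coord_field U \<phi> (\<Sum>i\<in>Basis. u i *\<^sub>R i) p = coord_field U \<phi> 0 p"
      by (simp add: linear_sum[OF linear_coord_field[OF c]] linear_cmul[OF linear_coord_field[OF c]]
          linear_0[OF linear_coord_field[OF c]])
    then have "(\<Sum>i\<in>Basis. u i *\<^sub>R i) = 0" by (rule coord_field_inject[OF c])
    then show "u i = 0" using i by (metis inner_sum_left_Basis inner_zero_left)
  qed
  then obtain k where "smooth_field_at M p (\<lambda>x. \<Sum>i\<in>Basis. k i x *\<^sub>R coord_field U \<phi> i x)"
    "eventually (\<lambda>x. \<forall>j\<in>Basis. g x (\<Sum>i\<in>Basis. k i x *\<^sub>R coord_field U \<phi> i x) (coord_field U \<phi> j x) =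
       \<beta> j x) (nhdsin (mtop M) p)"
    using frame_field[of p Basis "coord_field U \<phi>" \<beta>, OF p finite_Basis field_coord[OF c] \<beta>] by blast
  then show ?thesis by (rule that)
qed

text \<open>Away from \<open>N\<close> there is no tangent space of \<open>N\<close> to project to.
  The projection is therefore computed with coordinate fields that live on the whole chart and span
  the tangent spaces of \<open>N\<close> at the points of \<open>N\<close>.\<close>

lemma tangent_component:
  assumes N: "nondegenerate_submanifold M g N" "p \<in> N" and W: "smooth_field_at M p W"
  obtains Y where "smooth_field_at M p Y"
    "eventually (\<lambda>x. x \<in> N \<longrightarrow> Y x \<in> sub_tangent_space M N x \<and>
       (\<forall>t\<in>sub_tangent_space M N x. g x (W x - Y x) t = 0)) (nhdsin (mtop M) p)"
proof -
  have sub: "submanifold M N" and nd: "nondegenerate_on g p (sub_tangent_space M N p)"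
    using N by (auto simp: nondegenerate_submanifold_def)
  obtain U \<phi> S where c: "(U, \<phi>) \<in> charts M" "p \<in> U" and S: "subspace S" "\<phi> ` (U \<inter> N) = \<phi> ` U \<inter> S"
    using slice[OF sub N(2)] by blast
  note TN = sub_tangent_slice[OF c(1) S]
  have p: "p \<in> points M" using chart_subset[OF c] .
  \<comment> \<open>A basis of the slice space, in general not part of \<open>Basis\<close>;
    independence makes the coefficients unique in the Gram argument.\<close>
  obtain D where D: "D \<subseteq> S" "independent D" "span D = S" "finite D"
    using basis_exists[of S] S(1) by (metis independent_imp_finite span_subspace)
  have span: "\<exists>u. s = (\<Sum>i\<in>D. u i *\<^sub>R i)" if "s \<in> S" for s
    using that D(3,4) span_finite by auto
  have cfsum: "coord_field U \<phi> (\<Sum>i\<in>D. u i *\<^sub>R i) x = (\<Sum>i\<in>D. u i *\<^sub>R coord_field U \<phi> i x)"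
    if "x \<in> U" for u x
    by (simp add: linear_sum[OF linear_coord_field[OF c(1) that]]
        linear_cmul[OF linear_coord_field[OF c(1) that]])
  have sumS: "(\<Sum>i\<in>D. u i *\<^sub>R i) \<in> S" for u
    using D(1) S(1) by (auto intro!: subspace_sum subspace_scale)
  have nondeg: "u i = 0" if u: "\<And>j. j \<in> D \<Longrightarrow>
      (\<Sum>i\<in>D. u i * g p (coord_field U \<phi> i p) (coord_field U \<phi> j p)) = 0" and i: "i \<in> D" for u i
  proof -
    let ?v = "coord_field U \<phi> (\<Sum>i\<in>D. u i *\<^sub>R i) p"
    have "g p ?v t = 0" if "t \<in> sub_tangent_space M N p" for t
    proof -
      obtain s where "s \<in> S" "t = coord_field U \<phi> s p" using \<open>t \<in> _\<close> TN[OF c(2) N(2)] by blast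
      then obtain w where t: "t = coord_field U \<phi> (\<Sum>i\<in>D. w i *\<^sub>R i) p" using span by blast
      show ?thesis
        unfolding t cfsum[OF c(2)]
        by (subst metric_sum_right[OF p])
          (simp_all add: coord_field_tangent[OF c] tangent_vsum[OF p] tangent_vscale[OF p]
            metric_sum_left[OF p] u)
    qed
    moreover have "?v \<in> sub_tangent_space M N p" using TN[OF c(2) N(2)] sumS by blast
    ultimately have "?v = 0" using nd by (auto simp: nondegenerate_on_def)
    then have "(\<Sum>i\<in>D. u i *\<^sub>R i) = 0"
      using coord_field_inject[OF c, of "\<Sum>i\<in>D. u i *\<^sub>R i" 0] linear_0[OF linear_coord_field[OF c]] by simp
    then show "u i = 0" using independentD[OF D(2,4) subset_refl _ i] by blast
  qed
  obtain k where k: "smooth_field_at M p (\<lambda>x. \<Sum>i\<in>D. k i x *\<^sub>R coord_field U \<phi> i x)"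
    "eventually (\<lambda>x. \<forall>j\<in>D. g x (\<Sum>i\<in>D. k i x *\<^sub>R coord_field U \<phi> i x) (coord_field U \<phi> j x) =
       g x (W x) (coord_field U \<phi> j x)) (nhdsin (mtop M) p)"
    using frame_field[of p D "coord_field U \<phi>" "\<lambda>j x. g x (W x) (coord_field U \<phi> j x)",
        OF p D(4) field_coord[OF c] metric_smooth[OF W field_coord[OF c]]] nondeg by blast
  show ?thesis
  proof (rule that[OF k(1)])
    show "eventually (\<lambda>x. x \<in> N \<longrightarrow> (\<Sum>i\<in>D. k i x *\<^sub>R coord_field U \<phi> i x) \<in> sub_tangent_space M N x \<and>
       (\<forall>t\<in>sub_tangent_space M N x. g x (W x - (\<Sum>i\<in>D. k i x *\<^sub>R coord_field U \<phi> i x)) t = 0))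
       (nhdsin (mtop M) p)"
      using k(2) eventually_chart[OF c] eventually_field_tangent[OF W]
    proof (eventually_elim, intro impI conjI ballI)
      fix x assume x: "\<forall>j\<in>D. g x (\<Sum>i\<in>D. k i x *\<^sub>R coord_field U \<phi> i x) (coord_field U \<phi> j x) =
          g x (W x) (coord_field U \<phi> j x)" "x \<in> U" "W x \<in> tangent_space M x" "x \<in> N"
      have px: "x \<in> points M" using chart_subset[OF c(1) x(2)] .
      note cft = coord_field_tangent[OF c(1) x(2)]
      show "(\<Sum>i\<in>D. k i x *\<^sub>R coord_field U \<phi> i x) \<in> sub_tangent_space M N x"
        unfolding TN[OF x(2,4)] cfsum[OF x(2), symmetric] by (intro imageI sumS)
      fix t assume "t \<in> sub_tangent_space M N x"
      then obtain s where "s \<in> S" "t = coord_field U \<phi> s x" using TN[OF x(2,4)] by blast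
      then obtain w where t: "t = coord_field U \<phi> (\<Sum>i\<in>D. w i *\<^sub>R i) x" using span by blast
      show "g x (W x - (\<Sum>i\<in>D. k i x *\<^sub>R coord_field U \<phi> i x)) t = 0"
        unfolding t cfsum[OF x(2)]
        by (subst metric_sum_right[OF px])
          (use x in \<open>simp_all add: cft tangent_vsum[OF px] tangent_vscale[OF px] tangent_vdiff[OF px]
            metric_diff_left[OF px]\<close>)
    qed
  qed
qed

text \<open>The field of \<open>tangent_component\<close> supplies a candidate at \<open>p\<close>.
  The difference of two candidates is tangent to \<open>N\<close> and orthogonal to all tangent
  vectors, so nondegeneracy makes the definite description well defined.\<close>

lemma tangential_part_exists:
  assumes N: "nondegenerate_submanifold M g N" "p \<in> N" and v: "v \<in> tangent_space M p"
  shows "tangential_part M g N p v \<in> sub_tangent_space M N p"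
    and "t \<in> sub_tangent_space M N p \<Longrightarrow> g p (v - tangential_part M g N p v) t = 0"
proof -
  have sub: "submanifold M N" and nd: "nondegenerate_on g p (sub_tangent_space M N p)"
    using N by (auto simp: nondegenerate_submanifold_def)
  have p: "p \<in> points M" using sub N(2) by (auto simp: submanifold_def)
  obtain W where W: "smooth_field_at M p W" "W p = v" using field_extension[OF v p] by blast
  obtain Y where Y: "smooth_field_at M p Y" "eventually (\<lambda>x. x \<in> N \<longrightarrow> Y x \<in> sub_tangent_space M N x \<and>
       (\<forall>t\<in>sub_tangent_space M N x. g x (W x - Y x) t = 0)) (nhdsin (mtop M) p)"
    using tangent_component[OF N W(1)] by blast
  have Yp: "Y p \<in> sub_tangent_space M N p" "\<And>t. t \<in> sub_tangent_space M N p \<Longrightarrow> g p (v - Y p) t = 0"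
    using eventually_nhdsin_self[OF Y(2) p] N(2) W(2) by auto
  have "tangential_part M g N p v = Y p"
    unfolding tangential_part_def orth_projection_def
  proof (rule the_equality)
    fix w assume w: "w \<in> sub_tangent_space M N p \<and> (\<forall>u\<in>sub_tangent_space M N p. g p (v - w) u = 0)"
    have "g p (w - Y p) t = 0" if t: "t \<in> sub_tangent_space M N p" for t
    proof -
      have "g p (v - w) t = 0" "g p (v - Y p) t = 0" using w Yp t by auto
      then show ?thesis
        using conjunct1[OF w, THEN sub_tangent_tangent] Yp(1)[THEN sub_tangent_tangent]
          t[THEN sub_tangent_tangent] v by (simp add: metric_diff_left[OF p])
    qed
    moreover have "w - Y p \<in> sub_tangent_space M N p"
      using w Yp by (intro subspace_diff[OF subspace_sub_tangent[OF sub N(2)]]) auto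
    ultimately have "w - Y p = 0" using nd unfolding nondegenerate_on_def by blast
    then show "w = Y p" by simp
  qed (use Yp in auto)
  with Yp show "tangential_part M g N p v \<in> sub_tangent_space M N p"
    "t \<in> sub_tangent_space M N p \<Longrightarrow> g p (v - tangential_part M g N p v) t = 0" by auto
qed

text \<open>Subtract from any extension its tangential component. At \<open>p\<close> that component
  is tangent and, as \<open>w\<close> is normal, orthogonal to the tangent space; it vanishes there,
  and the value \<open>w\<close> is kept.\<close>

lemma normal_extension_exists:
  assumes N: "nondegenerate_submanifold M g N" "p \<in> N" and w: "w \<in> normal_subspace M g N p"
  obtains W where "normal_extension M g N p w W"
proof -
  have sub: "submanifold M N" and nd: "nondegenerate_on g p (sub_tangent_space M N p)"
    using N by (auto simp: nondegenerate_submanifold_def)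
  have p: "p \<in> points M" using sub N(2) by (auto simp: submanifold_def)
  have wt: "w \<in> tangent_space M p" "\<And>t. t \<in> sub_tangent_space M N p \<Longrightarrow> g p w t = 0"
    using w by (auto simp: normal_subspace_def orth_complement_def)
  obtain W where W: "smooth_field_at M p W" "W p = w" using field_extension[OF wt(1) p] by blast
  obtain Y where Y: "smooth_field_at M p Y" "eventually (\<lambda>x. x \<in> N \<longrightarrow> Y x \<in> sub_tangent_space M N x \<and>
       (\<forall>t\<in>sub_tangent_space M N x. g x (W x - Y x) t = 0)) (nhdsin (mtop M) p)"
    using tangent_component[OF N W(1)] by blast
  have Yp: "Y p \<in> sub_tangent_space M N p" "\<And>t. t \<in> sub_tangent_space M N p \<Longrightarrow> g p (w - Y p) t = 0"
    using eventually_nhdsin_self[OF Y(2) p] N(2) W(2) by auto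
  have "g p (Y p) t = 0" if "t \<in> sub_tangent_space M N p" for t
    using Yp wt that by (simp add: metric_diff_left[OF p] sub_tangent_tangent)
  then have Y0: "Y p = 0" using nd Yp(1) unfolding nondegenerate_on_def by blast
  have "eventually (\<lambda>x. x \<in> N \<longrightarrow> W x - Y x \<in> normal_subspace M g N x) (nhdsin (mtop M) p)"
    using Y(2) eventually_field_tangent[OF W(1)] eventually_points
    by eventually_elim
      (auto simp: normal_subspace_def orth_complement_def intro: tangent_vdiff sub_tangent_tangent)
  then have "normal_extension M g N p w (\<lambda>x. W x - Y x)"
    unfolding normal_extension_def using p field_minus[OF W(1) Y(1)] W(2) Y0
    by (auto simp: eventually_nhdsin)
  with that show ?thesis .
qed

section \<open>Rules for the connection and the shape operator\<close>

lemma nabla_tangent: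
  assumes "v \<in> tangent_space M p" "smooth_field_at M p W"
  shows "nabla p v W \<in> tangent_space M p"
proof -
  have "\<forall>p\<in>points M. \<forall>v\<in>tangent_space M p. \<forall>W. smooth_field_at M p W \<longrightarrow>
      nabla p v W \<in> tangent_space M p"
    using levi_civita unfolding levi_civita_def affine_connection_def by (elim conjE)
  then show ?thesis using field_points[OF assms(2)] assms by simp
qed

lemma nabla_scale:
  assumes "v \<in> tangent_space M p" "smooth_at M p f" "smooth_field_at M p W"
  shows "nabla p v (\<lambda>q. f q *\<^sub>R W q) = v f *\<^sub>R W p + f p *\<^sub>R nabla p v W"
proof -
  have "\<forall>p\<in>points M. \<forall>v\<in>tangent_space M p. \<forall>f W. smooth_at M p f \<longrightarrow> smooth_field_at M p W \<longrightarrow>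
      nabla p v (\<lambda>q. f q *\<^sub>R W q) = v f *\<^sub>R W p + f p *\<^sub>R nabla p v W"
    using levi_civita unfolding levi_civita_def affine_connection_def by (elim conjE)
  then show ?thesis using field_points[OF assms(3)] assms by simp
qed

lemma nabla_torsion:
  assumes "smooth_field_at M p V" "smooth_field_at M p W"
  shows "nabla p (V p) W - nabla p (W p) V = lie_bracket M p V W"
  using levi_civita field_points[OF assms(1)] assms unfolding levi_civita_def by blast

lemma nabla_metric:
  assumes "v \<in> tangent_space M p" "smooth_field_at M p W" "smooth_field_at M p Z"
  shows "v (\<lambda>q. g q (W q) (Z q)) = g p (nabla p v W) (Z p) + g p (W p) (nabla p v Z)"
  using levi_civita field_points[OF assms(2)] assms unfolding levi_civita_def by blast

text \<open>Multiplying by the indicator function of a neighbourhood, a smooth germ, shows that the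
  connection only sees germs of fields.\<close>

lemma nabla_cong:
  assumes v: "v \<in> tangent_space M p" and W: "smooth_field_at M p W"
    and eq: "eventually (\<lambda>x. W x = W' x) (nhdsin (mtop M) p)"
  shows "nabla p v W = nabla p v W'"
proof -
  have W': "smooth_field_at M p W'" by (rule field_cong[OF eq W])
  have p: "p \<in> points M" using field_points[OF W] .
  obtain U where U: "openin (mtop M) U" "p \<in> U" "\<And>x. x \<in> U \<Longrightarrow> W x = W' x"
    using eq p by (auto simp: eventually_nhdsin)
  define f :: "'a \<Rightarrow> real" where "f x = (if x \<in> U then 1 else 0)" for x
  have ev: "eventually (\<lambda>x. 1 = f x) (nhdsin (mtop M) p)"
    by (rule eventually_nhdsin_open[OF U(1,2)]) (simp add: f_def)
  have f: "smooth_at M p f" by (rule smooth_at_cong[OF ev smooth_at_const[OF p]])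
  have "v f = 0" using tangent_cong[OF v p ev] tangent_const[OF v p] by simp
  moreover have "f p = 1" using U by (simp add: f_def)
  moreover have "(\<lambda>x. f x *\<^sub>R W x) = (\<lambda>x. f x *\<^sub>R W' x)" using U by (auto simp: f_def)
  ultimately show ?thesis using nabla_scale[OF v f W] nabla_scale[OF v f W'] by simp
qed

lemma nabla_zero:
  assumes v: "v \<in> tangent_space M p" and p: "p \<in> points M"
  shows "nabla p v (\<lambda>x. 0) = 0"
  using nabla_scale[OF v smooth_at_const[OF p, of 0] field_zero[OF p]] tangent_const[OF v p, of 0]
  by simp

text \<open>Differentiate \<open>g W Y = 0\<close> along \<open>N\<close> for a field \<open>Y\<close> tangent to \<open>N\<close>: the product of
  \<open>\<nabla>\<^sub>v W\<close> with \<open>Y\<close> depends on the value of \<open>W\<close> at \<open>p\<close> only.\<close>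

lemma shape_operator_eq:
  assumes v: "v \<in> sub_tangent_space M N p" and W: "normal_extension M g N p w W"
    and ext: "\<And>y. y \<in> sub_tangent_space M N p \<Longrightarrow> \<exists>Y. smooth_field_at M p Y \<and> Y p = y \<and>
      eventually (\<lambda>x. x \<in> N \<longrightarrow> Y x \<in> sub_tangent_space M N x) (nhdsin (mtop M) p)"
  shows "shape_operator M g nabla N p v w = tangential_part M g N p (nabla p v W)"
proof -
  have vt: "v \<in> tangent_space M p" using v by (rule sub_tangent_tangent)
  have key: "g p (nabla p v W) (Y p) = - g p w (nabla p v Y)"
    if W: "normal_extension M g N p w W" and Y: "smooth_field_at M p Y"
      "eventually (\<lambda>x. x \<in> N \<longrightarrow> Y x \<in> sub_tangent_space M N x) (nhdsin (mtop M) p)" for W Y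
  proof -
    have sW: "smooth_field_at M p W" "W p = w" using W by (auto simp: normal_extension_def)
    have "eventually (\<lambda>x. x \<in> N \<longrightarrow> W x \<in> normal_subspace M g N x) (nhdsin (mtop M) p)"
      using W by (auto simp: normal_extension_def eventually_nhdsin)
    with Y(2) have "eventually (\<lambda>x. x \<in> N \<longrightarrow> g x (W x) (Y x) = 0) (nhdsin (mtop M) p)"
      by eventually_elim (simp add: normal_subspace_def orth_complement_def)
    then have "v (\<lambda>x. g x (W x) (Y x)) = 0" by (rule sub_tangent_annihilates[OF v])
    then show ?thesis using nabla_metric[OF vt sW(1) Y(1)] sW(2) by simp
  qed
  have "tangential_part M g N p (nabla p v W) = tangential_part M g N p (nabla p v W')"
    if W': "normal_extension M g N p w W'" for W'
    unfolding tangential_part_def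
  proof (rule orth_projection_cong)
    fix y t assume y: "y \<in> sub_tangent_space M N p" and t: "t \<in> sub_tangent_space M N p"
    obtain Y where Y: "smooth_field_at M p Y" "Y p = y"
      "eventually (\<lambda>x. x \<in> N \<longrightarrow> Y x \<in> sub_tangent_space M N x) (nhdsin (mtop M) p)"
      using ext[OF y] by blast
    have p: "p \<in> points M" using field_points[OF Y(1)] .
    have "g p (nabla p v W) y = g p (nabla p v W') y"
      using key[OF W Y(1,3)] key[OF W' Y(1,3)] Y(2) by simp
    moreover have "nabla p v W \<in> tangent_space M p" "nabla p v W' \<in> tangent_space M p"
      using W W' vt by (auto simp: normal_extension_def intro: nabla_tangent)
    ultimately show "g p (nabla p v W - t) y = g p (nabla p v W' - t) y"
      using y t by (simp add: metric_diff_left[OF p] sub_tangent_tangent)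
  qed
  then show ?thesis
    unfolding shape_operator_def
    by (intro the_equality exI[of _ W] conjI W refl) (elim exE conjE, simp only:)
qed

end

section \<open>Semi-Riemannian submersions\<close>

locale submersion = M: semi_riem M g nablaM + B: semi_riem B h nablaB + smooth_mfd_map M B \<pi>
  for M :: "('a, 'e::euclidean_space) manifold" and g nablaM
    and B :: "('b, 'f::euclidean_space) manifold" and h nablaB and \<pi> :: "'a \<Rightarrow> 'b" +
  assumes submersion: "semi_riemannian_submersion M g B h \<pi>"
begin

abbreviation d where "d \<equiv> differential B \<pi>"
abbreviation Ver where "Ver \<equiv> vertical_space M B \<pi>"
abbreviation Hor where "Hor \<equiv> horizontal_space M g B \<pi>"
abbreviation lift where "lift \<equiv> horizontal_lift M g B \<pi>"
abbreviation ver where "ver \<equiv> vertical_part M g B \<pi>"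
abbreviation hor where "hor \<equiv> horizontal_part M g B \<pi>"

lemma d_onto: "p \<in> points M \<Longrightarrow> d p ` tangent_space M p = tangent_space B (\<pi> p)"
  using submersion unfolding semi_riemannian_submersion_def by blast

lemma Ver_nondegenerate: "p \<in> points M \<Longrightarrow> nondegenerate_on g p (Ver p)"
  using submersion unfolding semi_riemannian_submersion_def by blast

lemma d_bij: "p \<in> points M \<Longrightarrow> bij_betw (d p) (Hor p) (tangent_space B (\<pi> p))"
  using submersion unfolding semi_riemannian_submersion_def by blast

lemma d_isometry: "p \<in> points M \<Longrightarrow> x \<in> Hor p \<Longrightarrow> y \<in> Hor p \<Longrightarrow> h (\<pi> p) (d p x) (d p y) = g p x y"
  using submersion unfolding semi_riemannian_submersion_def by blast

lemma Ver_tangent: "v \<in> Ver p \<Longrightarrow> v \<in> tangent_space M p"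
  by (simp add: vertical_space_def)

lemma d_Ver: "v \<in> Ver p \<Longrightarrow> d p v = 0"
  by (simp add: vertical_space_def)

lemma Hor_tangent: "v \<in> Hor p \<Longrightarrow> v \<in> tangent_space M p"
  by (simp add: horizontal_space_def orth_complement_def)

lemmas d_add = linear_add[OF differential_linear]
  and d_diff = linear_diff[OF differential_linear]
  and d_zero = linear_0[OF differential_linear]

section \<open>Horizontal lifts and the splitting of tangent vectors\<close>

context
  fixes p assumes p: "p \<in> points M"
begin

lemma lift:
  assumes "u \<in> tangent_space B (\<pi> p)"
  shows lift_Hor: "lift p u \<in> Hor p" and d_lift: "d p (lift p u) = u"
proof -
  have inj: "inj_on (d p) (Hor p)" and "u \<in> d p ` Hor p"
    using d_bij[OF p] assms by (auto simp: bij_betw_def)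
  then have "\<exists>!x. x \<in> Hor p \<and> d p x = u"
    by (auto dest: inj_onD)
  from theI'[OF this] show "lift p u \<in> Hor p" "d p (lift p u) = u"
    unfolding horizontal_lift_def by auto
qed

lemma lift_tangent: "u \<in> tangent_space B (\<pi> p) \<Longrightarrow> lift p u \<in> tangent_space M p"
  using lift_Hor Hor_tangent by blast

lemma lift_eqI: "x \<in> Hor p \<Longrightarrow> d p x = u \<Longrightarrow> lift p u = x"
  unfolding horizontal_lift_def using d_bij[OF p]
  by (intro the_equality) (auto simp: bij_betw_def inj_on_def)

lemma metric_Hor_Ver: "x \<in> Hor p \<Longrightarrow> v \<in> Ver p \<Longrightarrow> g p x v = 0"
  by (simp add: horizontal_space_def orth_complement_def)

lemma diff_lift_Ver:
  assumes "v \<in> tangent_space M p"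
  shows "v - lift p (d p v) \<in> Ver p"
proof -
  have "d p v \<in> tangent_space B (\<pi> p)" using assms by (rule differential_tangent)
  then show ?thesis
    using assms by (simp add: vertical_space_def M.tangent_vdiff p lift_tangent d_diff d_lift)
qed

text \<open>\<open>v\<close> differs from the lift of \<open>d p v\<close> by a vertical vector,
  which the horizontal vector \<open>lift p u\<close> does not see; the rest is the isometry. The
  lift is thus the adjoint of the differential.\<close>

lemma metric_lift:
  assumes u: "u \<in> tangent_space B (\<pi> p)" and v: "v \<in> tangent_space M p"
  shows "g p (lift p u) v = h (\<pi> p) u (d p v)"
proof -
  have dv: "d p v \<in> tangent_space B (\<pi> p)" using v by (rule differential_tangent)
  have "0 = g p (lift p u) (v - lift p (d p v))"
    using metric_Hor_Ver[OF lift_Hor[OF u] diff_lift_Ver[OF v]] by simp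
  also have "\<dots> = g p (lift p u) v - g p (lift p u) (lift p (d p v))"
    using u v dv by (intro M.metric_diff_right p lift_tangent)
  finally show ?thesis
    using d_isometry[OF p lift_Hor[OF u] lift_Hor[OF dv]] by (simp add: d_lift u dv)
qed

text \<open>Uniqueness is checked in \<open>B\<close>: products with all lifts determine
  \<open>d p w\<close>, since the metric of \<open>B\<close> is nondegenerate, and a horizontal
  vector is determined by its image.\<close>

lemma hor_eq:
  assumes v: "v \<in> tangent_space M p"
  shows "hor p v = lift p (d p v)"
  unfolding horizontal_part_def orth_projection_def
proof (rule the_equality)
  have dv: "d p v \<in> tangent_space B (\<pi> p)" using v by (rule differential_tangent)
  have diff: "v - lift p (d p v) \<in> Ver p" using v by (rule diff_lift_Ver)
  show "lift p (d p v) \<in> Hor p \<and> (\<forall>u\<in>Hor p. g p (v - lift p (d p v)) u = 0)"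
    using lift_Hor[OF dv] metric_Hor_Ver[OF _ diff] M.metric_sym[OF p] Ver_tangent[OF diff] Hor_tangent
    by metis
  fix w assume w: "w \<in> Hor p \<and> (\<forall>u\<in>Hor p. g p (v - w) u = 0)"
  then have wt: "w \<in> tangent_space M p" using Hor_tangent by blast
  show "w = lift p (d p v)"
  proof (rule lift_eqI[symmetric])
    show "w \<in> Hor p" using w by blast
    show "d p w = d p v"
    proof (rule B.metric_eqI[OF map_points[OF p]])
      fix t assume t: "t \<in> tangent_space B (\<pi> p)"
      have "g p (v - w) (lift p t) = 0" using w lift_Hor[OF t] by blast
      then have "g p (lift p t) v = g p (lift p t) w"
        using v wt lift_tangent[OF t] by (simp add: M.metric_diff_left[OF p] M.metric_sym[OF p])
      then show "h (\<pi> p) (d p w) t = h (\<pi> p) (d p v) t"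
        using t v wt by (simp add: metric_lift B.metric_sym[OF map_points[OF p]] differential_tangent)
    qed (use wt v in \<open>auto intro: differential_tangent\<close>)
  qed
qed

text \<open>Here uniqueness comes from nondegeneracy of the fibres: two candidates differ by a
  vertical vector orthogonal to all vertical vectors.\<close>

lemma ver_eq:
  assumes v: "v \<in> tangent_space M p"
  shows "ver p v = v - lift p (d p v)"
  unfolding vertical_part_def orth_projection_def
proof (rule the_equality)
  have dv: "d p v \<in> tangent_space B (\<pi> p)" using v by (rule differential_tangent)
  have diff: "v - lift p (d p v) \<in> Ver p" using v by (rule diff_lift_Ver)
  have lt: "lift p (d p v) \<in> tangent_space M p" using dv by (rule lift_tangent)
  show "v - lift p (d p v) \<in> Ver p \<and> (\<forall>u\<in>Ver p. g p (v - (v - lift p (d p v))) u = 0)"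
    using diff metric_Hor_Ver[OF lift_Hor[OF dv]] by simp
  fix w assume w: "w \<in> Ver p \<and> (\<forall>u\<in>Ver p. g p (v - w) u = 0)"
  then have wt: "w \<in> tangent_space M p" using Ver_tangent by blast
  have mem: "w - (v - lift p (d p v)) \<in> Ver p"
    using w diff by (auto simp: vertical_space_def M.tangent_vdiff[OF p] d_diff)
  have "g p (w - (v - lift p (d p v))) u = 0" if u: "u \<in> Ver p" for u
  proof -
    have "w - (v - lift p (d p v)) = lift p (d p v) - (v - w)" by simp
    moreover have "g p (v - w) u = 0" "g p (lift p (d p v)) u = 0"
      using w u metric_Hor_Ver[OF lift_Hor[OF dv]] by auto
    ultimately show ?thesis
      using M.metric_diff_left[OF p lt M.tangent_vdiff[OF p v wt] Ver_tangent[OF u]]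
      by (metis diff_self)
  qed
  then have "w - (v - lift p (d p v)) = 0"
    using Ver_nondegenerate[OF p] mem unfolding nondegenerate_on_def by blast
  then show "w = v - lift p (d p v)" by simp
qed

lemma lift_zero: "lift p 0 = 0"
proof -
  have "0 \<in> Hor p"
    by (simp add: horizontal_space_def orth_complement_def M.tangent_0 p M.metric_zero_left Ver_tangent)
  then show ?thesis by (rule lift_eqI) (rule d_zero)
qed

lemma hor_Ver: "v \<in> Ver p \<Longrightarrow> hor p v = 0"
  by (simp add: hor_eq Ver_tangent d_Ver lift_zero)

lemma ver_Ver: "v \<in> Ver p \<Longrightarrow> ver p v = v"
  by (simp add: ver_eq Ver_tangent d_Ver lift_zero)

lemma hor_Hor: "v \<in> Hor p \<Longrightarrow> hor p v = v"
  by (simp add: hor_eq Hor_tangent lift_eqI)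

lemma ver_Hor: "v \<in> Hor p \<Longrightarrow> ver p v = 0"
  by (simp add: ver_eq Hor_tangent lift_eqI)

lemma hor_in: "v \<in> tangent_space M p \<Longrightarrow> hor p v \<in> Hor p"
  by (simp add: hor_eq lift_Hor differential_tangent)

lemma ver_in: "v \<in> tangent_space M p \<Longrightarrow> ver p v \<in> Ver p"
  by (simp add: ver_eq diff_lift_Ver)

lemma d_hor: "v \<in> tangent_space M p \<Longrightarrow> d p (hor p v) = d p v"
  by (simp add: hor_eq d_lift differential_tangent)

end

text \<open>Smooth sections of the pull-back of the tangent bundle of \<open>B\<close>.\<close>

definition smooth_along :: "'a \<Rightarrow> ('a \<Rightarrow> 'b tvec) \<Rightarrow> bool" where
  "smooth_along p u \<longleftrightarrow> eventually (\<lambda>x. u x \<in> tangent_space B (\<pi> x)) (nhdsin (mtop M) p) \<and>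
     (\<forall>f. smooth_at B (\<pi> p) f \<longrightarrow> smooth_at M p (\<lambda>x. u x f))"

text \<open>\<open>u\<close> and \<open>w\<close> are not fields on \<open>B\<close>, so
  \<open>B.metric_smooth\<close> does not apply to them. Both are expanded in a coordinate frame of
  \<open>B\<close>, which leaves smooth coefficients on \<open>M\<close> times pulled-back products
  of frame fields.\<close>

lemma smooth_along_metric:
  assumes u: "smooth_along p u" and w: "smooth_along p w" and p: "p \<in> points M"
  shows "smooth_at M p (\<lambda>x. h (\<pi> x) (u x) (w x))"
proof -
  obtain V \<psi> where c: "(V, \<psi>) \<in> charts B" "\<pi> p \<in> V" using B.chart_at map_points p by blast
  let ?e = "B.coord_field V \<psi>"
  let ?f = "\<lambda>x. \<Sum>a\<in>Basis. \<Sum>b\<in>Basis. u x (\<lambda>y. \<psi> y \<bullet> a) * (w x (\<lambda>y. \<psi> y \<bullet> b) *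
     ((\<lambda>y. h y (?e a y) (?e b y)) \<circ> \<pi>) x)"
  have ev: "eventually (\<lambda>x. u x \<in> tangent_space B (\<pi> x) \<and> w x \<in> tangent_space B (\<pi> x)) (nhdsin (mtop M) p)"
    using u w by (auto simp: smooth_along_def intro: eventually_conj)
  have "eventually (\<lambda>x. ?f x = h (\<pi> x) (u x) (w x)) (nhdsin (mtop M) p)"
    using ev map_eventually[OF B.eventually_chart[OF c] p]
  proof eventually_elim
    case (elim x)
    then have px: "\<pi> x \<in> points B" using B.chart_subset[OF c(1)] by blast
    note ex = B.coord_expansion[OF c(1) elim(2)] and et = B.coord_field_tangent[OF c(1) elim(2)]
    have "h (\<pi> x) (u x) (w x) = (\<Sum>a\<in>Basis. u x (\<lambda>y. \<psi> y \<bullet> a) * h (\<pi> x) (?e a (\<pi> x)) (w x))"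
      using elim by (subst ex[of "u x"]) (simp_all add: B.metric_sum_left[OF px] et)
    also have "\<dots> = ?f x"
    proof (rule sum.cong[OF refl])
      fix a :: 'f assume "a \<in> Basis"
      have "h (\<pi> x) (?e a (\<pi> x)) (w x) =
          (\<Sum>b\<in>Basis. w x (\<lambda>y. \<psi> y \<bullet> b) * h (\<pi> x) (?e a (\<pi> x)) (?e b (\<pi> x)))"
        using elim by (subst ex[of "w x"]) (simp_all add: B.metric_sum_right[OF px] et)
      then show "u x (\<lambda>y. \<psi> y \<bullet> a) * h (\<pi> x) (?e a (\<pi> x)) (w x) = (\<Sum>b\<in>Basis. u x (\<lambda>y. \<psi> y \<bullet> a) *
          (w x (\<lambda>y. \<psi> y \<bullet> b) * ((\<lambda>y. h y (?e a y) (?e b y)) \<circ> \<pi>) x))"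
        by (simp add: sum_distrib_left)
    qed
    finally show ?case by simp
  qed
  moreover have "smooth_at M p ?f"
  proof (intro M.smooth_at_sum p M.smooth_at_mult)
    fix a b
    show "smooth_at M p (\<lambda>x. u x (\<lambda>y. \<psi> y \<bullet> a))" "smooth_at M p (\<lambda>x. w x (\<lambda>y. \<psi> y \<bullet> b))"
      using u w B.smooth_at_coord[OF c] by (auto simp: smooth_along_def)
    show "smooth_at M p (\<lambda>x. ((\<lambda>y. h y (?e a y) (?e b y)) \<circ> \<pi>) x)"
      using map_smooth_at[OF B.metric_smooth[OF B.field_coord[OF c] B.field_coord[OF c]] p] by (simp add: o_def)
  qed
  ultimately show ?thesis by (rule M.smooth_at_cong)
qed

lemma smooth_along_differential:
  assumes F: "smooth_field_at M p F"
  shows "smooth_along p (\<lambda>x. d x (F x))"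
  unfolding smooth_along_def
proof (intro conjI allI impI)
  show "eventually (\<lambda>x. d x (F x) \<in> tangent_space B (\<pi> x)) (nhdsin (mtop M) p)"
    using M.eventually_field_tangent[OF F] by eventually_elim (rule differential_tangent)
  fix f assume f: "smooth_at B (\<pi> p) f"
  have p: "p \<in> points M" using M.field_points[OF F] .
  have "eventually (\<lambda>x. F x (f \<circ> \<pi>) = d x (F x) f) (nhdsin (mtop M) p)"
    using map_eventually[OF B.eventually_smooth_at[OF f] p]
    by eventually_elim (simp add: differential_apply)
  then show "smooth_at M p (\<lambda>x. d x (F x) f)"
    by (rule M.smooth_at_cong) (rule M.field_apply[OF F map_smooth_at[OF f p]])
qed

lemma smooth_along_field:
  assumes w: "smooth_field_at B (\<pi> p) w" and p: "p \<in> points M"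
  shows "smooth_along p (\<lambda>x. w (\<pi> x))"
  unfolding smooth_along_def
proof (intro conjI allI impI)
  show "eventually (\<lambda>x. w (\<pi> x) \<in> tangent_space B (\<pi> x)) (nhdsin (mtop M) p)"
    using map_eventually[OF B.eventually_field_tangent[OF w] p] .
  fix f assume f: "smooth_at B (\<pi> p) f"
  show "smooth_at M p (\<lambda>x. w (\<pi> x) f)"
    using map_smooth_at[OF B.field_apply[OF w f] p] by (simp add: o_def)
qed

text \<open>The horizontal lift is adjoint to the differential, so it solves a Riesz problem with
  smooth data.\<close>

lemma smooth_lift:
  assumes u: "smooth_along p u" and p: "p \<in> points M"
  shows "smooth_field_at M p (\<lambda>x. lift x (u x))"
proof -
  obtain U \<phi> where c: "(U, \<phi>) \<in> charts M" "p \<in> U" using M.chart_at p by blast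
  let ?e = "M.coord_field U \<phi>"
  obtain L where L: "smooth_field_at M p L"
    "eventually (\<lambda>x. \<forall>b\<in>Basis. g x (L x) (?e b x) = h (\<pi> x) (u x) (d x (?e b x))) (nhdsin (mtop M) p)"
    using M.riesz_field[of U \<phi> p "\<lambda>b x. h (\<pi> x) (u x) (d x (?e b x))",
        OF c smooth_along_metric[OF u smooth_along_differential[OF M.field_coord[OF c]] p]] by blast
  have "eventually (\<lambda>x. u x \<in> tangent_space B (\<pi> x)) (nhdsin (mtop M) p)"
    using u by (simp add: smooth_along_def)
  then have "eventually (\<lambda>x. L x = lift x (u x)) (nhdsin (mtop M) p)"
    using L(2) M.eventually_field_tangent[OF L(1)] M.eventually_chart[OF c]
  proof eventually_elim
    case (elim x)
    have px: "x \<in> points M" using M.chart_subset[OF c(1)] elim by blast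
    show ?case
      by (rule M.metric_eq_coordI[OF c(1) elim(4) elim(3) lift_tangent[OF px elim(1)]])
        (use elim px in \<open>simp add: metric_lift M.coord_field_tangent[OF c(1)]\<close>)
  qed
  then show ?thesis by (rule M.field_cong) (rule L(1))
qed

lemma field_hor:
  assumes F: "smooth_field_at M p F"
  shows "smooth_field_at M p (\<lambda>x. hor x (F x))"
proof (rule M.field_cong)
  have p: "p \<in> points M" using M.field_points[OF F] .
  show "smooth_field_at M p (\<lambda>x. lift x (d x (F x)))"
    by (rule smooth_lift[OF smooth_along_differential[OF F] p])
  show "eventually (\<lambda>x. lift x (d x (F x)) = hor x (F x)) (nhdsin (mtop M) p)"
    using M.eventually_field_tangent[OF F] M.eventually_points by eventually_elim (simp add: hor_eq)
qed

lemma field_ver: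
  assumes F: "smooth_field_at M p F"
  shows "smooth_field_at M p (\<lambda>x. ver x (F x))"
proof (rule M.field_cong)
  have p: "p \<in> points M" using M.field_points[OF F] .
  show "smooth_field_at M p (\<lambda>x. F x - hor x (F x))"
    by (rule M.field_minus[OF F field_hor[OF F]])
  show "eventually (\<lambda>x. F x - hor x (F x) = ver x (F x)) (nhdsin (mtop M) p)"
    using M.eventually_field_tangent[OF F] M.eventually_points
    by eventually_elim (simp add: hor_eq ver_eq)
qed

section \<open>Tensoriality of O'Neill's tensors\<close>

text \<open>The common expression of both tensors, as a function of a field: \<open>v\<close> is the
  vertical part of the first argument for \<open>oneill_T\<close> and its horizontal part for
  \<open>oneill_A\<close>.\<close>

definition oneill :: "'a \<Rightarrow> 'a tvec \<Rightarrow> 'a vfield \<Rightarrow> 'a tvec" where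
  "oneill p v F = hor p (nablaM p v (\<lambda>x. ver x (F x))) + ver p (nablaM p v (\<lambda>x. hor x (F x)))"

lemma nabla_metric_orthogonal:
  assumes v: "v \<in> tangent_space M p" and W: "smooth_field_at M p W" and Y: "smooth_field_at M p Y"
    and orth: "eventually (\<lambda>x. g x (W x) (Y x) = 0) (nhdsin (mtop M) p)"
  shows "g p (nablaM p v W) (Y p) = - g p (W p) (nablaM p v Y)"
proof -
  have p: "p \<in> points M" using M.field_points[OF W] .
  have "v (\<lambda>x. g x (W x) (Y x)) = 0"
    using M.tangent_cong[OF v p orth] M.tangent_const[OF v p] by simp
  then show ?thesis using M.nabla_metric[OF v W Y] by simp
qed

text \<open>Vertical and horizontal fields are orthogonal everywhere, so the product of
  nabla(\<open>ver F\<close>) with a horizontal field is minus the product of \<open>ver F\<close>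
  with a derivative of that field; at \<open>p\<close> this involves only \<open>F p\<close>. The
  other summand is symmetric.\<close>

lemma oneill_tensorial:
  assumes v: "v \<in> tangent_space M p" and F: "smooth_field_at M p F" and F': "smooth_field_at M p F'"
    and eq: "F p = F' p"
  shows "oneill p v F = oneill p v F'"
proof -
  have p: "p \<in> points M" using M.field_points[OF F] .
  have tan: "nablaM p v (\<lambda>x. ver x (F x)) \<in> tangent_space M p"
      "nablaM p v (\<lambda>x. hor x (F x)) \<in> tangent_space M p" if "smooth_field_at M p F" for F
    using that by (auto intro!: M.nabla_tangent[OF v] field_hor field_ver)
  have orth: "eventually (\<lambda>x. g x (hor x (F x)) (ver x (Y x)) = 0 \<and> g x (ver x (F x)) (hor x (Y x)) = 0)
      (nhdsin (mtop M) p)" if "smooth_field_at M p F" "smooth_field_at M p Y" for F Y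
    using M.eventually_field_tangent[OF that(1)] M.eventually_field_tangent[OF that(2)] M.eventually_points
  proof eventually_elim
    case (elim x)
    have "hor x (Y x) \<in> Hor x" "ver x (F x) \<in> Ver x" using elim hor_in ver_in by auto
    then have "g x (ver x (F x)) (hor x (Y x)) = 0"
      using metric_Hor_Ver[OF elim(3)] M.metric_sym[OF elim(3)] Ver_tangent Hor_tangent by metis
    then show ?case using elim metric_Hor_Ver hor_in ver_in by simp
  qed
  have "hor p (nablaM p v (\<lambda>x. ver x (F x))) = hor p (nablaM p v (\<lambda>x. ver x (F' x)))"
    unfolding horizontal_part_def
  proof (rule orth_projection_cong)
    fix y t assume y: "y \<in> Hor p" and t: "t \<in> Hor p"
    obtain Y where Y: "smooth_field_at M p Y" "Y p = y"
      using M.field_extension[OF Hor_tangent[OF y] p] by blast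
    have "g p (nablaM p v (\<lambda>x. ver x (F x))) (hor p (Y p)) = - g p (ver p (F p)) (nablaM p v (\<lambda>x. hor x (Y x)))"
      if "smooth_field_at M p F" for F
      by (rule nabla_metric_orthogonal[OF v field_ver[OF that] field_hor[OF Y(1)]])
        (use orth[OF that Y(1)] in \<open>auto elim: eventually_mono\<close>)
    from this[OF F] this[OF F'] eq
    have "g p (nablaM p v (\<lambda>x. ver x (F x))) y = g p (nablaM p v (\<lambda>x. ver x (F' x))) y"
      by (simp add: Y(2) hor_Hor[OF p y])
    then show "g p (nablaM p v (\<lambda>x. ver x (F x)) - t) y = g p (nablaM p v (\<lambda>x. ver x (F' x)) - t) y"
      using tan F F' y t by (simp add: M.metric_diff_left[OF p] Hor_tangent)
  qed
  moreover have "ver p (nablaM p v (\<lambda>x. hor x (F x))) = ver p (nablaM p v (\<lambda>x. hor x (F' x)))"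
    unfolding vertical_part_def
  proof (rule orth_projection_cong)
    fix y t assume y: "y \<in> Ver p" and t: "t \<in> Ver p"
    obtain Y where Y: "smooth_field_at M p Y" "Y p = y"
      using M.field_extension[OF Ver_tangent[OF y] p] by blast
    have "g p (nablaM p v (\<lambda>x. hor x (F x))) (ver p (Y p)) = - g p (hor p (F p)) (nablaM p v (\<lambda>x. ver x (Y x)))"
      if "smooth_field_at M p F" for F
      by (rule nabla_metric_orthogonal[OF v field_hor[OF that] field_ver[OF Y(1)]])
        (use orth[OF that Y(1)] in \<open>auto elim: eventually_mono\<close>)
    from this[OF F] this[OF F'] eq
    have "g p (nablaM p v (\<lambda>x. hor x (F x))) y = g p (nablaM p v (\<lambda>x. hor x (F' x))) y"
      by (simp add: Y(2) ver_Ver[OF p y])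
    then show "g p (nablaM p v (\<lambda>x. hor x (F x)) - t) y = g p (nablaM p v (\<lambda>x. hor x (F' x)) - t) y"
      using tan F F' y t by (simp add: M.metric_diff_left[OF p] Ver_tangent)
  qed
  ultimately show ?thesis by (simp add: oneill_def)
qed

text \<open>Tensoriality makes the definite description unambiguous, so the extension can be chosen
  at will: later a basic field for \<open>Z\<close> and, in the analogous rule for \<open>A\<close>,
  also a vertical one for \<open>V\<close>.\<close>

lemma oneill_T_eq:
  assumes "ver p e \<in> tangent_space M p" "smooth_field_at M p F"
  shows "oneill_T M g nablaM B \<pi> p e (F p) = oneill p (ver p e) F"
  unfolding oneill_T_def Let_def
proof (rule the_equality)
  show "\<exists>G. smooth_field_at M p G \<and> G p = F p \<and> oneill p (ver p e) F =
      hor p (nablaM p (ver p e) (\<lambda>q. ver q (G q))) + ver p (nablaM p (ver p e) (\<lambda>q. hor q (G q)))"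
    using assms(2) by (intro exI[of _ F]) (simp add: oneill_def)
  fix u assume "\<exists>G. smooth_field_at M p G \<and> G p = F p \<and> u =
      hor p (nablaM p (ver p e) (\<lambda>q. ver q (G q))) + ver p (nablaM p (ver p e) (\<lambda>q. hor q (G q)))"
  then obtain G where "smooth_field_at M p G" "G p = F p" "u = oneill p (ver p e) G"
    unfolding oneill_def by (elim exE conjE)
  then show "u = oneill p (ver p e) F" using oneill_tensorial[OF assms(1) _ assms(2)] by simp
qed

lemma oneill_A_eq:
  assumes "hor p e \<in> tangent_space M p" "smooth_field_at M p F"
  shows "oneill_A M g nablaM B \<pi> p e (F p) = oneill p (hor p e) F"
  unfolding oneill_A_def Let_def
proof (rule the_equality)
  show "\<exists>G. smooth_field_at M p G \<and> G p = F p \<and> oneill p (hor p e) F =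
      hor p (nablaM p (hor p e) (\<lambda>q. ver q (G q))) + ver p (nablaM p (hor p e) (\<lambda>q. hor q (G q)))"
    using assms(2) by (intro exI[of _ F]) (simp add: oneill_def)
  fix u assume "\<exists>G. smooth_field_at M p G \<and> G p = F p \<and> u =
      hor p (nablaM p (hor p e) (\<lambda>q. ver q (G q))) + ver p (nablaM p (hor p e) (\<lambda>q. hor q (G q)))"
  then obtain G where "smooth_field_at M p G" "G p = F p" "u = oneill p (hor p e) G"
    unfolding oneill_def by (elim exE conjE)
  then show "u = oneill p (hor p e) F" using oneill_tensorial[OF assms(1) _ assms(2)] by simp
qed

text \<open>The vertical part of \<open>F\<close> is the zero germ and its horizontal part is the
  germ of \<open>F\<close>; by \<open>nabla_cong\<close> the connection sees nothing else.\<close>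

lemma oneill_horizontal:
  assumes v: "v \<in> tangent_space M p" and F: "smooth_field_at M p F"
    and H: "eventually (\<lambda>x. F x \<in> Hor x) (nhdsin (mtop M) p)"
  shows "oneill p v F = ver p (nablaM p v F)"
proof -
  have p: "p \<in> points M" using M.field_points[OF F] .
  have "eventually (\<lambda>x. hor x (F x) = F x) (nhdsin (mtop M) p)"
    "eventually (\<lambda>x. ver x (F x) = 0) (nhdsin (mtop M) p)"
    using H M.eventually_points by (eventually_elim, simp add: hor_Hor ver_Hor)+
  from M.nabla_cong[OF v field_hor[OF F] this(1)] M.nabla_cong[OF v field_ver[OF F] this(2)]
  show ?thesis
    by (simp add: oneill_def M.nabla_zero[OF v p] hor_eq[OF p M.tangent_0[OF p]] d_zero lift_zero[OF p])
qed

lemma oneill_vertical: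
  assumes v: "v \<in> tangent_space M p" and F: "smooth_field_at M p F"
    and V: "eventually (\<lambda>x. F x \<in> Ver x) (nhdsin (mtop M) p)"
  shows "oneill p v F = hor p (nablaM p v F)"
proof -
  have p: "p \<in> points M" using M.field_points[OF F] .
  have "eventually (\<lambda>x. hor x (F x) = 0) (nhdsin (mtop M) p)"
    "eventually (\<lambda>x. ver x (F x) = F x) (nhdsin (mtop M) p)"
    using V M.eventually_points by (eventually_elim, simp add: hor_Ver ver_Ver)+
  from M.nabla_cong[OF v field_hor[OF F] this(1)] M.nabla_cong[OF v field_ver[OF F] this(2)]
  show ?thesis
    by (simp add: oneill_def M.nabla_zero[OF v p] ver_eq[OF p M.tangent_0[OF p]] d_zero lift_zero[OF p])
qed

section \<open>Related fields and their brackets\<close>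

text \<open>As germs at \<open>p\<close>, \<open>W\<close> applied to the pull-back of
  \<open>f\<close> is the pull-back of \<open>w\<close> applied to \<open>f\<close>.\<close>

lemma related_apply:
  assumes v: "v \<in> tangent_space M p" and p: "p \<in> points M" and w: "smooth_field_at B (\<pi> p) w"
    and rel: "eventually (\<lambda>x. d x (W x) = w (\<pi> x)) (nhdsin (mtop M) p)" and f: "smooth_at B (\<pi> p) f"
  shows "v (\<lambda>x. W x (f \<circ> \<pi>)) = d p v (\<lambda>y. w y f)"
proof -
  have "eventually (\<lambda>x. W x (f \<circ> \<pi>) = ((\<lambda>y. w y f) \<circ> \<pi>) x) (nhdsin (mtop M) p)"
    using rel map_eventually[OF B.eventually_smooth_at[OF f] p]
  proof eventually_elim
    case (elim x)
    have "W x (f \<circ> \<pi>) = d x (W x) f" using elim(2) by (simp add: differential_apply)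
    then show ?case by (simp add: elim(1))
  qed
  from M.tangent_cong[OF v p this] show ?thesis
    unfolding differential_apply[OF B.field_apply[OF w f]] .
qed

text \<open>Both iterated derivatives of a pulled-back function descend by
  \<open>related_apply\<close>; on non-smooth functions both sides are 0 by convention.\<close>

lemma bracket_related:
  assumes X: "smooth_field_at M p X" and Y: "smooth_field_at M p Y"
    and x: "smooth_field_at B (\<pi> p) x" and y: "smooth_field_at B (\<pi> p) y"
    and relX: "eventually (\<lambda>z. d z (X z) = x (\<pi> z)) (nhdsin (mtop M) p)"
    and relY: "eventually (\<lambda>z. d z (Y z) = y (\<pi> z)) (nhdsin (mtop M) p)"
  shows "d p (lie_bracket M p X Y) = lie_bracket B (\<pi> p) x y"
proof
  fix f
  have p: "p \<in> points M" using M.field_points[OF X] .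
  have at: "d p (X p) = x (\<pi> p)" "d p (Y p) = y (\<pi> p)"
    using eventually_nhdsin_self relX relY p by fast+
  show "d p (lie_bracket M p X Y) f = lie_bracket B (\<pi> p) x y f"
  proof (cases "smooth_at B (\<pi> p) f")
    case True
    have "d p (lie_bracket M p X Y) f = X p (\<lambda>z. Y z (f \<circ> \<pi>)) - Y p (\<lambda>z. X z (f \<circ> \<pi>))"
      unfolding differential_apply[OF True] lie_bracket_def using map_smooth_at[OF True p] by simp
    also have "\<dots> = x (\<pi> p) (\<lambda>z. y z f) - y (\<pi> p) (\<lambda>z. x z f)"
      unfolding related_apply[OF M.field_tangent[OF X] p y relY True]
        related_apply[OF M.field_tangent[OF Y] p x relX True] at ..
    finally show ?thesis using True by (simp add: lie_bracket_def)
  qed (simp add: differential_def lie_bracket_def)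
qed

section \<open>Basic fields\<close>

context
  fixes p assumes p: "p \<in> points M"
begin

abbreviation basic :: "'b vfield \<Rightarrow> 'a vfield" where
  "basic w \<equiv> \<lambda>x. lift x (w (\<pi> x))"

lemma basic_field: "smooth_field_at B (\<pi> p) w \<Longrightarrow> smooth_field_at M p (basic w)"
  by (rule smooth_lift[OF smooth_along_field p]) (auto simp: p)

lemma basic_related:
  assumes "smooth_field_at B (\<pi> p) w"
  shows "eventually (\<lambda>x. d x (basic w x) = w (\<pi> x)) (nhdsin (mtop M) p)"
  using map_eventually[OF B.eventually_field_tangent[OF assms] p] M.eventually_points
  by eventually_elim (simp add: d_lift)

lemma basic_Hor:
  assumes "smooth_field_at B (\<pi> p) w"
  shows "eventually (\<lambda>x. basic w x \<in> Hor x) (nhdsin (mtop M) p)"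
  using map_eventually[OF B.eventually_field_tangent[OF assms] p] M.eventually_points
  by eventually_elim (simp add: lift_Hor)

text \<open>On basic fields, \<open>D x y z = g (\<nabla>\<^sub>X Y) Z - h (\<nabla>\<^sub>x y) z\<close> is symmetric in
  \<open>x, y\<close> because brackets of related fields are related, and skew in \<open>y, z\<close> because both
  connections are metric; hence it vanishes.\<close>

lemma d_nabla_basic:
  assumes x: "x \<in> tangent_space B (\<pi> p)" and y: "smooth_field_at B (\<pi> p) y"
  shows "d p (nablaM p (lift p x) (basic y)) = nablaB (\<pi> p) x y"
proof (rule B.metric_eqI[OF map_points[OF p]])
  have pB: "\<pi> p \<in> points B" using map_points[OF p] .
  have lt: "basic w p \<in> tangent_space M p" if "smooth_field_at B (\<pi> p) w" for w
    using M.field_tangent[OF basic_field[OF that]] .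
  have nt: "nablaM p (basic v p) (basic w) \<in> tangent_space M p"
    if "smooth_field_at B (\<pi> p) v" "smooth_field_at B (\<pi> p) w" for v w
    by (rule M.nabla_tangent[OF lt[OF that(1)] basic_field[OF that(2)]])
  define D where "D u v w = g p (nablaM p (basic u p) (basic v)) (basic w p) -
    h (\<pi> p) (nablaB (\<pi> p) (u (\<pi> p)) v) (w (\<pi> p))" for u v w
  have skew: "D u v w = - D u w v"
    if u: "smooth_field_at B (\<pi> p) u" and v: "smooth_field_at B (\<pi> p) v"
      and w: "smooth_field_at B (\<pi> p) w" for u v w
  proof -
    have "eventually (\<lambda>z. g z (basic v z) (basic w z) = ((\<lambda>y. h y (v y) (w y)) \<circ> \<pi>) z) (nhdsin (mtop M) p)"
      using map_eventually[OF B.eventually_field_tangent[OF v] p]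
        map_eventually[OF B.eventually_field_tangent[OF w] p] M.eventually_points
      by eventually_elim (simp add: metric_lift lift_tangent d_lift)
    then have "basic u p (\<lambda>z. g z (basic v z) (basic w z)) = basic u p ((\<lambda>y. h y (v y) (w y)) \<circ> \<pi>)"
      by (rule M.tangent_cong[OF lt[OF u] p])
    also have "\<dots> = d p (basic u p) (\<lambda>y. h y (v y) (w y))"
      by (rule differential_apply[OF B.metric_smooth[OF v w], symmetric])
    also have "d p (basic u p) = u (\<pi> p)" using d_lift[OF p B.field_tangent[OF u]] .
    finally have "g p (nablaM p (basic u p) (basic v)) (basic w p) + g p (basic v p) (nablaM p (basic u p) (basic w)) =
        h (\<pi> p) (nablaB (\<pi> p) (u (\<pi> p)) v) (w (\<pi> p)) + h (\<pi> p) (v (\<pi> p)) (nablaB (\<pi> p) (u (\<pi> p)) w)"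
      by (simp only: M.nabla_metric[OF lt[OF u] basic_field[OF v] basic_field[OF w]]
          B.nabla_metric[OF B.field_tangent[OF u] v w])
    then show ?thesis
      using M.metric_sym[OF p lt[OF v] nt[OF u w]]
        B.metric_sym[OF pB B.field_tangent[OF v] B.nabla_tangent[OF B.field_tangent[OF u] w]]
      by (simp add: D_def)
  qed
  have sym: "D u v w = D v u w"
    if u: "smooth_field_at B (\<pi> p) u" and v: "smooth_field_at B (\<pi> p) v"
      and w: "smooth_field_at B (\<pi> p) w" for u v w
  proof -
    let ?m = "nablaM p (basic u p) (basic v) - nablaM p (basic v p) (basic u)"
    let ?b = "nablaB (\<pi> p) (u (\<pi> p)) v - nablaB (\<pi> p) (v (\<pi> p)) u"
    have m: "?m \<in> tangent_space M p" using nt u v by (intro M.tangent_vdiff p)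
    have "d p ?m = ?b"
      using bracket_related[OF basic_field[OF u] basic_field[OF v] u v basic_related[OF u] basic_related[OF v]]
      by (simp only: M.nabla_torsion[OF basic_field[OF u] basic_field[OF v]] B.nabla_torsion[OF u v])
    \<comment> \<open>\<open>basic w p\<close> is a lift, so by adjointness its product with
      \<open>?m\<close> depends only on the image of \<open>?m\<close> in \<open>B\<close>.\<close>
    then have "g p ?m (basic w p) = h (\<pi> p) ?b (w (\<pi> p))"
      using metric_lift[OF p B.field_tangent[OF w] m] M.metric_sym[OF p lt[OF w] m]
        B.metric_sym[OF pB B.field_tangent[OF w] differential_tangent[OF m]] by simp
    moreover have "g p ?m (basic w p) = g p (nablaM p (basic u p) (basic v)) (basic w p) -
        g p (nablaM p (basic v p) (basic u)) (basic w p)"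
      by (rule M.metric_diff_left[OF p nt[OF u v] nt[OF v u] lt[OF w]])
    moreover have "h (\<pi> p) ?b (w (\<pi> p)) = h (\<pi> p) (nablaB (\<pi> p) (u (\<pi> p)) v) (w (\<pi> p)) -
        h (\<pi> p) (nablaB (\<pi> p) (v (\<pi> p)) u) (w (\<pi> p))"
      using u v w by (intro B.metric_diff_left[OF pB] B.nabla_tangent B.field_tangent)
    ultimately show ?thesis by (simp add: D_def)
  qed
  obtain u where u: "smooth_field_at B (\<pi> p) u" "u (\<pi> p) = x" using B.field_extension[OF x pB] by blast
  have n: "nablaM p (lift p x) (basic y) \<in> tangent_space M p" using nt[OF u(1) y] u(2) by simp
  show "d p (nablaM p (lift p x) (basic y)) \<in> tangent_space B (\<pi> p)"
    using n by (rule differential_tangent)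
  show "nablaB (\<pi> p) x y \<in> tangent_space B (\<pi> p)" by (rule B.nabla_tangent[OF x y])
  fix t assume t: "t \<in> tangent_space B (\<pi> p)"
  obtain w where w: "smooth_field_at B (\<pi> p) w" "w (\<pi> p) = t" using B.field_extension[OF t pB] by blast
  \<comment> \<open>Alternating the two symmetries returns to the start with the opposite sign: D u
    y w = D y u w = - D y w u = - D w y u = D w u y = D u w y = - D u y w.\<close>
  have "D u y w = 0"
    using sym[OF u(1) y w(1)] skew[OF y u(1) w(1)] sym[OF y w(1) u(1)] skew[OF w(1) y u(1)]
      sym[OF w(1) u(1) y] skew[OF u(1) w(1) y] by simp
  then have "g p (lift p t) (nablaM p (lift p x) (basic y)) = h (\<pi> p) (nablaB (\<pi> p) x y) t"
    using M.metric_sym[OF p lt[OF w(1)] n] w(2) u(2) by (simp add: D_def)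
  then show "h (\<pi> p) (d p (nablaM p (lift p x) (basic y))) t = h (\<pi> p) (nablaB (\<pi> p) x y) t"
    using metric_lift[OF p t n] B.metric_sym[OF pB t differential_tangent[OF n]] by simp
qed

end

section \<open>Geometry of the total lift\<close>

context
  fixes P Q p
  assumes P: "nondegenerate_submanifold B h P" and Q: "Q = total_lift M \<pi> P" and pQ: "p \<in> Q"
begin

lemma Q_points: "x \<in> Q \<Longrightarrow> x \<in> points M" and Q_P: "x \<in> Q \<Longrightarrow> \<pi> x \<in> P"
  by (auto simp: Q total_lift_def)

lemma Q_tangent:
  "x \<in> Q \<Longrightarrow> sub_tangent_space M Q x = {v \<in> tangent_space M x. d x v \<in> sub_tangent_space B P (\<pi> x)}"
  using sub_tangent_total_lift[of x P] d_onto[of x] Q_points[of x] by (simp add: Q)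

lemma P_submanifold: "submanifold B P"
  using P by (simp add: nondegenerate_submanifold_def)

lemma lift_sub_tangent:
  "x \<in> Q \<Longrightarrow> t \<in> sub_tangent_space B P (\<pi> x) \<Longrightarrow> lift x t \<in> sub_tangent_space M Q x"
  by (simp add: Q_tangent lift_tangent Q_points B.sub_tangent_tangent d_lift)

lemma Ver_sub_tangent: "x \<in> Q \<Longrightarrow> v \<in> Ver x \<Longrightarrow> v \<in> sub_tangent_space M Q x"
  using subspace_0[OF B.subspace_sub_tangent[OF P_submanifold Q_P]]
  by (simp add: Q_tangent vertical_space_def)

text \<open>The residue of the claimed projection is the lift of a vector of \<open>B\<close>
  orthogonal to \<open>P\<close>, and adjointness moves its products with tangent vectors of
  \<open>Q\<close> down to \<open>P\<close>. The uniqueness argument amounts to nondegeneracy of the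
  tangent space of \<open>Q\<close>, deduced from that of \<open>P\<close> and of the fibre.\<close>

lemma tangential_part_Q:
  assumes x: "x \<in> Q" and v: "v \<in> tangent_space M x"
  shows "tangential_part M g Q x v = ver x v + lift x (tangential_part B h P (\<pi> x) (d x v))"
proof -
  let ?t = "tangential_part B h P (\<pi> x) (d x v)"
  have px: "x \<in> points M" and pB: "\<pi> x \<in> points B" using x Q_points map_points by auto
  have dv: "d x v \<in> tangent_space B (\<pi> x)" using v by (rule differential_tangent)
  note t = B.tangential_part_exists[OF P Q_P[OF x] dv]
  have tt: "?t \<in> tangent_space B (\<pi> x)" using t(1) by (rule B.sub_tangent_tangent)
  let ?w = "ver x v + lift x ?t"
  have vt: "ver x v \<in> tangent_space M x" using ver_in[OF px v] by (rule Ver_tangent)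
  have lt: "lift x ?t \<in> tangent_space M x" by (rule lift_tangent[OF px tt])
  have dver: "d x (ver x v) = 0" using ver_in[OF px v] by (simp add: vertical_space_def)
  have w: "?w \<in> tangent_space M x" "d x ?w = ?t"
    using vt lt by (simp_all add: M.tangent_vadd px d_add dver d_lift tt)
  have wQ: "?w \<in> sub_tangent_space M Q x" using w t(1) by (simp add: Q_tangent x)
  have orth: "g x (v - ?w) s = 0" if s: "s \<in> sub_tangent_space M Q x" for s
  proof -
    have st: "s \<in> tangent_space M x" "d x s \<in> sub_tangent_space B P (\<pi> x)" using s by (auto simp: Q_tangent x)
    have ldv: "lift x (d x v) \<in> tangent_space M x" by (rule lift_tangent[OF px dv])
    have "v - ?w = lift x (d x v) - lift x ?t" by (simp add: ver_eq[OF px v])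
    then have "g x (v - ?w) s = g x (lift x (d x v)) s - g x (lift x ?t) s"
      using M.metric_diff_left[OF px ldv lt st(1)] by metis
    also have "\<dots> = h (\<pi> x) (d x v - ?t) (d x s)"
      by (simp add: metric_lift[OF px] dv tt st B.metric_diff_left[OF pB] differential_tangent)
    also have "\<dots> = 0" by (rule t(2)[OF st(2)])
    finally show ?thesis .
  qed
  show ?thesis
    unfolding tangential_part_def[of M] orth_projection_def
  proof (rule the_equality)
    fix w' assume w': "w' \<in> sub_tangent_space M Q x \<and> (\<forall>u\<in>sub_tangent_space M Q x. g x (v - w') u = 0)"
    have wt': "w' \<in> tangent_space M x" "d x w' \<in> sub_tangent_space B P (\<pi> x)" using w' by (auto simp: Q_tangent x)
    have 0: "g x (w' - ?w) s = 0" if s: "s \<in> sub_tangent_space M Q x" for s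
    proof -
      have "s \<in> tangent_space M x" "g x (v - w') s = 0" "g x (v - ?w) s = 0"
        using s w' orth by (auto intro: M.sub_tangent_tangent)
      then show ?thesis using v wt' w(1) by (simp add: M.metric_diff_left[OF px])
    qed
    have m: "w' - ?w \<in> tangent_space M x" using wt' w by (intro M.tangent_vdiff px)
    \<comment> \<open>Testing the difference of two candidates against lifts of vectors tangent to
      \<open>P\<close> kills its image, by nondegeneracy of \<open>P\<close>. It is then vertical,
      and testing against vertical vectors, all tangent to \<open>Q\<close>, finishes.\<close>
    have "d x (w' - ?w) = 0"
    proof -
      have mem: "d x (w' - ?w) \<in> sub_tangent_space B P (\<pi> x)"
        using subspace_diff[OF B.subspace_sub_tangent[OF P_submanifold Q_P[OF x]] wt'(2) t(1)] w(2)
        by (simp add: d_diff)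
      have "h (\<pi> x) (d x (w' - ?w)) s = 0" if s: "s \<in> sub_tangent_space B P (\<pi> x)" for s
      proof -
        have st: "s \<in> tangent_space B (\<pi> x)" using s by (rule B.sub_tangent_tangent)
        have "g x (w' - ?w) (lift x s) = 0" using lift_sub_tangent[OF x s] 0 by blast
        then have "h (\<pi> x) s (d x (w' - ?w)) = 0"
          using metric_lift[OF px st m] M.metric_sym[OF px m lift_tangent[OF px st]] by simp
        then show ?thesis using B.metric_sym[OF pB st differential_tangent[OF m]] by simp
      qed
      then show ?thesis
        using P Q_P[OF x] mem unfolding nondegenerate_submanifold_def nondegenerate_on_def by blast
    qed
    then have "w' - ?w \<in> Ver x" using m by (simp add: vertical_space_def)
    moreover have "\<forall>s\<in>Ver x. g x (w' - ?w) s = 0" using 0 Ver_sub_tangent[OF x] by blast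
    ultimately have "w' - ?w = 0" using Ver_nondegenerate[OF px] unfolding nondegenerate_on_def by blast
    then show "w' = ?w" by simp
  qed (use wQ orth in blast)
qed

text \<open>Vertical vectors and lifts of vectors tangent to \<open>P\<close> are both tangent to
  \<open>Q\<close>: the first make \<open>z\<close> horizontal, the second make its image normal to
  \<open>P\<close>.\<close>

lemma normal_Hor:
  assumes "z \<in> normal_subspace M g Q p"
  shows "z \<in> Hor p" "d p z \<in> normal_subspace B h P (\<pi> p)"
proof -
  have p: "p \<in> points M" using Q_points[OF pQ] .
  have z: "z \<in> tangent_space M p" "\<And>t. t \<in> sub_tangent_space M Q p \<Longrightarrow> g p z t = 0"
    using assms by (auto simp: normal_subspace_def orth_complement_def)
  show H: "z \<in> Hor p"
    using z Ver_sub_tangent[OF pQ] by (simp add: horizontal_space_def orth_complement_def)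
  have dz: "d p z \<in> tangent_space B (\<pi> p)" using z(1) by (rule differential_tangent)
  have "h (\<pi> p) (d p z) t = 0" if t: "t \<in> sub_tangent_space B P (\<pi> p)" for t
  proof -
    have tt: "t \<in> tangent_space B (\<pi> p)" using t by (rule B.sub_tangent_tangent)
    have "g p z (lift p t) = 0" using z(2) lift_sub_tangent[OF pQ t] by blast
    then show ?thesis
      using d_isometry[OF p H lift_Hor[OF p tt]] by (simp add: d_lift[OF p tt])
  qed
  then show "d p z \<in> normal_subspace B h P (\<pi> p)"
    using dz by (simp add: normal_subspace_def orth_complement_def)
qed

text \<open>At points of \<open>Q\<close>, adjointness of the lift turns products with vectors
  tangent to \<open>Q\<close> into products of \<open>w\<close> with vectors tangent to
  \<open>P\<close>.\<close>

lemma basic_normal_extension: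
  assumes w: "normal_extension B h P (\<pi> p) (d p z) w" and z: "z \<in> Hor p"
  shows "normal_extension M g Q p z (basic w)"
proof -
  have p: "p \<in> points M" using Q_points[OF pQ] .
  have sw: "smooth_field_at B (\<pi> p) w" and wp: "w (\<pi> p) = d p z"
    and ew: "eventually (\<lambda>y. y \<in> P \<longrightarrow> w y \<in> normal_subspace B h P y) (nhdsin (mtop B) (\<pi> p))"
    using w by (auto simp: normal_extension_def eventually_nhdsin)
  have "eventually (\<lambda>x. x \<in> Q \<longrightarrow> basic w x \<in> normal_subspace M g Q x) (nhdsin (mtop M) p)"
    using map_eventually[OF ew p]
  proof (eventually_elim, intro impI)
    fix x assume "\<pi> x \<in> P \<longrightarrow> w (\<pi> x) \<in> normal_subspace B h P (\<pi> x)" and x: "x \<in> Q"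
    then have n: "w (\<pi> x) \<in> tangent_space B (\<pi> x)" "\<And>t. t \<in> sub_tangent_space B P (\<pi> x) \<Longrightarrow> h (\<pi> x) (w (\<pi> x)) t = 0"
      using Q_P[OF x] by (auto simp: normal_subspace_def orth_complement_def)
    have px: "x \<in> points M" using Q_points[OF x] .
    show "basic w x \<in> normal_subspace M g Q x"
      using n by (auto simp: normal_subspace_def orth_complement_def lift_tangent[OF px] metric_lift[OF px] Q_tangent[OF x])
  qed
  moreover have "basic w p = z" using lift_eqI[OF p z] wp by simp
  ultimately show ?thesis
    unfolding normal_extension_def using basic_field[OF p sw] p by (auto simp: eventually_nhdsin)
qed

text \<open>Supplies the hypothesis \<open>ext\<close> of \<open>shape_operator_eq\<close> for
  \<open>Q\<close>. The vertical part of \<open>y\<close> is extended by a vertical field, tangent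
  to \<open>Q\<close> automatically, and its horizontal part by the lift of a field tangent to
  \<open>P\<close>.\<close>

lemma Q_tangent_extension:
  assumes "y \<in> sub_tangent_space M Q p"
  shows "\<exists>Y. smooth_field_at M p Y \<and> Y p = y \<and>
      eventually (\<lambda>x. x \<in> Q \<longrightarrow> Y x \<in> sub_tangent_space M Q x) (nhdsin (mtop M) p)"
proof -
  have p: "p \<in> points M" using Q_points[OF pQ] .
  have y: "y \<in> tangent_space M p" "d p y \<in> sub_tangent_space B P (\<pi> p)"
    using assms by (auto simp: Q_tangent[OF pQ])
  obtain F where F: "smooth_field_at M p F" "F p = y" using M.field_extension[OF y(1) p] by blast
  obtain w where w: "smooth_field_at B (\<pi> p) w" "w (\<pi> p) = d p y"
    "eventually (\<lambda>x. x \<in> P \<longrightarrow> w x \<in> sub_tangent_space B P x) (nhdsin (mtop B) (\<pi> p))"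
    using B.tangent_extension[OF P_submanifold Q_P[OF pQ] y(2)] by blast
  let ?Y = "\<lambda>x. ver x (F x) + basic w x"
  have "smooth_field_at M p ?Y" by (intro M.field_add field_ver F basic_field p w)
  moreover have "?Y p = y" using w(2) F(2) by (simp add: ver_eq[OF p y(1)])
  moreover have "eventually (\<lambda>x. x \<in> Q \<longrightarrow> ?Y x \<in> sub_tangent_space M Q x) (nhdsin (mtop M) p)"
    using map_eventually[OF w(3) p] M.eventually_field_tangent[OF F(1)]
  proof (eventually_elim, intro impI)
    fix x assume *: "\<pi> x \<in> P \<longrightarrow> w (\<pi> x) \<in> sub_tangent_space B P (\<pi> x)" "F x \<in> tangent_space M x" and x: "x \<in> Q"
    have px: "x \<in> points M" using Q_points[OF x] .
    have wx: "w (\<pi> x) \<in> sub_tangent_space B P (\<pi> x)" using * Q_P[OF x] by blast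
    have "ver x (F x) \<in> Ver x" using ver_in[OF px] * by blast
    then have "ver x (F x) \<in> tangent_space M x" "d x (ver x (F x)) = 0" by (auto simp: vertical_space_def)
    then show "?Y x \<in> sub_tangent_space M Q x"
      using wx B.sub_tangent_tangent[OF wx]
      by (simp add: Q_tangent[OF x] M.tangent_vadd[OF px] lift_tangent[OF px] d_add d_lift[OF px])
  qed
  ultimately show ?thesis by blast
qed

lemma shape_operator_total_lift:
  assumes V: "V \<in> Ver p" and X: "X \<in> Hor p" "X \<in> sub_tangent_space M Q p"
    and Z: "Z \<in> normal_subspace M g Q p"
  shows "shape_operator M g nablaM Q p V Z =
      oneill_T M g nablaM B \<pi> p V Z + tangential_part M g Q p (oneill_A M g nablaM B \<pi> p Z V)"
    and "shape_operator M g nablaM Q p X Z = oneill_A M g nablaM B \<pi> p X Z +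
      lift p (shape_operator B h nablaB P (\<pi> p) (d p X) (d p Z))"
proof -
  have p: "p \<in> points M" and pB: "\<pi> p \<in> points B" using Q_points[OF pQ] map_points by auto
  have ZH: "Z \<in> Hor p" and dZ: "d p Z \<in> normal_subspace B h P (\<pi> p)" using normal_Hor[OF Z] by auto
  have Vt: "V \<in> tangent_space M p" and Xt: "X \<in> tangent_space M p" and Zt: "Z \<in> tangent_space M p"
    using V X ZH Ver_tangent Hor_tangent by auto
  obtain w where w: "normal_extension B h P (\<pi> p) (d p Z) w"
    using B.normal_extension_exists[OF P Q_P[OF pQ] dZ] by blast
  then have sw: "smooth_field_at B (\<pi> p) w" by (simp add: normal_extension_def)
  define W where "W = basic w"
  have neW: "normal_extension M g Q p Z W" unfolding W_def by (rule basic_normal_extension[OF w ZH])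
  have W: "smooth_field_at M p W" "W p = Z" using neW by (auto simp: normal_extension_def)
  have WH: "eventually (\<lambda>x. W x \<in> Hor x) (nhdsin (mtop M) p)" unfolding W_def by (rule basic_Hor[OF p sw])
  \<comment> \<open>With this splitting, each formula reduces to identifying two things: the
    vertical part of \<open>nablaM p v W\<close> and its image in \<open>B\<close>.\<close>
  have shape: "shape_operator M g nablaM Q p v Z = ver p (nablaM p v W) +
      lift p (tangential_part B h P (\<pi> p) (d p (nablaM p v W)))"
    if v: "v \<in> sub_tangent_space M Q p" for v
    using M.shape_operator_eq[OF v neW Q_tangent_extension]
      tangential_part_Q[OF pQ M.nabla_tangent[OF M.sub_tangent_tangent[OF v] W(1)]] by simp
  obtain F0 where F0: "smooth_field_at M p F0" "F0 p = V" using M.field_extension[OF Vt p] by blast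
  define F where "F x = ver x (F0 x)" for x
  have F: "smooth_field_at M p F" "F p = V"
    using field_ver[OF F0(1)] F0(2) ver_Ver[OF p V] by (simp_all add: F_def[abs_def])
  have FV: "eventually (\<lambda>x. F x \<in> Ver x) (nhdsin (mtop M) p)"
    using M.eventually_field_tangent[OF F0(1)] M.eventually_points
    by eventually_elim (simp add: F_def ver_in)
  have nt: "nablaM p Z F \<in> tangent_space M p" "nablaM p V W \<in> tangent_space M p"
    by (rule M.nabla_tangent[OF Zt F(1)], rule M.nabla_tangent[OF Vt W(1)])
  have "d p (lie_bracket M p F W) = lie_bracket B (\<pi> p) (\<lambda>x. 0) w"
  proof (rule bracket_related[OF F(1) W(1) B.field_zero[OF pB] sw])
    show "eventually (\<lambda>z. d z (F z) = 0) (nhdsin (mtop M) p)"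
      using FV by eventually_elim (simp add: vertical_space_def)
    show "eventually (\<lambda>z. d z (W z) = w (\<pi> z)) (nhdsin (mtop M) p)"
      unfolding W_def by (rule basic_related[OF p sw])
  qed
  \<comment> \<open>One term of the bracket applies the zero vector, the other differentiates the
    constant 0.\<close>
  also have "\<dots> = 0"
    by (simp add: fun_eq_iff lie_bracket_def B.tangent_const[OF B.field_tangent[OF sw] pB])
  finally have "d p (nablaM p V W - nablaM p Z F) = 0"
    using M.nabla_torsion[OF F(1) W(1)] F(2) W(2) by simp
  then have bracket: "d p (nablaM p V W) = d p (nablaM p Z F)" by (simp add: d_diff)
  have T: "oneill_T M g nablaM B \<pi> p V Z = ver p (nablaM p V W)"
    using oneill_T_eq[of p V W] oneill_horizontal[OF Vt W(1) WH] Vt W by (simp add: ver_Ver[OF p V])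
  have "oneill_A M g nablaM B \<pi> p Z V = hor p (nablaM p Z F)"
    using oneill_A_eq[of p Z F] oneill_vertical[OF Zt F(1) FV] Zt F by (simp add: hor_Hor[OF p ZH])
  \<comment> \<open>This vector is horizontal, so only the lifted summand of
    \<open>tangential_part_Q\<close> survives.\<close>
  moreover have "tangential_part M g Q p (hor p (nablaM p Z F)) =
      lift p (tangential_part B h P (\<pi> p) (d p (nablaM p Z F)))"
    using tangential_part_Q[OF pQ Hor_tangent[OF hor_in[OF p nt(1)]]]
    by (simp add: ver_Hor[OF p hor_in[OF p nt(1)]] d_hor[OF p nt(1)])
  ultimately show "shape_operator M g nablaM Q p V Z =
      oneill_T M g nablaM B \<pi> p V Z + tangential_part M g Q p (oneill_A M g nablaM B \<pi> p Z V)"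
    using shape[OF Ver_sub_tangent[OF pQ V]] T bracket by simp
  have dX: "d p X \<in> sub_tangent_space B P (\<pi> p)" using X(2) by (simp add: Q_tangent[OF pQ])
  have "lift p (d p X) = X" using lift_eqI[OF p X(1)] by simp
  then have "d p (nablaM p X W) = nablaB (\<pi> p) (d p X) w"
    using d_nabla_basic[OF p B.sub_tangent_tangent[OF dX] sw] by (simp add: W_def)
  \<comment> \<open>The shape operator of \<open>P\<close> is evaluated with the very field
    \<open>w\<close> whose lift is \<open>W\<close>, so both sides involve the same derivative in
    \<open>B\<close>.\<close>
  moreover have "shape_operator B h nablaB P (\<pi> p) (d p X) (d p Z) =
      tangential_part B h P (\<pi> p) (nablaB (\<pi> p) (d p X) w)"
    by (rule B.shape_operator_eq[OF dX w]) (metis B.tangent_extension[OF P_submanifold Q_P[OF pQ]])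
  moreover have "oneill_A M g nablaM B \<pi> p X Z = ver p (nablaM p X W)"
    using oneill_A_eq[of p X W] oneill_horizontal[OF Xt W(1) WH] Xt W by (simp add: hor_Hor[OF p X(1)])
  ultimately show "shape_operator M g nablaM Q p X Z = oneill_A M g nablaM B \<pi> p X Z +
      lift p (shape_operator B h nablaB P (\<pi> p) (d p X) (d p Z))"
    using shape[OF X(2)] by simp
qed

end

end

theorem proposition3p11:
  fixes M :: "('a, 'e::euclidean_space) manifold" and g :: "'a metric"
    and B :: "('b, 'f::euclidean_space) manifold" and h :: "'b metric"
    and nablaM :: "'a connection" and nablaB :: "'b connection"
    and \<pi> :: "'a \<Rightarrow> 'b" and P :: "'b set" and Q :: "'a set"
    and q :: 'a and V X Z :: "'a tvec"
  assumes submersion: "semi_riemannian_submersion M g B h \<pi>"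
    and nablaM: "levi_civita M g nablaM"
    and nablaB: "levi_civita B h nablaB"
    and P: "nondegenerate_submanifold B h P"
    and Q: "Q = total_lift M \<pi> P"
    and q: "q \<in> Q"
    and V: "V \<in> vertical_space M B \<pi> q"
    and X: "X \<in> horizontal_space M g B \<pi> q" "X \<in> sub_tangent_space M Q q"
    and Z: "Z \<in> normal_subspace M g Q q"
  shows "shape_operator M g nablaM Q q V Z =
           oneill_T M g nablaM B \<pi> q V Z +
           tangential_part M g Q q (oneill_A M g nablaM B \<pi> q Z V) \<and>
         shape_operator M g nablaM Q q X Z =
           oneill_A M g nablaM B \<pi> q X Z +
           horizontal_lift M g B \<pi> q
             (shape_operator B h nablaB P (\<pi> q) (differential B \<pi> q X) (differential B \<pi> q Z))"
proof -
  have "semi_riemannian_manifold M g" "semi_riemannian_manifold B h" "smooth_map M B \<pi>"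
    using submersion unfolding semi_riemannian_submersion_def by auto
  moreover from this have "smooth_manifold M" "smooth_manifold B"
    by (simp_all add: semi_riemannian_manifold_def)
  ultimately interpret submersion M g nablaM B h nablaB \<pi>
    using nablaM nablaB submersion by unfold_locales
  show ?thesis
    using shape_operator_total_lift[OF P Q q V X Z] by (rule conjI)
qed

end
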